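(* Let $A$ be a sectorial operator on a complex Banach space $X$, let $\omega\in(\omega_{\mathrm{se}}(A),\pi)$, and let $(f_n)_n$ be a sequence in $\mathrm{H}^\infty(S_\omega\cup\{0\})$ such that $f_n\to0$ pointwise and boundedly on $S_\omega\cup\{0\}$. Suppose that for each $n$, $f_n$ lies in the domain of the sectorial calculus $\Phi_A$ with $\Phi_A(f_n)\in\mathcal{L}(X)$, and that $\Phi_A(f_n)\xrightarrow{\tau_A^s}T$ for some $T\in\mathcal{A}_A$. Then $T=0$.
   Context: For $\omega\in(0,\pi]$, $S_\omega=\{z\in\mathbb{C}\setminus\{0\}:|\arg z|<\omega\}$, $\overline{S_0}=[0,\infty)$. A closed operator $A$ on $X$ is sectorial if there is $\omega\in[0,\pi)$ with $\sigma(A)\subseteq\overline{S_\omega}$ and $\sup\{\|\lambda R(\lambda,A)\|:\lambda\notin\overline{S_{\omega'}}\}<\infty$ for every $\omega'\in(\omega,\pi)$; $\omega_{\mathrm{se}}(A)$ is the minimal such $\omega$. For $\omega>0$, $\mathcal{E}(S_\omega)$ is the set of bounded holomorphic $f$ on $S_\omega$ with $\int_{\partial S_\delta}|f(z)|\,|dz|/|z|<\infty$ for all $0\le\delta<\omega$. For $\omega>\omega_{\mathrm{se}}(A)$ and $f\in\mathcal{E}(S_\omega)$, $\Phi_A^\omega(f)=\frac{1}{2\pi i}\int_{\partial S_\delta}f(z)R(z,A)\,dz$ with $\delta\in(\omega_{\mathrm{se}}(A),\omega)$, $\partial S_\delta$ oriented positively around $\overline{S_{\omega_{\mathrm{se}}(A)}}$.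 Let $\mathcal{E}_e(S_\omega)=\mathcal{E}(S_\omega)\oplus\mathbb{C}\mathbf{1}\oplus\mathbb{C}(1+z)^{-1}$ and extend $\Phi_A^\omega$ linearly by $\Phi_A^\omega(\mathbf{1})=I$, $\Phi_A^\omega((1+z)^{-1})=(1+A)^{-1}$ (an algebra homomorphism). A meromorphic $f$ on $S_\omega$ is in $\mathrm{dom}(\Phi_A^\omega)$ if $[f]:=\{e\in\mathcal{E}_e(S_\omega): ef\in\mathcal{E}_e(S_\omega)\}$ satisfies $\bigcap_{e\in[f]}\ker\Phi_A^\omega(e)=\{0\}$ (with $[f]\ne\emptyset$), and then $\Phi_A^\omega(f)x=y$ iff $\Phi_A^\omega(ef)x=\Phi_A^\omega(e)y$ for all $e\in[f]$. The sectorial calculus: a meromorphic $f$ on $S_\omega$ is in $\mathrm{dom}(\Phi_A)$ if $f|_{S_{\omega'}}\in\mathrm{dom}(\Phi_A^{\omega'})$ for some $\omega'\in(\omega_{\mathrm{se}}(A),\omega]$, and $\Phi_A(f):=\Phi_A^{\omega'}(f|_{S_{\omega'}})$ (independent of $\omega'$). $\mathrm{H}^\infty(S_\omega\cup\{0\})$ is the set of bounded holomorphic $f$ on $S_\omega$ for which $f(0):=\lim_{z\searrow0}f(z)$ exists; $f_n\to f$ pointwise and boundedly on $S_\omega\cup\{0\}$ means $f_n(z)\to f(z)$ for all $z\in S_\omega\cup\{0\}$ and $\sup_n\|f_n\|_{\infty,S_\omega}<\infty$. $\mathcal{A}_A=\{S\in\mathcal{L}(X): S(1+A)^{-1}=(1+A)^{-1}S\}$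 and $\mathcal{A}_A'$ is the set of bounded operators commuting with every element of $\mathcal{A}_A$. For $T_n,T\in\mathcal{A}_A$, $T_n\xrightarrow{\tau_A^s}T$ means there is a set $\mathcal{D}\subseteq\mathcal{A}_A'$ with $\bigcap_{D\in\mathcal{D}}\ker D=\{0\}$ and $DT_n\to DT$ strongly for each $D\in\mathcal{D}$. *)

theory Defs
  imports "HOL-Analysis.Analysis" "HOL-Complex_Analysis.Complex_Analysis"
begin

class complex_vector = real_vector +
  fixes scaleC :: "complex \<Rightarrow> 'a \<Rightarrow> 'a"
  assumes scaleC_add_right: "scaleC a (x + y) = scaleC a x + scaleC a y"
    and scaleC_add_left: "scaleC (a + b) x = scaleC a x + scaleC b x"
    and scaleC_scaleC: "scaleC a (scaleC b x) = scaleC (a * b) x"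
    and scaleC_one: "scaleC 1 x = x"
    and scaleR_scaleC: "scaleR r x = scaleC (of_real r) x"

class complex_normed_vector = complex_vector + real_normed_vector +
  assumes norm_scaleC: "norm (scaleC a x) = cmod a * norm x"

class complex_banach = complex_normed_vector + banach

definition cblin :: "('a::complex_normed_vector \<Rightarrow> 'a) \<Rightarrow> bool" where
  "cblin S \<longleftrightarrow> bounded_linear S \<and> (\<forall>c x. S (scaleC c x) = scaleC c (S x))"

definition sector :: "real \<Rightarrow> complex set" where
  "sector w = {z. z \<noteq> 0 \<and> \<bar>Arg z\<bar> < w}"

definition csector :: "real \<Rightarrow> complex set" where
  "csector w = {z. z = 0 \<or> \<bar>Arg z\<bar> \<le> w}"

text \<open>An (unbounded) operator is a pair: a domain Dom and a map A, relevant on Dom.\<close>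
definition closed_op :: "'a::complex_banach set \<Rightarrow> ('a \<Rightarrow> 'a) \<Rightarrow> bool" where
  "closed_op Dom A \<longleftrightarrow>
     0 \<in> Dom \<and>
     (\<forall>x\<in>Dom. \<forall>y\<in>Dom. x + y \<in> Dom \<and> A (x + y) = A x + A y) \<and>
     (\<forall>c. \<forall>x\<in>Dom. scaleC c x \<in> Dom \<and> A (scaleC c x) = scaleC c (A x)) \<and>
     closed {(x, A x) | x. x \<in> Dom}"

definition resolvent :: "'a::complex_banach set \<Rightarrow> ('a \<Rightarrow> 'a) \<Rightarrow> complex \<Rightarrow> 'a \<Rightarrow> 'a" where
  "resolvent Dom A lam = inv_into Dom (\<lambda>x. scaleC lam x - A x)"

definition resolvent_set :: "'a::complex_banach set \<Rightarrow> ('a \<Rightarrow> 'a) \<Rightarrow> complex set" where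
  "resolvent_set Dom A = {lam. bij_betw (\<lambda>x. scaleC lam x - A x) Dom UNIV \<and>
                              (\<exists>C. \<forall>y. norm (resolvent Dom A lam y) \<le> C * norm y)}"

definition spectrum_op :: "'a::complex_banach set \<Rightarrow> ('a \<Rightarrow> 'a) \<Rightarrow> complex set" where
  "spectrum_op Dom A = - resolvent_set Dom A"

definition sect_cond :: "'a::complex_banach set \<Rightarrow> ('a \<Rightarrow> 'a) \<Rightarrow> real \<Rightarrow> bool" where
  "sect_cond Dom A w \<longleftrightarrow> spectrum_op Dom A \<subseteq> csector w \<and>
     (\<forall>w'. w < w' \<and> w' < pi \<longrightarrow>
        (\<exists>M. \<forall>lam. lam \<notin> csector w' \<longrightarrow>
               (\<forall>y. cmod lam * norm (resolvent Dom A lam y) \<le> M * norm y)))"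

definition sectorial :: "'a::complex_banach set \<Rightarrow> ('a \<Rightarrow> 'a) \<Rightarrow> bool" where
  "sectorial Dom A \<longleftrightarrow> closed_op Dom A \<and> (\<exists>w. 0 \<le> w \<and> w < pi \<and> sect_cond Dom A w)"

definition omega_se :: "'a::complex_banach set \<Rightarrow> ('a \<Rightarrow> 'a) \<Rightarrow> real" where
  "omega_se Dom A = Inf {w. 0 \<le> w \<and> w < pi \<and> sect_cond Dom A w}"

definition one_plus_inv :: "'a::complex_banach set \<Rightarrow> ('a \<Rightarrow> 'a) \<Rightarrow> 'a \<Rightarrow> 'a" where
  "one_plus_inv Dom A = inv_into Dom (\<lambda>x. x + A x)"

text \<open>The class E(S_w): bounded holomorphic functions with
  int_{dS_d} |f(z)| |dz|/|z| < oo for all 0 <= d < w; dS_d consists of the rays t e^{+-id}, t > 0.\<close>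
definition Ecl :: "real \<Rightarrow> (complex \<Rightarrow> complex) set" where
  "Ecl w = {f. f holomorphic_on sector w \<and> bounded (f ` sector w) \<and>
     (\<forall>d. 0 \<le> d \<and> d < w \<longrightarrow>
        set_integrable lborel {0<..} (\<lambda>t::real. cmod (f (of_real t * cis d)) / t) \<and>
        set_integrable lborel {0<..} (\<lambda>t::real. cmod (f (of_real t * cis (- d))) / t))}"

text \<open>Phi_A^w(f) = 1/(2 pi i) int_{dS_d} f(z) R(z,A) dz, with d in (omega_se(A), w); the path
  runs from oo e^{id} to 0 and then from 0 to oo e^{-id} (positive orientation around the
  sector containing the spectrum).  We take d = (omega_se(A) + w)/2.\<close>
definition Phi_E :: "'a::complex_banach set \<Rightarrow> ('a \<Rightarrow> 'a) \<Rightarrow> real \<Rightarrow> (complex \<Rightarrow> complex) \<Rightarrow> 'a \<Rightarrow> 'a" where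
  "Phi_E Dom A w f x =
     (let d = (omega_se Dom A + w) / 2 in
      scaleC (1 / (2 * pi * \<i>))
        (integral {0<..} (\<lambda>t::real. scaleC (f (of_real t * cis (- d)) * cis (- d))
                                           (resolvent Dom A (of_real t * cis (- d)) x))
         - integral {0<..} (\<lambda>t::real. scaleC (f (of_real t * cis d) * cis d)
                                           (resolvent Dom A (of_real t * cis d) x))))"

text \<open>Membership of a (meromorphic) function g in E_e(S_w) = E(S_w) + C 1 + C (1+z)^{-1}:
  g agrees, in a punctured neighbourhood of every point of S_w (i.e. as meromorphic
  functions), with h + a + b/(1+z), h in E(S_w).\<close>
definition Ee :: "real \<Rightarrow> (complex \<Rightarrow> complex) set" where
  "Ee w = {g. \<exists>h a b. h \<in> Ecl w \<and>
      (\<forall>z0\<in>sector w. \<forall>\<^sub>F z in at z0. g z = h z + a + b / (1 + z))}"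

definition Phi_e :: "'a::complex_banach set \<Rightarrow> ('a \<Rightarrow> 'a) \<Rightarrow> real \<Rightarrow> (complex \<Rightarrow> complex) \<Rightarrow> 'a \<Rightarrow> 'a" where
  "Phi_e Dom A w g = (THE T. \<exists>h a b. h \<in> Ecl w \<and>
      (\<forall>z0\<in>sector w. \<forall>\<^sub>F z in at z0. g z = h z + a + b / (1 + z)) \<and>
      T = (\<lambda>x. Phi_E Dom A w h x + scaleC a x + scaleC b (one_plus_inv Dom A x)))"

definition regs :: "real \<Rightarrow> (complex \<Rightarrow> complex) \<Rightarrow> (complex \<Rightarrow> complex) set" where
  "regs w f = {e \<in> Ee w. (\<lambda>z. e z * f z) \<in> Ee w}"

definition dom_Phi_w :: "'a::complex_banach set \<Rightarrow> ('a \<Rightarrow> 'a) \<Rightarrow> real \<Rightarrow> (complex \<Rightarrow> complex) \<Rightarrow> bool" where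
  "dom_Phi_w Dom A w f \<longleftrightarrow> f meromorphic_on sector w \<and> regs w f \<noteq> {} \<and>
     (\<forall>x. (\<forall>e\<in>regs w f. Phi_e Dom A w e x = 0) \<longrightarrow> x = 0)"

definition graph_Phi_w :: "'a::complex_banach set \<Rightarrow> ('a \<Rightarrow> 'a) \<Rightarrow> real \<Rightarrow> (complex \<Rightarrow> complex) \<Rightarrow> ('a \<times> 'a) set" where
  "graph_Phi_w Dom A w f = {(x, y). \<forall>e\<in>regs w f.
      Phi_e Dom A w (\<lambda>z. e z * f z) x = Phi_e Dom A w e y}"

definition Phi_sect_is :: "'a::complex_banach set \<Rightarrow> ('a \<Rightarrow> 'a) \<Rightarrow> real \<Rightarrow> (complex \<Rightarrow> complex) \<Rightarrow> ('a \<Rightarrow> 'a) \<Rightarrow> bool" where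
  "Phi_sect_is Dom A w f S \<longleftrightarrow>
     (\<exists>w'. omega_se Dom A < w' \<and> w' \<le> w \<and> dom_Phi_w Dom A w' f \<and>
           graph_Phi_w Dom A w' f = {(x, S x) | x. True})"

text \<open>f(0) is stored as the value of f at 0 and must equal lim_{z \<searrow> 0} f(z).\<close>
definition Hinf0 :: "real \<Rightarrow> (complex \<Rightarrow> complex) set" where
  "Hinf0 w = {f. f holomorphic_on sector w \<and> bounded (f ` sector w) \<and>
      ((\<lambda>t::real. f (of_real t)) \<longlongrightarrow> f 0) (at_right 0)}"

definition comm_alg :: "'a::complex_banach set \<Rightarrow> ('a \<Rightarrow> 'a) \<Rightarrow> ('a \<Rightarrow> 'a) set" where
  "comm_alg Dom A = {S. cblin S \<and> S \<circ> one_plus_inv Dom A = one_plus_inv Dom A \<circ> S}"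

definition comm_alg' :: "'a::complex_banach set \<Rightarrow> ('a \<Rightarrow> 'a) \<Rightarrow> ('a \<Rightarrow> 'a) set" where
  "comm_alg' Dom A = {D. cblin D \<and> (\<forall>S\<in>comm_alg Dom A. D \<circ> S = S \<circ> D)}"

definition tau_conv :: "'a::complex_banach set \<Rightarrow> ('a \<Rightarrow> 'a) \<Rightarrow> (nat \<Rightarrow> 'a \<Rightarrow> 'a) \<Rightarrow> ('a \<Rightarrow> 'a) \<Rightarrow> bool" where
  "tau_conv Dom A Tn T \<longleftrightarrow> (\<forall>n. Tn n \<in> comm_alg Dom A) \<and> T \<in> comm_alg Dom A \<and>
     (\<exists>\<D>. \<D> \<subseteq> comm_alg' Dom A \<and> (\<forall>x. (\<forall>D\<in>\<D>. D x = 0) \<longrightarrow> x = 0) \<and>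
          (\<forall>D\<in>\<D>. \<forall>x. (\<lambda>n. D (Tn n x)) \<longlonglongrightarrow> D (T x)))"

end

theory Submission
  imports Defs "HOL-Probability.Sinc_Integral"
begin

text \<open>
  Write \<open>B = (1 + A)\<^sup>-\<^sup>1\<close> and \<open>e\<^sub>0(z) = z / (1 + z)\<^sup>2\<close>, so that \<open>\<Phi>(e\<^sub>0) = B - B\<^sup>2\<close>. Let \<open>D\<close> be one of the
  operators that define the convergence to \<open>T\<close>, and let \<open>y = D T x\<close>. Dominated convergence on a fixed contour
  gives \<open>\<Phi>(e\<^sub>0 f\<^sub>n) x \<rightarrow> 0\<close>; this is \<open>(B - B\<^sup>2) \<Phi>(f\<^sub>n) x\<close>, hence \<open>(B - B\<^sup>2) y = 0\<close>, that is, \<open>A y = 0\<close>.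

  For \<open>h \<in> \<E>\<close> the range of \<open>\<Phi>(h)\<close> lies in the closure \<open>R\<close> of the range of \<open>A\<close>: modulo \<open>R\<close> the resolvent
  \<open>R(z, A) x\<close> is \<open>x / z\<close>, and the contour integral of \<open>h(z) / z\<close> vanishes. If \<open>A\<close> is not injective, then \<open>f\<^sub>n\<close>
  being in the domain of the calculus yields a regulariser \<open>h + a + b / (1 + z)\<close> with \<open>a + b \<noteq> 0\<close>, and it follows
  that \<open>\<Phi>(f\<^sub>n) x\<close> equals \<open>f\<^sub>n(0) x\<close> modulo \<open>R\<close>. As \<open>f\<^sub>n(0) \<rightarrow> 0\<close>, the limit \<open>y\<close> lies in \<open>R\<close>. Since \<open>R\<close> meets the
  kernel of \<open>A\<close> only in 0, \<open>y = 0\<close> for all \<open>D\<close>, and therefore \<open>T x = 0\<close>.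
\<close>

section \<open>Integrals of Banach-valued functions on the half-line\<close>

text \<open>Two contours have to be reconciled. \<open>Phi_E\<close> on a sector of angle w
  integrates along the rays of angle (\<omega> + w)/2, but the sectorial calculus may realise each
  \<open>f n\<close> on its own smaller sector w' \<le> w. Dominated convergence needs one contour
  for all n, so the integrals of \<open>z / (1 + z)\<^sup>2 * f n z\<close> are rotated to the angle
  that belongs to w. The product formula for \<Phi>(f n) is read off the definition of its graph,
  since \<open>z / (1 + z)\<^sup>2\<close> regularises every bounded holomorphic function. The
  definition of \<open>Ecl\<close> gives boundedness and integrability against dt/t on each single
  ray, but directly neither pointwise decay nor limits at 0 and infinity. Hence damping factors
  precede the rotation of a contour, and boundary values are taken along special sequences. The
  integrals are gauge integrals of Banach-valued functions, controlled throughout by scalar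
  majorants. A need not be injective, so annihilation by B - B^2 only places D T x in the kernel of
  A. That remaining component is invisible to the values of \<open>f n\<close> off 0; it is removed
  by f n(0) \<rightarrow> 0.\<close>

lemma norm_diff_less_thirds:
  fixes a b c d :: "'b::real_normed_vector"
  assumes "norm (a - b) < e/3" "norm (c - d) < e/3" "norm (b - d) < e/3"
  shows "norm (a - c) < e"
proof -
  have "norm (a - c) = norm ((a - b) - (c - d) + (b - d))" by simp
  then have "norm (a - c) \<le> norm (a - b) + norm (c - d) + norm (b - d)"
    using norm_triangle_ineq[of "(a - b) - (c - d)" "b - d"] norm_triangle_ineq4[of "a - b" "c - d"]
    by linarith
  then show ?thesis using assms by simp
qed

text \<open>Riemann sums of g - k are dominated in norm by the Riemann sums of \<psi>, so on fine
  divisions the sums of g inherit the Cauchy property from those of k. This replaces absolute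
  integrability by a scalar majorant of the error.\<close>

lemma integrable_on_cbox_L1_approx:
  fixes g :: "'n::euclidean_space \<Rightarrow> 'b::banach"
  assumes approx: "\<And>e. e > 0 \<Longrightarrow> \<exists>k \<psi>. k integrable_on cbox a b \<and> \<psi> integrable_on cbox a b \<and>
      integral (cbox a b) \<psi> < e \<and> (\<forall>x\<in>cbox a b. norm (g x - k x) \<le> \<psi> x)"
  shows "g integrable_on cbox a b"
  unfolding integrable_Cauchy
proof (intro allI impI)
  fix e :: real assume e: "e > 0"
  \<comment> \<open>The e/6 is spent twice: the integral of \<psi> and the deviation of its Riemann
    sums from it together stay below e/3.\<close>
  then obtain k \<psi> where k: "k integrable_on cbox a b" and psi: "\<psi> integrable_on cbox a b"
    and small: "integral (cbox a b) \<psi> < e/6"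
    and le: "\<And>x. x \<in> cbox a b \<Longrightarrow> norm (g x - k x) \<le> \<psi> x"
    using approx[of "e/6"] by auto
  obtain \<gamma>1 where g1: "gauge \<gamma>1" and fine1: "\<And>p q. p tagged_division_of (cbox a b) \<Longrightarrow> \<gamma>1 fine p \<Longrightarrow>
        q tagged_division_of (cbox a b) \<Longrightarrow> \<gamma>1 fine q \<Longrightarrow>
        norm ((\<Sum>(x,K)\<in>p. measure lborel K *\<^sub>R k x) - (\<Sum>(x,K)\<in>q. measure lborel K *\<^sub>R k x)) < e/3"
    using k[unfolded integrable_Cauchy, rule_format, of "e/3"] e by auto
  obtain \<gamma>2 where g2: "gauge \<gamma>2" and fine2: "\<And>p. p tagged_division_of (cbox a b) \<Longrightarrow> \<gamma>2 fine p \<Longrightarrow>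
        norm ((\<Sum>(x,K)\<in>p. measure lborel K *\<^sub>R \<psi> x) - integral (cbox a b) \<psi>) < e/6"
    using integrable_integral[OF psi, unfolded has_integral, rule_format, of "e/6"] e by auto
  have close: "norm ((\<Sum>(x,K)\<in>p. measure lborel K *\<^sub>R g x) - (\<Sum>(x,K)\<in>p. measure lborel K *\<^sub>R k x)) < e/3"
    if p: "p tagged_division_of (cbox a b)" and fp: "\<gamma>2 fine p" for p
  proof -
    have "norm ((\<Sum>(x,K)\<in>p. measure lborel K *\<^sub>R g x) - (\<Sum>(x,K)\<in>p. measure lborel K *\<^sub>R k x))
        = norm (\<Sum>(x,K)\<in>p. measure lborel K *\<^sub>R (g x - k x))"
      by (simp add: sum_subtractf[symmetric] split_def scaleR_diff_right)
    also have "\<dots> \<le> (\<Sum>(x,K)\<in>p. measure lborel K *\<^sub>R \<psi> x)"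
    proof (rule sum_norm_le)
      fix y assume y: "y \<in> p"
      obtain x K where xK: "y = (x, K)" by force
      have "x \<in> cbox a b"
        using p y xK by (auto dest: tag_in_interval)
      then show "norm (case y of (x, K) \<Rightarrow> measure lborel K *\<^sub>R (g x - k x))
          \<le> (case y of (x, K) \<Rightarrow> measure lborel K *\<^sub>R \<psi> x)"
        using le by (auto simp: xK intro!: mult_left_mono)
    qed
    finally show ?thesis
      using fine2[OF p fp] small unfolding real_norm_def by linarith
  qed
  show "\<exists>\<gamma>. gauge \<gamma> \<and>
          (\<forall>\<D>1 \<D>2. \<D>1 tagged_division_of (cbox a b) \<and> \<gamma> fine \<D>1 \<and>
            \<D>2 tagged_division_of (cbox a b) \<and> \<gamma> fine \<D>2 \<longrightarrow>
            norm ((\<Sum>(x,K)\<in>\<D>1. measure lborel K *\<^sub>R g x) - (\<Sum>(x,K)\<in>\<D>2. measure lborel K *\<^sub>R g x)) < e)"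
  proof (intro exI[of _ "\<lambda>x. \<gamma>1 x \<inter> \<gamma>2 x"] conjI allI impI; (elim conjE)?)
    show "gauge (\<lambda>x. \<gamma>1 x \<inter> \<gamma>2 x)"
      using g1 g2 by (rule gauge_Int)
    fix p q assume pq: "p tagged_division_of (cbox a b)" "(\<lambda>x. \<gamma>1 x \<inter> \<gamma>2 x) fine p"
      "q tagged_division_of (cbox a b)" "(\<lambda>x. \<gamma>1 x \<inter> \<gamma>2 x) fine q"
    then have f: "\<gamma>1 fine p" "\<gamma>2 fine p" "\<gamma>1 fine q" "\<gamma>2 fine q"
      by (auto simp: fine_Int)
    show "norm ((\<Sum>(x,K)\<in>p. measure lborel K *\<^sub>R g x) - (\<Sum>(x,K)\<in>q. measure lborel K *\<^sub>R g x)) < e"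
      by (rule norm_diff_less_thirds[OF close[OF pq(1) f(2)] close[OF pq(3) f(4)]
            fine1[OF pq(1) f(1) pq(3) f(3)]])
  qed
qed

text \<open>Extension by zero (\<open>E\<close>) reduces to boxes. As \<psi> is nonnegative on S,
  its integral over every box is below its total integral, so the error is small uniformly in the
  box, which is what the Cauchy criterion over growing boxes asks for.\<close>

lemma integrable_on_L1_approx:
  fixes g :: "'n::euclidean_space \<Rightarrow> 'b::banach"
  assumes approx: "\<And>e. e > 0 \<Longrightarrow> \<exists>k \<psi>. k integrable_on S \<and> \<psi> integrable_on S \<and>
      integral S \<psi> < e \<and> (\<forall>x\<in>S. norm (g x - k x) \<le> \<psi> x)"
  shows "g integrable_on S"
proof -
  define E where "E f = (\<lambda>x. if x \<in> S then f x else 0)" for f :: "'n \<Rightarrow> 'b"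
  have approx': "\<exists>k \<psi>. k integrable_on S \<and> (\<forall>a b. \<psi> integrable_on cbox a b) \<and>
      (\<forall>a b. integral (cbox a b) \<psi> < e) \<and> (\<forall>x. norm (E g x - E k x) \<le> \<psi> x)" if e: "e > 0" for e
  proof -
    obtain k \<psi> where k: "k integrable_on S" and psi: "\<psi> integrable_on S"
      and small: "integral S \<psi> < e" and le: "\<And>x. x \<in> S \<Longrightarrow> norm (g x - k x) \<le> \<psi> x"
      using approx[OF e] by auto
    have nn: "\<psi> x \<ge> 0" if "x \<in> S" for x
      using le[OF that] norm_ge_zero order_trans by blast
    define \<psi>' where "\<psi>' = (\<lambda>x. if x \<in> S then \<psi> x else 0)"
    have *: "\<psi>' integrable_on cbox a b" for a b
      unfolding \<psi>'_def using psi by (rule integrable_altD(1))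
    have U: "\<psi>' integrable_on UNIV" "integral UNIV \<psi>' = integral S \<psi>"
      unfolding \<psi>'_def using psi by (auto simp: integrable_restrict_UNIV integral_restrict_UNIV)
    have "integral (cbox a b) \<psi>' \<le> integral UNIV \<psi>'" for a b
      by (rule integral_subset_le) (use * U nn in \<open>auto simp: \<psi>'_def\<close>)
    then have "integral (cbox a b) \<psi>' < e" for a b
      using small U(2) by (metis order.strict_trans1)
    then show ?thesis
      using k * le by (intro exI[of _ k] exI[of _ \<psi>']) (auto simp: \<psi>'_def E_def)
  qed
  have box: "E g integrable_on cbox a b" for a b
  proof (rule integrable_on_cbox_L1_approx)
    fix e :: real assume "e > 0"
    from approx'[OF this] obtain k \<psi> where "k integrable_on S" "\<forall>a b. \<psi> integrable_on cbox a b"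
      "\<forall>a b. integral (cbox a b) \<psi> < e" "\<forall>x. norm (E g x - E k x) \<le> \<psi> x" by blast
    moreover from this(1) have "E k integrable_on cbox a b"
      unfolding E_def by (rule integrable_altD(1))
    ultimately show "\<exists>k \<psi>. k integrable_on cbox a b \<and> \<psi> integrable_on cbox a b \<and>
      integral (cbox a b) \<psi> < e \<and> (\<forall>x\<in>cbox a b. norm (E g x - k x) \<le> \<psi> x)"
      by (intro exI[of _ "E k"] exI[of _ \<psi>]) auto
  qed
  show ?thesis
    unfolding integrable_alt[of g S] E_def[symmetric]
  proof (intro conjI allI impI box)
    fix e :: real assume e: "e > 0"
    with approx'[of "e/3"] obtain k \<psi> where k: "k integrable_on S"
      and psi: "\<And>a b. \<psi> integrable_on cbox a b"
      and small: "\<And>a b. integral (cbox a b) \<psi> < e/3" and le: "\<And>x. norm (E g x - E k x) \<le> \<psi> x" by auto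
    have Ek: "E k integrable_on cbox a b" for a b
      using k unfolding E_def by (rule integrable_altD(1))
    obtain M where M: "M > 0" "\<And>a b c d. ball 0 M \<subseteq> cbox a b \<and> ball 0 M \<subseteq> cbox c d \<Longrightarrow>
       norm (integral (cbox a b) (E k) - integral (cbox c d) (E k)) < e/3"
      using integrable_altD(2)[OF k, of "e/3"] e unfolding E_def by auto
    have close: "norm (integral (cbox a b) (E g) - integral (cbox a b) (E k)) < e/3" for a b
    proof -
      have "norm (integral (cbox a b) (E g) - integral (cbox a b) (E k))
          = norm (integral (cbox a b) (\<lambda>x. E g x - E k x))"
        by (simp add: integral_diff box Ek)
      also have "\<dots> \<le> integral (cbox a b) \<psi>"
        by (intro integral_norm_bound_integral integrable_diff box Ek psi le)
      finally show ?thesis using small[of a b] by simp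
    qed
    show "\<exists>M>0. \<forall>a b c d. ball 0 M \<subseteq> cbox a b \<and> ball 0 M \<subseteq> cbox c d \<longrightarrow>
       norm (integral (cbox a b) (E g) - integral (cbox c d) (E g)) < e"
    proof (intro exI[of _ M] conjI allI impI M(1))
      fix a b c d :: "'n" assume "ball 0 M \<subseteq> cbox a b \<and> ball 0 M \<subseteq> cbox c d"
      from norm_diff_less_thirds[OF close[of a b] close[of c d] M(2)[OF this]]
      show "norm (integral (cbox a b) (E g) - integral (cbox c d) (E g)) < e" .
    qed
  qed
qed

text \<open>Cutting g off outside [1/(n+1), n+1] leaves a function integrable by continuity. The
  error is at most \<phi> outside that interval, and scalar dominated convergence sends the integral
  of this tail to 0.\<close>

lemma
  fixes g :: "real \<Rightarrow> 'b::banach"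
  assumes cont: "continuous_on {0<..} g"
    and phi: "\<phi> integrable_on {0<..}"
    and le: "\<And>t. t > 0 \<Longrightarrow> norm (g t) \<le> \<phi> t"
  shows integrable_on_halfline: "g integrable_on {0<..}"
    and halfline_truncation_tendsto:
      "(\<lambda>n. integral {1 / real (Suc n)..real (Suc n)} g) \<longlonglongrightarrow> integral {0<..} g"
proof -
  let ?I = "\<lambda>n. {1 / real (Suc n)..real (Suc n)}"
  have sub: "?I n \<subseteq> {0<..}" for n
    by (metis atLeastAtMost_iff divide_pos_pos greaterThan_iff less_le_trans of_nat_0_less_iff
        subsetI zero_less_Suc zero_less_one)
  define k where "k n = (\<lambda>t. if t \<in> ?I n then g t else 0)" for n
  define \<psi> where "\<psi> n = (\<lambda>t. \<phi> t - (if t \<in> ?I n then \<phi> t else 0))" for n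
  have nn: "\<phi> t \<ge> 0" if "t > 0" for t
    using le[OF that] norm_ge_zero order_trans by blast
  have k: "k n integrable_on {0<..}" "integral {0<..} (k n) = integral (?I n) g" for n
  proof -
    have "g integrable_on ?I n"
      by (intro integrable_continuous_interval continuous_on_subset[OF cont] sub)
    then show "k n integrable_on {0<..}" "integral {0<..} (k n) = integral (?I n) g"
      unfolding k_def integrable_restrict_Int integral_restrict_Int
      using sub[of n] by (simp_all add: inf_absorb1 del: of_nat_Suc)
  qed
  have psi: "\<psi> n integrable_on {0<..}" for n
  proof -
    have "\<phi> integrable_on ?I n"
      using integrable_on_subcbox[OF phi, of "1 / real (Suc n)" "real (Suc n)"] sub[of n] by simp
    then have "(\<lambda>t. if t \<in> ?I n then \<phi> t else 0) integrable_on {0<..}"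
      unfolding integrable_restrict_Int
      using sub[of n] by (simp add: inf_absorb1 del: of_nat_Suc)
    then show ?thesis
      unfolding \<psi>_def using phi by (rule integrable_diff[rotated])
  qed
  have lim: "(\<lambda>n. integral {0<..} (\<psi> n)) \<longlonglongrightarrow> integral {0<..} (\<lambda>t::real. 0::real)"
  proof (rule dominated_convergence(2)[OF psi phi])
    fix t :: real assume t: "t \<in> {0<..}"
    show "norm (\<psi> n t) \<le> \<phi> t" for n
      using nn t by (auto simp: \<psi>_def)
    have "\<forall>\<^sub>F n in sequentially. 1 / real (Suc n) < t"
      using t LIMSEQ_inverse_real_of_nat order_tendstoD(2)[of _ 0 sequentially t]
      by (simp add: inverse_eq_divide)
    moreover have "\<forall>\<^sub>F n in sequentially. t < real (Suc n)"
    proof -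
      obtain N where "t < real N" using reals_Archimedean2 by blast
      then show ?thesis
        by (intro eventually_sequentiallyI[of N]) auto
    qed
    ultimately have "\<forall>\<^sub>F n in sequentially. \<psi> n t = 0"
      by eventually_elim (auto simp: \<psi>_def)
    then show "(\<lambda>n. \<psi> n t) \<longlonglongrightarrow> 0"
      by (rule tendsto_eventually)
  qed
  then have lim: "(\<lambda>n. integral {0<..} (\<psi> n)) \<longlonglongrightarrow> 0" by simp
  have diff: "norm (g t - k n t) \<le> \<psi> n t" if "t > 0" for n t
    using le[OF that] nn[OF that] by (auto simp: k_def \<psi>_def)
  show int: "g integrable_on {0<..}"
  proof (rule integrable_on_L1_approx)
    fix e :: real assume "e > 0"
    with lim have "\<forall>\<^sub>F n in sequentially. integral {0<..} (\<psi> n) < e"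
      by (rule order_tendstoD(2))
    then obtain n where "integral {0<..} (\<psi> n) < e"
      using eventually_happens' sequentially_bot by blast
    then show "\<exists>k \<psi>. k integrable_on {0<..} \<and> \<psi> integrable_on {0<..} \<and>
      integral {0<..} \<psi> < e \<and> (\<forall>x\<in>{0<..}. norm (g x - k x) \<le> \<psi> x)"
      using k(1) psi diff by (intro exI[of _ "k n"] exI[of _ "\<psi> n"]) auto
  qed
  have "norm (integral (?I n) g - integral {0<..} g) \<le> integral {0<..} (\<psi> n)" for n
  proof -
    have "norm (integral (?I n) g - integral {0<..} g) = norm (integral {0<..} (\<lambda>t. g t - k n t))"
      by (simp only: integral_diff[OF int k(1)] k(2) norm_minus_commute)
    also have "\<dots> \<le> integral {0<..} (\<psi> n)"
      by (intro integral_norm_bound_integral integrable_diff int k psi) (use diff in auto)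
    finally show ?thesis .
  qed
  then have "(\<lambda>n. integral (?I n) g - integral {0<..} g) \<longlonglongrightarrow> 0"
    by (intro Lim_null_comparison[OF _ lim] always_eventually allI)
  then show "(\<lambda>n. integral (?I n) g) \<longlonglongrightarrow> integral {0<..} g"
    by (rule LIM_zero_cancel)
qed

text \<open>Reduces to scalar dominated convergence for \<open>norm (g n t - h t)\<close> with
  majorant 2\<phi>; continuity makes these norms integrable.\<close>

lemma halfline_dominated_convergence:
  fixes g :: "nat \<Rightarrow> real \<Rightarrow> 'b::banach"
  assumes cont: "\<And>n. continuous_on {0<..} (g n)" "continuous_on {0<..} h"
    and phi: "\<phi> integrable_on {0<..}"
    and le: "\<And>n t. t > 0 \<Longrightarrow> norm (g n t) \<le> \<phi> t"
    and lim: "\<And>t. t > 0 \<Longrightarrow> (\<lambda>n. g n t) \<longlonglongrightarrow> h t"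
  shows "(\<lambda>n. integral {0<..} (g n)) \<longlonglongrightarrow> integral {0<..} h"
proof -
  have leh: "norm (h t) \<le> \<phi> t" if "t > 0" for t
    using le[OF that] tendsto_norm[OF lim[OF that]] by (intro LIMSEQ_le_const2) auto
  have int: "g n integrable_on {0<..}" "h integrable_on {0<..}" for n
    using integrable_on_halfline[OF cont(1) phi le] integrable_on_halfline[OF cont(2) phi leh]
    by auto
  have phi2: "(\<lambda>t. 2 * \<phi> t) integrable_on {0<..}"
    using phi by (simp add: integrable_on_mult_right)
  have le2: "norm (g n t - h t) \<le> 2 * \<phi> t" if "t > 0" for n t
    using norm_triangle_ineq4[of "g n t" "h t"] le[OF that, of n] leh[OF that] by simp
  have nint: "(\<lambda>t. norm (g n t - h t)) integrable_on {0<..}" for n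
    by (rule integrable_on_halfline[OF _ phi2]) (use le2 cont in \<open>auto intro!: continuous_intros\<close>)
  have "(\<lambda>n. integral {0<..} (\<lambda>t. norm (g n t - h t))) \<longlonglongrightarrow> integral {0<..} (\<lambda>t::real. 0::real)"
  proof (rule dominated_convergence(2)[OF nint phi2])
    fix t :: real assume t: "t \<in> {0<..}"
    show "norm (norm (g n t - h t)) \<le> 2 * \<phi> t" for n
      using le2 t by auto
    show "(\<lambda>n. norm (g n t - h t)) \<longlonglongrightarrow> 0"
      using lim t by (auto intro!: tendsto_norm_zero LIM_zero)
  qed
  then have lim0: "(\<lambda>n. integral {0<..} (\<lambda>t. norm (g n t - h t))) \<longlonglongrightarrow> 0" by simp
  have "norm (integral {0<..} (g n) - integral {0<..} h)
      \<le> integral {0<..} (\<lambda>t. norm (g n t - h t))" for n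
    unfolding integral_diff[OF int, symmetric]
    by (intro integral_norm_bound_integral integrable_diff int nint) auto
  then have "(\<lambda>n. integral {0<..} (g n) - integral {0<..} h) \<longlonglongrightarrow> 0"
    by (intro Lim_null_comparison[OF _ lim0] always_eventually allI)
  then show ?thesis by (rule LIM_zero_cancel)
qed

text \<open>Riemann sums are linear combinations of values of g, and they approximate the
  integral.\<close>

lemma integral_interval_in_closed_subspace:
  fixes g :: "real \<Rightarrow> 'b::banach"
  assumes V: "subspace V" "closed V" and int: "g integrable_on {a..b}"
    and gV: "\<And>t. t \<in> {a..b} \<Longrightarrow> g t \<in> V"
  shows "integral {a..b} g \<in> V"
proof -
  have "\<exists>v\<in>V. dist v (integral {a..b} g) < e" if "e > 0" for e
  proof -
    obtain \<gamma> where "gauge \<gamma>" and \<gamma>: "\<And>p. p tagged_division_of (cbox a b) \<Longrightarrow> \<gamma> fine p \<Longrightarrow>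
        norm ((\<Sum>(x,K)\<in>p. measure lborel K *\<^sub>R g x) - integral (cbox a b) g) < e"
      using integrable_integral[of g "cbox a b", unfolded has_integral, rule_format, OF _ \<open>e > 0\<close>] int by auto
    obtain p where p: "p tagged_division_of (cbox a b)" "\<gamma> fine p"
      using fine_division_exists[OF \<open>gauge \<gamma>\<close>] by blast
    have "(\<Sum>(x,K)\<in>p. measure lborel K *\<^sub>R g x) \<in> V"
    proof (rule subspace_sum[OF V(1)])
      fix y assume y: "y \<in> p"
      obtain x K where xK: "y = (x, K)" by force
      have "x \<in> {a..b}"
        using p y xK by (auto dest: tag_in_interval)
      then show "(case y of (x, K) \<Rightarrow> measure lborel K *\<^sub>R g x) \<in> V"
        using gV V(1) by (auto simp: xK intro: subspace_scale)
    qed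
    then show ?thesis
      using \<gamma>[OF p] by (auto simp: dist_norm)
  qed
  then show ?thesis
    using V(2) closed_approachable by blast
qed

lemma integral_halfline_in_closed_subspace:
  fixes g :: "real \<Rightarrow> 'b::banach"
  assumes V: "subspace V" "closed V" and cont: "continuous_on {0<..} g"
    and phi: "\<phi> integrable_on {0<..}" "\<And>t. t > 0 \<Longrightarrow> norm (g t) \<le> \<phi> t"
    and gV: "\<And>t. t > 0 \<Longrightarrow> g t \<in> V"
  shows "integral {0<..} g \<in> V"
proof (rule closed_sequentially[OF V(2) _ halfline_truncation_tendsto[OF cont phi]])
  fix n
  have pos: "t > 0" if "t \<in> {1 / real (Suc n)..real (Suc n)}" for t
    using that by (metis atLeastAtMost_iff divide_pos_pos less_le_trans of_nat_0_less_iff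
        zero_less_Suc zero_less_one)
  show "integral {1 / real (Suc n)..real (Suc n)} g \<in> V"
    by (rule integral_interval_in_closed_subspace[OF V])
       (use pos gV in \<open>auto intro!: integrable_continuous_interval continuous_on_subset[OF cont]
          simp del: of_nat_Suc\<close>)
qed auto

section \<open>Contour shifts for vector-valued functions\<close>

text \<open>Real bilinearity opens the general product rules for limits, derivatives and continuity
  to complex scalar multiplication.\<close>

lemma bounded_bilinear_scaleC:
  "bounded_bilinear (scaleC :: complex \<Rightarrow> 'a::complex_normed_vector \<Rightarrow> 'a)"
proof
  fix r :: real and a :: complex and x :: 'a
  show "scaleC (r *\<^sub>R a) x = r *\<^sub>R scaleC a x"
    by (simp add: scaleR_scaleC scaleC_scaleC scaleR_conv_of_real)
  show "scaleC a (r *\<^sub>R x) = r *\<^sub>R scaleC a x"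
    by (simp add: scaleR_scaleC scaleC_scaleC mult.commute)
  show "\<exists>K. \<forall>a (x::'a). norm (scaleC a x) \<le> norm a * norm x * K"
    by (rule exI[of _ 1]) (simp add: norm_scaleC)
qed (simp_all add: scaleC_add_left scaleC_add_right)

interpretation scaleC: bounded_bilinear "scaleC :: complex \<Rightarrow> 'a::complex_normed_vector \<Rightarrow> 'a"
  by (rule bounded_bilinear_scaleC)

declare scaleC.zero_left [simp] scaleC.zero_right [simp] scaleC_scaleC [simp] scaleC_one [simp] norm_scaleC [simp]

lemmas continuous_on_scaleC [continuous_intros] = scaleC.continuous_on

lemma has_vector_derivative_compose_complex:
  fixes g :: "complex \<Rightarrow> 'a::complex_normed_vector"
  assumes "(g has_derivative (\<lambda>h. scaleC h d)) (at (p x))"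
    and "(p has_vector_derivative v) (at x within S)"
  shows "((\<lambda>x. g (p x)) has_vector_derivative scaleC v d) (at x within S)"
proof -
  have "((\<lambda>x. g (p x)) has_derivative (\<lambda>h. scaleC (h *\<^sub>R v) d)) (at x within S)"
    using has_derivative_compose[OF assms(2)[unfolded has_vector_derivative_def] assms(1)] .
  then show ?thesis
    by (simp add: has_vector_derivative_def scaleC.scaleR_left)
qed

lemma has_vector_derivative_mult_of_real:
  "((\<lambda>t. of_real t * c) has_vector_derivative c) (at t within S)" for c :: complex
  unfolding has_vector_derivative_def scaleR_conv_of_real
  by (auto intro!: derivative_eq_intros)

text \<open>A direct form of Cauchy's theorem for Banach-valued g: the ray integral is
  differentiated in its angle. Its derivative reduces to boundary terms on the two arcs, of norm at
  most C, and the mean value inequality over the angles gives the factor \<beta> - \<alpha>.\<close>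

lemma annular_sector_shift_bound:
  fixes g g' :: "complex \<Rightarrow> 'a::complex_banach"
  assumes ab: "0 < a" "a \<le> b" and le: "\<alpha> \<le> \<beta>"
    and der: "\<And>t \<theta>. t > 0 \<Longrightarrow> \<theta> \<in> {\<alpha>..\<beta>} \<Longrightarrow>
        (g has_derivative (\<lambda>h. scaleC h (g' (of_real t * cis \<theta>)))) (at (of_real t * cis \<theta>))"
    and cont: "continuous_on ({\<alpha>..\<beta>} \<times> {0<..}) (\<lambda>(\<theta>, t). g' (of_real t * cis \<theta>))"
    and bound: "\<And>\<theta>. \<theta> \<in> {\<alpha>..\<beta>} \<Longrightarrow>
        a * norm (g (of_real a * cis \<theta>)) + b * norm (g (of_real b * cis \<theta>)) \<le> C"
  shows "norm (integral {a..b} (\<lambda>t. scaleC (cis \<beta>) (g (of_real t * cis \<beta>)))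
             - integral {a..b} (\<lambda>t. scaleC (cis \<alpha>) (g (of_real t * cis \<alpha>)))) \<le> C * (\<beta> - \<alpha>)"
proof -
  define G where "G = (\<lambda>\<theta> t. scaleC (cis \<theta>) (g (of_real t * cis \<theta>)))"
  \<comment> \<open>\<open>L\<close> is at once the \<theta>-derivative of \<open>G\<close> and the
    t-derivative of \<open>P\<close>, by the Cauchy-Riemann relation between the two directions. The
    Leibniz rule followed by the fundamental theorem thus turns the angular derivative into
    \<open>P \<theta> b - P \<theta> a\<close>.\<close>
  define L where "L = (\<lambda>\<theta> t. scaleC (\<i> * cis \<theta>) (g (of_real t * cis \<theta>))
      + scaleC (\<i> * of_real t * cis \<theta> * cis \<theta>) (g' (of_real t * cis \<theta>)))"
  define P where "P = (\<lambda>\<theta> t. scaleC (\<i> * of_real t * cis \<theta>) (g (of_real t * cis \<theta>)))"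
  have pos: "t > 0" if "t \<in> {a..b}" for t using that ab by auto
  have cis_der: "(cis has_vector_derivative (\<i> * cis \<theta>)) (at \<theta> within S)" for \<theta> S
    using has_derivative_cis[OF has_derivative_ident, of \<theta> S]
    by (simp add: has_vector_derivative_def scaleR_conv_of_real mult_ac)
  have gder_theta: "((\<lambda>\<theta>. g (of_real t * cis \<theta>)) has_vector_derivative
      scaleC (of_real t * (\<i> * cis \<theta>)) (g' (of_real t * cis \<theta>))) (at \<theta> within S)"
    if "t > 0" "\<theta> \<in> {\<alpha>..\<beta>}" for t \<theta> S
    using that by (intro has_vector_derivative_compose_complex[where p = "\<lambda>\<theta>. of_real t * cis \<theta>"] der has_vector_derivative_mult_right cis_der)
  have gder_t: "((\<lambda>t. g (of_real t * cis \<theta>)) has_vector_derivative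
      scaleC (cis \<theta>) (g' (of_real t * cis \<theta>))) (at t within S)"
    if "t > 0" "\<theta> \<in> {\<alpha>..\<beta>}" for t \<theta> S
  proof (rule has_vector_derivative_compose_complex[where p = "\<lambda>t. of_real t * cis \<theta>", OF der[OF that]])
    show "((\<lambda>t. of_real t * cis \<theta>) has_vector_derivative cis \<theta>) (at t within S)"
      by (rule has_vector_derivative_mult_of_real)
  qed
  have Gder: "((\<lambda>\<theta>. G \<theta> t) has_vector_derivative L \<theta> t) (at \<theta> within {\<alpha>..\<beta>})"
    if "\<theta> \<in> {\<alpha>..\<beta>}" "t \<in> cbox a b" for \<theta> t
    unfolding G_def L_def
    by (rule has_vector_derivative_eq_rhs[OF scaleC.has_vector_derivative[OF cis_der gder_theta]])
       (use that pos in \<open>simp_all add: mult_ac add.commute\<close>)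
  have Pder: "((\<lambda>t. P \<theta> t) has_vector_derivative L \<theta> t) (at t within {a..b})"
    if "\<theta> \<in> {\<alpha>..\<beta>}" "t \<in> {a..b}" for \<theta> t
  proof -
    have "((\<lambda>t. \<i> * of_real t * cis \<theta>) has_vector_derivative \<i> * cis \<theta>) (at t within {a..b})"
      using has_vector_derivative_mult_of_real[of "\<i> * cis \<theta>" t "{a..b}"] by (simp add: mult_ac)
    then show ?thesis
      unfolding P_def L_def
      by (rule has_vector_derivative_eq_rhs[OF scaleC.has_vector_derivative[OF _ gder_t]])
         (use that pos in \<open>simp_all add: mult_ac add.commute\<close>)
  qed
  have contg: "continuous_on ({\<alpha>..\<beta>} \<times> {a..b}) (\<lambda>(\<theta>, t). g (of_real t * cis \<theta>))"
    unfolding split_def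
  proof (rule continuous_on_compose2[where f = "\<lambda>x. of_real (snd x) * cis (fst x)" and g = g])
    show "continuous_on {of_real t * cis \<theta> | t \<theta>. t > 0 \<and> \<theta> \<in> {\<alpha>..\<beta>}} g"
      by (rule continuous_at_imp_continuous_on) (use has_derivative_continuous[OF der] in auto)
  qed (use pos in \<open>force intro!: continuous_intros\<close>)+
  have cont': "continuous_on ({\<alpha>..\<beta>} \<times> {a..b}) (\<lambda>(\<theta>, t). g' (of_real t * cis \<theta>))"
    by (rule continuous_on_subset[OF cont]) (use pos in auto)
  have Lcont: "continuous_on ({\<alpha>..\<beta>} \<times> cbox a b) (\<lambda>(\<theta>, t). L \<theta> t)"
    using contg cont' unfolding L_def split_def
    by (auto intro!: continuous_intros)
  have Gint: "G \<theta> integrable_on cbox a b" if "\<theta> \<in> {\<alpha>..\<beta>}" for \<theta>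
  proof -
    have "continuous_on {a..b} (\<lambda>t. g (of_real t * cis \<theta>))"
      using gder_t[OF pos that] by (intro continuous_on_vector_derivative) blast
    then show ?thesis
      unfolding G_def interval_cbox[symmetric]
      by (intro integrable_continuous_interval continuous_intros)
  qed
  have Fder: "((\<lambda>\<theta>. integral (cbox a b) (G \<theta>)) has_vector_derivative P \<theta> b - P \<theta> a) (at \<theta> within {\<alpha>..\<beta>})"
    if "\<theta> \<in> {\<alpha>..\<beta>}" for \<theta>
  proof -
    have "(L \<theta> has_integral P \<theta> b - P \<theta> a) {a..b}"
      by (intro fundamental_theorem_of_calculus ab Pder that)
    then have "integral (cbox a b) (L \<theta>) = P \<theta> b - P \<theta> a"
      by (simp add: integral_unique)
    then show ?thesis
      using leibniz_rule_vector_derivative[OF Gder Gint Lcont that convex_real_interval(5)] by simp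
  qed
  have "norm (integral (cbox a b) (G \<beta>) - integral (cbox a b) (G \<alpha>)) \<le> C * norm (\<beta> - \<alpha>)"
  proof (rule differentiable_bound[OF convex_real_interval(5)])
    fix \<theta> assume th: "\<theta> \<in> {\<alpha>..\<beta>}"
    show "((\<lambda>\<theta>. integral (cbox a b) (G \<theta>)) has_derivative (\<lambda>h. h *\<^sub>R (P \<theta> b - P \<theta> a))) (at \<theta> within {\<alpha>..\<beta>})"
      using Fder[OF th] by (simp add: has_vector_derivative_def)
    have "norm (P \<theta> b - P \<theta> a) \<le> C"
      using norm_triangle_ineq4[of "P \<theta> b" "P \<theta> a"] bound[OF th] ab
      by (simp add: P_def norm_mult)
    then show "onorm (\<lambda>h. h *\<^sub>R (P \<theta> b - P \<theta> a)) \<le> C"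
      by (intro onorm_le) (simp add: mult.commute[of C] mult_left_mono)
  qed (use le in auto)
  then show ?thesis
    using le by (simp add: G_def)
qed

text \<open>On the radii 1/(n+1) and n+1 the arcs contribute at most a multiple of \<sigma>, which
  vanishes at both ends; \<phi> is needed only on the two extreme rays to let the truncations
  converge.\<close>

lemma ray_integral_shift:
  fixes g g' :: "complex \<Rightarrow> 'a::complex_banach"
  assumes le: "\<alpha> \<le> \<beta>"
    and der: "\<And>t \<theta>. t > 0 \<Longrightarrow> \<theta> \<in> {\<alpha>..\<beta>} \<Longrightarrow>
        (g has_derivative (\<lambda>h. scaleC h (g' (of_real t * cis \<theta>)))) (at (of_real t * cis \<theta>))"
    and cont: "continuous_on ({\<alpha>..\<beta>} \<times> {0<..}) (\<lambda>(\<theta>, t). g' (of_real t * cis \<theta>))"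
    and bound: "\<And>t \<theta>. t > 0 \<Longrightarrow> \<theta> \<in> {\<alpha>..\<beta>} \<Longrightarrow> t * norm (g (of_real t * cis \<theta>)) \<le> \<sigma> t"
    and \<sigma>: "(\<sigma> \<longlongrightarrow> 0) (at_right 0)" "(\<sigma> \<longlongrightarrow> 0) at_top"
    and phi: "\<phi> integrable_on {0<..}"
      "\<And>t. t > 0 \<Longrightarrow> norm (g (of_real t * cis \<alpha>)) \<le> \<phi> t"
      "\<And>t. t > 0 \<Longrightarrow> norm (g (of_real t * cis \<beta>)) \<le> \<phi> t"
  shows "integral {0<..} (\<lambda>t. scaleC (cis \<beta>) (g (of_real t * cis \<beta>)))
       = integral {0<..} (\<lambda>t. scaleC (cis \<alpha>) (g (of_real t * cis \<alpha>)))"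
proof -
  let ?F = "\<lambda>\<theta> t. scaleC (cis \<theta>) (g (of_real t * cis \<theta>))"
  have contF: "continuous_on {0<..} (?F \<theta>)" if "\<theta> \<in> {\<alpha>..\<beta>}" for \<theta>
  proof -
    have "continuous_on {of_real t * cis \<theta> | t. t > 0} g"
      by (rule continuous_at_imp_continuous_on) (use has_derivative_continuous[OF der] that in auto)
    then have "continuous_on {0<..} (\<lambda>t. g (of_real t * cis \<theta>))"
      by (rule continuous_on_compose2) (auto intro!: continuous_intros)
    then show ?thesis by (intro continuous_intros)
  qed
  let ?a = "\<lambda>n. 1 / real (Suc n)" and ?b = "\<lambda>n. real (Suc n)"
  have "(\<lambda>n. integral {?a n..?b n} (?F \<beta>) - integral {?a n..?b n} (?F \<alpha>))
      \<longlonglongrightarrow> integral {0<..} (?F \<beta>) - integral {0<..} (?F \<alpha>)"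
    using le phi by (intro tendsto_diff halfline_truncation_tendsto[OF contF phi(1)]) auto
  moreover have "(\<lambda>n. integral {?a n..?b n} (?F \<beta>) - integral {?a n..?b n} (?F \<alpha>)) \<longlonglongrightarrow> 0"
  proof (rule Lim_null_comparison[OF always_eventually])
    show "\<forall>n. norm (integral {?a n..?b n} (?F \<beta>) - integral {?a n..?b n} (?F \<alpha>))
        \<le> (\<sigma> (?a n) + \<sigma> (?b n)) * (\<beta> - \<alpha>)"
    proof
      fix n
      have "?a n \<le> 1" "1 \<le> ?b n" by auto
      then have "?a n \<le> ?b n" by linarith
      then show "norm (integral {?a n..?b n} (?F \<beta>) - integral {?a n..?b n} (?F \<alpha>))
        \<le> (\<sigma> (?a n) + \<sigma> (?b n)) * (\<beta> - \<alpha>)"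
        by (intro annular_sector_shift_bound[OF _ _ le der cont] add_mono bound)
           (auto simp del: of_nat_Suc)
    qed
    have "filterlim ?a (at_right 0) sequentially"
      using LIMSEQ_inverse_real_of_nat
      by (auto simp: filterlim_at inverse_eq_divide simp del: of_nat_Suc)
    then have "(\<lambda>n. \<sigma> (?a n)) \<longlonglongrightarrow> 0"
      by (rule filterlim_compose[OF \<sigma>(1)])
    moreover have "filterlim ?b at_top sequentially"
      by (rule filterlim_compose[OF filterlim_real_sequentially filterlim_Suc])
    then have "(\<lambda>n. \<sigma> (?b n)) \<longlonglongrightarrow> 0"
      by (rule filterlim_compose[OF \<sigma>(2)])
    ultimately show "(\<lambda>n. (\<sigma> (?a n) + \<sigma> (?b n)) * (\<beta> - \<alpha>)) \<longlonglongrightarrow> 0"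
      by (intro tendsto_eq_intros) auto
  qed
  ultimately show ?thesis
    using LIMSEQ_unique by fastforce
qed

section \<open>Sectors and resolvents\<close>

lemma set_integrable_inverse_1_plus_square:
  "set_integrable lborel {0<..} (\<lambda>t::real. C / (1 + t\<^sup>2))"
proof -
  have "set_integrable lborel UNIV (\<lambda>t::real. inverse (1 + t\<^sup>2))"
    using integrable_inverse_1_plus_square by (simp add: einterval_def)
  then have "set_integrable lborel {0<..} (\<lambda>t::real. inverse (1 + t\<^sup>2))"
    by (rule set_integrable_subset) auto
  then have "set_integrable lborel {0<..} (\<lambda>t::real. C * inverse (1 + t\<^sup>2))"
    by (rule set_integrable_mult_right)
  then show ?thesis by (simp add: field_class.field_divide_inverse)
qed

lemma integrable_on_inverse_1_plus_square:
  "(\<lambda>t::real. C / (1 + t\<^sup>2)) integrable_on {0<..}"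
  by (rule set_borel_integral_eq_integral(1)[OF set_integrable_inverse_1_plus_square])

text \<open>The single majorant C/(1+t^2) serves both purposes: it is integrable, and t times it
  tends to 0 at 0 and at infinity.\<close>

lemma ray_integral_shift_Lorentz:
  fixes g g' :: "complex \<Rightarrow> 'a::complex_banach"
  assumes le: "\<alpha> \<le> \<beta>"
    and der: "\<And>t \<theta>. t > 0 \<Longrightarrow> \<theta> \<in> {\<alpha>..\<beta>} \<Longrightarrow>
        (g has_derivative (\<lambda>h. scaleC h (g' (of_real t * cis \<theta>)))) (at (of_real t * cis \<theta>))"
    and cont: "continuous_on ({\<alpha>..\<beta>} \<times> {0<..}) (\<lambda>(\<theta>, t). g' (of_real t * cis \<theta>))"
    and bound: "\<And>t \<theta>. t > 0 \<Longrightarrow> \<theta> \<in> {\<alpha>..\<beta>} \<Longrightarrow> norm (g (of_real t * cis \<theta>)) \<le> C / (1 + t\<^sup>2)"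
  shows "integral {0<..} (\<lambda>t. scaleC (cis \<beta>) (g (of_real t * cis \<beta>)))
       = integral {0<..} (\<lambda>t. scaleC (cis \<alpha>) (g (of_real t * cis \<alpha>)))"
proof (rule ray_integral_shift[OF le der cont])
  show "t * norm (g (of_real t * cis \<theta>)) \<le> t * (C / (1 + t\<^sup>2))" if "t > 0" "\<theta> \<in> {\<alpha>..\<beta>}" for t \<theta>
    using bound[OF that] that(1) by (intro mult_left_mono) auto
  show "((\<lambda>t. t * (C / (1 + t\<^sup>2))) \<longlongrightarrow> 0) (at_right 0)" "((\<lambda>t. t * (C / (1 + t\<^sup>2))) \<longlongrightarrow> 0) at_top"
    by real_asymp+
  show "(\<lambda>t. C / (1 + t\<^sup>2)) integrable_on {0<..}"
    by (rule integrable_on_inverse_1_plus_square)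
qed (use bound le in auto)

lemma Re_eq_norm_cos_Arg: "Re z = cmod z * cos (Arg z)"
  by (metis rcis_cmod_Arg Re_rcis)

text \<open>Cosine is decreasing on [0, pi], so the condition on \<open>Arg\<close>, which jumps
  across the negative axis, becomes an inequality between continuous functions. Openness and
  membership of rays follow from it.\<close>

lemma csector_iff:
  assumes "0 \<le> w" "w \<le> pi"
  shows "z \<in> csector w \<longleftrightarrow> cmod z * cos w \<le> Re z"
proof (cases "z = 0")
  case False
  have "\<bar>Arg z\<bar> \<le> pi" using Arg_bounded[of z] by auto
  then have "cos w \<le> cos \<bar>Arg z\<bar> \<longleftrightarrow> \<bar>Arg z\<bar> \<le> w"
    using assms by (intro cos_mono_le_eq) auto
  then show ?thesis
    using False by (simp add: csector_def Re_eq_norm_cos_Arg[of z])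
qed (simp add: csector_def)

lemma sector_iff:
  assumes "0 \<le> w" "w \<le> pi"
  shows "z \<in> sector w \<longleftrightarrow> cmod z * cos w < Re z"
proof (cases "z = 0")
  case False
  have "\<bar>Arg z\<bar> \<le> pi" using Arg_bounded[of z] by auto
  then have "cos w < cos \<bar>Arg z\<bar> \<longleftrightarrow> \<bar>Arg z\<bar> < w"
    using assms by (intro cos_mono_less_eq) auto
  then show ?thesis
    using False by (simp add: sector_def Re_eq_norm_cos_Arg[of z])
qed (simp add: sector_def)

lemma open_sector: "0 \<le> w \<Longrightarrow> w \<le> pi \<Longrightarrow> open (sector w)"
proof -
  assume "0 \<le> w" "w \<le> pi"
  then have "sector w = {z. cmod z * cos w < Re z}" by (auto simp: sector_iff)
  then show ?thesis by (auto intro!: open_Collect_less continuous_intros)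
qed

lemma open_Compl_csector: "0 \<le> w \<Longrightarrow> w \<le> pi \<Longrightarrow> open (- csector w)"
proof -
  assume "0 \<le> w" "w \<le> pi"
  then have "- csector w = {z. Re z < cmod z * cos w}" by (auto simp: csector_iff not_le)
  then show ?thesis by (auto intro!: open_Collect_less continuous_intros)
qed

lemma sector_mono: "v \<le> w \<Longrightarrow> sector v \<subseteq> sector w"
  by (auto simp: sector_def)

lemma ray_in_sector_iff:
  assumes "0 \<le> w" "w \<le> pi" "t > 0"
  shows "of_real t * cis \<theta> \<in> sector w \<longleftrightarrow> cos w < cos \<theta>"
  using assms by (simp add: sector_iff norm_mult)

lemma ray_in_csector_iff:
  assumes "0 \<le> w" "w \<le> pi" "t > 0"
  shows "of_real t * cis \<theta> \<in> csector w \<longleftrightarrow> cos w \<le> cos \<theta>"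
  using assms by (simp add: csector_iff norm_mult)

lemma ray_in_sector:
  assumes "\<bar>\<theta>\<bar> < w" "w \<le> pi" "t > 0"
  shows "of_real t * cis \<theta> \<in> sector w"
proof -
  have "cos w < cos \<bar>\<theta>\<bar>" using assms by (intro cos_monotone_0_pi) auto
  then show ?thesis using assms by (subst ray_in_sector_iff) auto
qed

text \<open>Angles beyond pi are included because one contour will be rotated through the negative
  real axis; there the cosine is reflected at pi.\<close>

lemma ray_notin_csector:
  assumes "0 \<le> w" "w < \<theta>" "\<theta> < 2 * pi - w" "t > 0"
  shows "of_real t * cis \<theta> \<notin> csector w" "of_real t * cis (- \<theta>) \<notin> csector w"
proof -
  have "cos \<theta> < cos w"
  proof (cases "\<theta> \<le> pi")
    case True
    then show ?thesis using assms by (intro cos_monotone_0_pi) auto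
  next
    case False
    then have "cos (2 * pi - \<theta>) < cos w" using assms by (intro cos_monotone_0_pi) auto
    then show ?thesis by (simp add: cos_diff)
  qed
  then show "of_real t * cis \<theta> \<notin> csector w" "of_real t * cis (- \<theta>) \<notin> csector w"
    using assms by (subst ray_in_csector_iff; auto)+
qed

lemma has_derivative_scaleC:
  fixes u :: "complex \<Rightarrow> 'a::complex_normed_vector"
  assumes "(h has_field_derivative h') (at z)"
    and "(u has_derivative (\<lambda>k. scaleC k u')) (at z)"
  shows "((\<lambda>z. scaleC (h z) (u z)) has_derivative
           (\<lambda>k. scaleC k (scaleC (h z) u' + scaleC h' (u z)))) (at z)"
proof -
  from scaleC.FDERIV[OF assms(1)[unfolded has_field_derivative_def] assms(2)]
  show ?thesis
    by (rule has_derivative_eq_rhs) (simp add: scaleC_add_right mult_ac fun_eq_iff)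
qed

lemma has_derivative_scaleC_const:
  fixes x :: "'a::complex_normed_vector"
  assumes "(h has_field_derivative h') (at z)"
  shows "((\<lambda>z. scaleC (h z) x) has_derivative (\<lambda>k. scaleC k (scaleC h' x))) (at z)"
  using bounded_linear.has_derivative[OF scaleC.bounded_linear_left
      assms[unfolded has_field_derivative_def], of x] by (simp add: mult.commute)

section \<open>Resolvents of a sectorial operator: algebra, bounds, complex
  differentiability\<close>

locale sectorial_operator =
  fixes Dom :: "'a::complex_banach set" and A :: "'a \<Rightarrow> 'a"
  assumes sectorial: "sectorial Dom A"
begin

abbreviation "Res \<equiv> resolvent Dom A"
abbreviation "\<omega> \<equiv> omega_se Dom A"
abbreviation "B \<equiv> one_plus_inv Dom A"

lemma zero_Dom: "0 \<in> Dom"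
  and Dom_add: "x \<in> Dom \<Longrightarrow> y \<in> Dom \<Longrightarrow> x + y \<in> Dom"
  and A_add: "x \<in> Dom \<Longrightarrow> y \<in> Dom \<Longrightarrow> A (x + y) = A x + A y"
  and Dom_scaleC: "x \<in> Dom \<Longrightarrow> scaleC c x \<in> Dom"
  and A_scaleC: "x \<in> Dom \<Longrightarrow> A (scaleC c x) = scaleC c (A x)"
  using sectorial unfolding sectorial_def closed_op_def by auto

lemma scaleC_minus1: "scaleC (- 1) x = - x" for x :: 'a
  by (simp add: scaleC.minus_left)

lemma Dom_minus: "x \<in> Dom \<Longrightarrow> - x \<in> Dom" and A_minus: "x \<in> Dom \<Longrightarrow> A (- x) = - A x"
  using Dom_scaleC[of x "-1"] A_scaleC[of x "-1"] by (simp_all add: scaleC_minus1)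

lemma Dom_diff: "x \<in> Dom \<Longrightarrow> y \<in> Dom \<Longrightarrow> x - y \<in> Dom"
  using Dom_add[of x "- y"] Dom_minus by simp

lemma A_diff: "x \<in> Dom \<Longrightarrow> y \<in> Dom \<Longrightarrow> A (x - y) = A x - A y"
  using A_add[of x "- y"] Dom_minus[of y] A_minus[of y] by simp

lemma A_0: "A 0 = 0"
  using A_scaleC[OF zero_Dom, of 0] by simp

lemma angles_nonempty: "{w. 0 \<le> w \<and> w < pi \<and> sect_cond Dom A w} \<noteq> {}"
  using sectorial unfolding sectorial_def by auto

lemma omega_nonneg: "0 \<le> \<omega>"
  unfolding omega_se_def using angles_nonempty by (intro cInf_greatest) auto

lemma omega_less_pi: "\<omega> < pi"
proof -
  obtain w where w: "0 \<le> w" "w < pi" "sect_cond Dom A w" using angles_nonempty by auto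
  have "\<omega> \<le> w"
    unfolding omega_se_def using w by (intro cInf_lower) (auto intro!: bdd_belowI[of _ 0])
  with w show ?thesis by simp
qed

text \<open>\<open>omega_se\<close> is an infimum; no attainment is invoked. An admissible angle v <
  w exists, and its sectoriality condition at w gives the bound outside the closed sector of angle
  w.\<close>

lemma resolvent_bound:
  assumes "\<omega> < w" "w < pi"
  obtains M where "M \<ge> 0" "\<And>z. z \<notin> csector w \<Longrightarrow> z \<in> resolvent_set Dom A"
    "\<And>z x. z \<notin> csector w \<Longrightarrow> cmod z * norm (Res z x) \<le> M * norm x"
proof -
  obtain v where v: "v < w" "sect_cond Dom A v"
    using cInf_lessD[OF angles_nonempty, of w] assms unfolding omega_se_def by auto
  obtain M where M: "\<And>z x. z \<notin> csector w \<Longrightarrow> cmod z * norm (Res z x) \<le> M * norm x"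
    using v assms unfolding sect_cond_def by blast
  show thesis
  proof (rule that)
    show "\<bar>M\<bar> \<ge> 0" by simp
    show "z \<in> resolvent_set Dom A" if "z \<notin> csector w" for z
      using v that unfolding sect_cond_def spectrum_op_def csector_def by auto
    show "cmod z * norm (Res z x) \<le> \<bar>M\<bar> * norm x" if "z \<notin> csector w" for z x
      using M[OF that, of x] by (meson abs_ge_self mult_right_mono norm_ge_zero order_trans)
  qed
qed

context
  fixes z assumes z: "z \<in> resolvent_set Dom A"
begin

lemma Res_bij: "bij_betw (\<lambda>x. scaleC z x - A x) Dom UNIV"
  using z unfolding resolvent_set_def by auto

lemma Res_Dom [simp, intro]: "Res z y \<in> Dom"
  unfolding resolvent_def using Res_bij by (intro inv_into_into) (auto simp: bij_betw_def)

lemma Res_right: "scaleC z (Res z y) - A (Res z y) = y"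
  unfolding resolvent_def
  using Res_bij f_inv_into_f[of y "\<lambda>x. scaleC z x - A x" Dom] by (auto simp: bij_betw_def)

lemma Res_left: "x \<in> Dom \<Longrightarrow> Res z (scaleC z x - A x) = x"
  unfolding resolvent_def
  using Res_bij inv_into_f_f[of "\<lambda>x. scaleC z x - A x" Dom x] by (auto simp: bij_betw_def)

lemma Res_eqI: "x \<in> Dom \<Longrightarrow> scaleC z x - A x = y \<Longrightarrow> Res z y = x"
  using Res_left by blast

lemma Res_add: "Res z (x + y) = Res z x + Res z y"
proof (rule Res_eqI)
  have "scaleC z (Res z x + Res z y) - A (Res z x + Res z y)
      = (scaleC z (Res z x) - A (Res z x)) + (scaleC z (Res z y) - A (Res z y))"
    by (simp add: A_add scaleC_add_right)
  then show "scaleC z (Res z x + Res z y) - A (Res z x + Res z y) = x + y"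
    by (simp only: Res_right)
qed (simp add: Dom_add)

lemma Res_scaleC: "Res z (scaleC c x) = scaleC c (Res z x)"
proof (rule Res_eqI)
  have "scaleC z (scaleC c (Res z x)) - A (scaleC c (Res z x))
      = scaleC c (scaleC z (Res z x) - A (Res z x))"
    by (simp add: A_scaleC scaleC.diff_right mult.commute)
  then show "scaleC z (scaleC c (Res z x)) - A (scaleC c (Res z x)) = scaleC c x"
    by (simp only: Res_right)
qed (simp add: Dom_scaleC)

lemma Res_minus: "Res z (- x) = - Res z x"
  using Res_scaleC[of "-1" x] by (simp add: scaleC_minus1)

lemma Res_diff: "Res z (x - y) = Res z x - Res z y"
  using Res_add[of x "- y"] by (simp add: Res_minus)

lemma cblin_Res: "cblin (Res z)"
proof -
  obtain C where C: "\<And>y. norm (Res z y) \<le> C * norm y"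
    using z unfolding resolvent_set_def by auto
  have "bounded_linear (Res z)"
  proof (rule bounded_linear_intro)
    show "norm (Res z x) \<le> norm x * C" for x using C[of x] by (simp add: mult.commute)
  qed (simp_all add: Res_add Res_scaleC scaleR_scaleC)
  then show ?thesis by (simp add: cblin_def Res_scaleC)
qed

lemma Res_kernel:
  assumes "z \<noteq> 0" "x \<in> Dom" "A x = 0"
  shows "Res z x = scaleC (1 / z) x"
  using assms by (intro Res_eqI) (simp_all add: Dom_scaleC A_scaleC)

end

lemma resolvent_identity:
  assumes z: "z \<in> resolvent_set Dom A" and v: "v \<in> resolvent_set Dom A"
  shows "Res z x - Res v x = scaleC (v - z) (Res z (Res v x))"
proof -
  have "Res z x - Res v x = Res z (scaleC v (Res v x) - A (Res v x))
      - Res z (scaleC z (Res v x) - A (Res v x))"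
    by (simp only: Res_right[OF v] Res_left[OF z Res_Dom[OF v]])
  also have "\<dots> = Res z (scaleC v (Res v x) - scaleC z (Res v x))"
    unfolding Res_diff[OF z, symmetric] by simp
  also have "\<dots> = scaleC (v - z) (Res z (Res v x))"
    by (simp add: Res_scaleC[OF z] scaleC.diff_left[symmetric])
  finally show ?thesis .
qed

text \<open>Two applications of the resolvent identity leave the remainder (z - y)^2 R(y) R(z)^2 x.
  On the ball of radius |z|/2 one has |y| \<ge> |z|/2, so the sectorial bound controls R(y)
  uniformly and the remainder is quadratic.\<close>

lemma has_derivative_Res:
  assumes w: "\<omega> < w" "w < pi" and z: "z \<notin> csector w"
  shows "((\<lambda>z. Res z x) has_derivative (\<lambda>k. scaleC k (- Res z (Res z x)))) (at z)"
proof -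
  obtain M where M: "M \<ge> 0" "\<And>z. z \<notin> csector w \<Longrightarrow> z \<in> resolvent_set Dom A"
    "\<And>z x. z \<notin> csector w \<Longrightarrow> cmod z * norm (Res z x) \<le> M * norm x"
    using resolvent_bound[OF w] by blast
  have z0: "z \<noteq> 0" using z by (auto simp: csector_def)
  define U where "U = - csector w \<inter> ball z (cmod z / 2)"
  have U: "open U" "z \<in> U"
    unfolding U_def using open_Compl_csector[of w] w omega_nonneg z z0 by auto
  define c where "c = norm (Res z (Res z x)) * M * 2 / cmod z"
  have est: "norm (Res y x - Res z x - scaleC (y - z) (- Res z (Res z x))) \<le> c * (cmod (y - z))\<^sup>2"
    if y: "y \<in> U" for y
  proof -
    have yr: "y \<in> resolvent_set Dom A" "z \<in> resolvent_set Dom A" using y z M by (auto simp: U_def)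
    have "cmod z - cmod y \<le> cmod z / 2"
      using y norm_triangle_ineq2[of z y] by (auto simp: U_def dist_norm)
    then have ly: "cmod z / 2 \<le> cmod y" by simp
    have "Res y x - Res z x - scaleC (y - z) (- Res z (Res z x))
        = scaleC (z - y) (Res y (Res z x)) - scaleC (z - y) (Res z (Res z x))"
      by (simp add: resolvent_identity[OF yr] scaleC.minus_right scaleC.diff_left)
    also have "\<dots> = scaleC ((z - y) * (z - y)) (Res y (Res z (Res z x)))"
      by (simp only: scaleC.diff_right[symmetric] resolvent_identity[OF yr] scaleC_scaleC)
    finally have eq: "norm (Res y x - Res z x - scaleC (y - z) (- Res z (Res z x)))
        = (cmod (y - z))\<^sup>2 * norm (Res y (Res z (Res z x)))"
      by (simp add: norm_mult power2_eq_square norm_minus_commute)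
    have "cmod z / 2 * norm (Res y (Res z (Res z x))) \<le> cmod y * norm (Res y (Res z (Res z x)))"
      using ly by (intro mult_right_mono) auto
    also have "\<dots> \<le> M * norm (Res z (Res z x))"
      using M(3) y by (auto simp: U_def)
    finally have "norm (Res y (Res z (Res z x))) \<le> c"
      using z0 by (simp add: c_def field_simps)
    then show ?thesis
      unfolding eq by (simp add: mult.commute[of c] mult_left_mono)
  qed
  obtain r where r: "r > 0" "ball z r \<subseteq> U" using U openE by blast
  show ?thesis
  proof (rule has_derivativeI_sandwich[where H = "\<lambda>y. c * cmod (y - z)" and e = r])
    show "bounded_linear (\<lambda>k. scaleC k (- Res z (Res z x)))"
      by (rule scaleC.bounded_linear_left)
    fix y assume y: "y \<noteq> z" "dist y z < r"
    then have "y \<in> U" using r by (auto simp: dist_commute)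
    from est[OF this] y(1)
    show "norm (Res y x - Res z x - scaleC (y - z) (- Res z (Res z x))) / norm (y - z) \<le> c * cmod (y - z)"
      by (simp add: divide_le_eq power2_eq_square mult_ac)
  next
    show "((\<lambda>y. c * cmod (y - z)) \<longlongrightarrow> 0) (at z)"
      by (auto intro!: tendsto_eq_intros)
  qed (rule r)
qed

text \<open>The vector may move with the parameter, because derivatives of the resolvent contain
  R(z) R(z) x. The difference u s - u a is absorbed by the uniform bound, and the fixed vector u a
  by strong continuity.\<close>

lemma continuous_on_Res:
  assumes w: "\<omega> < w" "w < pi" and p: "continuous_on S p" "\<And>s. s \<in> S \<Longrightarrow> p s \<notin> csector w"
    and u: "continuous_on S u"
  shows "continuous_on S (\<lambda>s. Res (p s) (u s))"
  unfolding continuous_on_def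
proof
  fix a assume a: "a \<in> S"
  obtain M where M: "M \<ge> 0" "\<And>z. z \<notin> csector w \<Longrightarrow> z \<in> resolvent_set Dom A"
    "\<And>z x. z \<notin> csector w \<Longrightarrow> cmod z * norm (Res z x) \<le> M * norm x"
    using resolvent_bound[OF w] by blast
  have p0: "p s \<noteq> 0" if "s \<in> S" for s using p(2)[OF that] by (auto simp: csector_def)
  have pl: "(p \<longlongrightarrow> p a) (at a within S)" and ul: "(u \<longlongrightarrow> u a) (at a within S)"
    using p(1) u a by (auto simp: continuous_on_def)
  have "isCont (\<lambda>z. Res z (u a)) (p a)"
    using has_derivative_continuous[OF has_derivative_Res[OF w p(2)[OF a]]] .
  then have 1: "((\<lambda>s. Res (p s) (u a)) \<longlongrightarrow> Res (p a) (u a)) (at a within S)"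
    using pl by (rule isCont_tendsto_compose)
  have 2: "((\<lambda>s. Res (p s) (u s - u a)) \<longlongrightarrow> 0) (at a within S)"
  proof (rule Lim_null_comparison)
    show "\<forall>\<^sub>F s in at a within S. norm (Res (p s) (u s - u a)) \<le> M / cmod (p s) * norm (u s - u a)"
      unfolding eventually_at_filter
    proof (intro always_eventually allI impI)
      fix s assume "s \<in> S"
      then show "norm (Res (p s) (u s - u a)) \<le> M / cmod (p s) * norm (u s - u a)"
        using M(3)[OF p(2), of s "u s - u a"] p0[of s] by (simp add: field_simps)
    qed
    have "((\<lambda>s. M / cmod (p s) * norm (u s - u a)) \<longlongrightarrow> M / cmod (p a) * norm (u a - u a)) (at a within S)"
      using p0[OF a] by (intro tendsto_intros pl ul) auto
    then show "((\<lambda>s. M / cmod (p s) * norm (u s - u a)) \<longlongrightarrow> 0) (at a within S)" by simp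
  qed
  have "((\<lambda>s. Res (p s) (u s - u a) + Res (p s) (u a)) \<longlongrightarrow> Res (p a) (u a)) (at a within S)"
    using tendsto_add[OF 2 1] by simp
  moreover have "Res (p s) (u s - u a) + Res (p s) (u a) = Res (p s) (u s)" if "s \<in> S" for s
    by (simp add: Res_add[OF M(2)[OF p(2)[OF that]], symmetric])
  ultimately show "((\<lambda>s. Res (p s) (u s)) \<longlongrightarrow> Res (p a) (u a)) (at a within S)"
    by (subst (asm) tendsto_cong) (auto simp: eventually_at_filter)
qed

lemma neg_real_notin_csector: "t > 0 \<Longrightarrow> w < pi \<Longrightarrow> - complex_of_real t \<notin> csector w"
  using Arg_of_real[of "- t"] by (auto simp: csector_def)

lemma neg_real_resolvent_set: "t > 0 \<Longrightarrow> - complex_of_real t \<in> resolvent_set Dom A"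
proof -
  assume "t > 0"
  have w: "\<omega> < (\<omega> + pi) / 2" "(\<omega> + pi) / 2 < pi" using omega_less_pi by auto
  show ?thesis
    using resolvent_bound[OF w] neg_real_notin_csector[OF \<open>t > 0\<close> w(2)] by metis
qed

lemma minus1_resolvent_set: "- 1 \<in> resolvent_set Dom A"
  using neg_real_resolvent_set[of 1] by simp

lemma B_eq: "B y = - Res (- 1) y"
proof -
  note m = minus1_resolvent_set
  have eq: "x + A x = - (scaleC (- 1) x - A x)" for x by (simp add: scaleC_minus1)
  have inj: "inj_on (\<lambda>x. x + A x) Dom"
  proof (rule inj_onI)
    fix x y assume xy: "x \<in> Dom" "y \<in> Dom" "x + A x = y + A y"
    then have "scaleC (- 1) x - A x = scaleC (- 1) y - A y"
      unfolding eq by (simp only: neg_equal_iff_equal)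
    then show "x = y"
      using Res_bij[OF m] xy unfolding bij_betw_def by (auto dest: inj_onD)
  qed
  have d: "- Res (- 1) y \<in> Dom" using m by (auto intro: Dom_minus)
  have "- Res (- 1) y + A (- Res (- 1) y) = y"
    using Res_right[OF m, of y] by (simp add: A_minus m scaleC_minus1)
  then show ?thesis
    unfolding one_plus_inv_def using inv_into_f_f[OF inj d] by simp
qed

lemma B_Dom [simp, intro]: "B y \<in> Dom"
  using minus1_resolvent_set by (auto simp: B_eq intro: Dom_minus)

lemma A_B: "A (B y) = y - B y"
proof -
  have "- Res (- 1) y - A (Res (- 1) y) = y"
    using Res_right[OF minus1_resolvent_set, of y] by (simp only: scaleC_minus1)
  then have "y - B y = (- Res (- 1) y - A (Res (- 1) y)) - B y" by (simp only:)
  also have "\<dots> = A (B y)"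
    by (simp add: B_eq A_minus minus1_resolvent_set)
  finally show ?thesis by simp
qed

lemma B_add: "B (x + y) = B x + B y"
  and B_diff: "B (x - y) = B x - B y"
  and B_scaleC: "B (scaleC c x) = scaleC c (B x)"
  by (simp_all add: B_eq Res_add Res_diff Res_scaleC minus1_resolvent_set scaleC.minus_right)

lemma B_of_Dom: "x \<in> Dom \<Longrightarrow> B (x + A x) = x"
  using Res_left[OF minus1_resolvent_set, of "- x"]
  by (simp add: B_eq A_minus Dom_minus scaleC_minus1 Res_minus[OF minus1_resolvent_set, symmetric])

lemma cblin_B: "cblin B"
proof -
  have "bounded_linear (\<lambda>y. - Res (- 1) y)"
    using cblin_Res[OF minus1_resolvent_set] unfolding cblin_def by (auto intro: bounded_linear_minus)
  then show ?thesis by (simp add: cblin_def B_scaleC B_eq[abs_def] Res_scaleC minus1_resolvent_set scaleC.minus_right)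
qed

lemma B_eq_0: "B y = 0 \<Longrightarrow> y = 0"
  using A_B[of y] A_0 by simp

lemma B_comm_alg: "B \<in> comm_alg Dom A"
  using cblin_B by (simp add: comm_alg_def)

text \<open>Turns the kernel of an unbounded operator into the fixed points of a bounded one, a
  condition that survives limits and the operators D.\<close>

lemma kernel_iff: "y \<in> Dom \<and> A y = 0 \<longleftrightarrow> B y = y"
proof
  assume "y \<in> Dom \<and> A y = 0"
  then show "B y = y" using B_of_Dom[of y] by simp
next
  assume "B y = y"
  then show "y \<in> Dom \<and> A y = 0" using A_B[of y] B_Dom[of y] by simp
qed

lemma Res_B:
  assumes z: "z \<in> resolvent_set Dom A"
  shows "scaleC (1 + z) (Res z (B x)) = Res z x + B x"
  using resolvent_identity[OF z minus1_resolvent_set, of x]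
  by (simp add: B_eq Res_minus[OF z] scaleC.minus_right scaleC.diff_left scaleC_add_left scaleC.minus_left)

lemma Res_A:
  assumes z: "z \<in> resolvent_set Dom A" and x: "x \<in> Dom"
  shows "Res z (A x) = scaleC z (Res z x) - x"
  using Res_left[OF z x] by (simp add: Res_diff[OF z] Res_scaleC[OF z] algebra_simps)

section \<open>The closure of the range of A\<close>

text \<open>This is the closure of the range of A, since A B = I - B and B maps onto
  \<open>Dom\<close>. Writing it through I - B makes invariance under operators commuting with B
  immediate.\<close>

definition clran :: "'a set" where
  "clran = closure (range (\<lambda>v. v - B v))"

lemma closed_clran: "closed clran"
  by (simp add: clran_def)

lemma A_in_clran: "x \<in> Dom \<Longrightarrow> A x \<in> clran"
  using closure_subset[of "range (\<lambda>v. v - B v)"] B_of_Dom[of x]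
  unfolding clran_def by (metis add_diff_cancel_left' rangeI subsetD)

lemma diff_B_in_clran: "v - B v \<in> clran"
  using A_in_clran[OF B_Dom] by (simp add: A_B)

lemma clran_invariant:
  assumes D: "cblin D" "\<And>v. D (B v) = B (D v)" and y: "y \<in> clran"
  shows "D y \<in> clran"
proof -
  interpret D: bounded_linear D using D(1) by (simp add: cblin_def)
  have "D ` closure (range (\<lambda>v. v - B v)) \<subseteq> closure (D ` range (\<lambda>v. v - B v))"
    by (intro continuous_image_closure_subset[OF _ closure_subset] closure_minimal order_refl
        linear_continuous_on D.bounded_linear_axioms) 
  also have "\<dots> \<subseteq> closure (range (\<lambda>v. v - B v))"
    by (intro closure_mono) (auto simp: D.diff D(2))
  finally show ?thesis using y by (auto simp: clran_def)
qed

lemma scaleC_clran: "y \<in> clran \<Longrightarrow> scaleC c y \<in> clran"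
  by (rule clran_invariant)
     (auto simp: cblin_def B_scaleC mult.commute intro: scaleC.bounded_linear_right)

lemma subspace_clran: "subspace clran"
proof -
  let ?V = "range (\<lambda>v. v - B v)"
  have sub: "subspace ?V"
    unfolding subspace_def
  proof (intro conjI ballI allI)
    have "0 = 0 - B 0" using B_diff[of 0 0] by simp
    then show "0 \<in> ?V" by (rule range_eqI)
  next
    fix x y assume "x \<in> ?V" "y \<in> ?V"
    then obtain v v' where "x = v - B v" "y = v' - B v'" by auto
    then have "x + y = (v + v') - B (v + v')" by (simp add: B_add)
    then show "x + y \<in> ?V" by (rule range_eqI)
  next
    fix c x assume "x \<in> ?V"
    then obtain v where "x = v - B v" by auto
    then have "c *\<^sub>R x = c *\<^sub>R v - B (c *\<^sub>R v)"
      by (simp add: scaleR_scaleC B_scaleC scaleC.diff_right)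
    then show "c *\<^sub>R x \<in> ?V" by (rule range_eqI)
  qed
  show ?thesis
    unfolding subspace_def
  proof (intro conjI ballI allI)
    show "0 \<in> clran"
      unfolding clran_def by (rule subsetD[OF closure_subset subspace_0[OF sub]])
  next
    fix x y assume "x \<in> clran" "y \<in> clran"
    then obtain f g where "\<And>n. f n \<in> ?V" "f \<longlonglongrightarrow> x" "\<And>n. g n \<in> ?V" "g \<longlonglongrightarrow> y"
      unfolding clran_def closure_sequential by metis
    then have "\<And>n. f n + g n \<in> ?V" "(\<lambda>n. f n + g n) \<longlonglongrightarrow> x + y"
      by (auto intro: subspace_add[OF sub] tendsto_add)
    then show "x + y \<in> clran"
      unfolding clran_def closure_sequential by (intro exI[of _ "\<lambda>n. f n + g n"]) simp
  next
    fix c x assume "x \<in> clran"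
    then show "c *\<^sub>R x \<in> clran" by (simp add: scaleR_scaleC scaleC_clran)
  qed
qed

text \<open>On the kernel of \<open>A\<close> the operators \<open>t (t + A)\<^sup>-\<^sup>1\<close> are the identity, while they tend to 0 strongly
  on the range of \<open>A\<close> as \<open>t\<close> tends to 0.\<close>
lemma clran_Int_kernel:
  assumes y: "y \<in> clran" "B y = y"
  shows "y = 0"
proof -
  have w: "\<omega> < (\<omega> + pi) / 2" "(\<omega> + pi) / 2 < pi" using omega_less_pi by auto
  let ?w = "(\<omega> + pi) / 2"
  obtain M where M: "M \<ge> 0"
    "\<And>z x. z \<notin> csector ?w \<Longrightarrow> cmod z * norm (Res z x) \<le> M * norm x"
    by (rule resolvent_bound[OF w]) (rule that)
  have bound: "t * norm (Res (- of_real t) x) \<le> M * norm x" if "t > 0" for t x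
    using M(2)[OF neg_real_notin_csector[OF that w(2)], of x] that by simp
  have est: "norm y \<le> M * norm (y - (v - B v))" for v
  proof (rule field_le_epsilon)
    fix e :: real assume e: "e > 0"
    define b where "b = B v"
    have b: "b \<in> Dom" "A b = v - B v" by (simp_all add: b_def A_B)
    \<comment> \<open>Chosen so that the contribution t R(-t) A b, of norm at most t ((M + 1) |b|),
      is below e; the additional 1 keeps the denominator positive.\<close>
    define t where "t = e / ((M + 1) * norm b + 1)"
    have dpos: "(M + 1) * norm b + 1 > 0" using M(1) by (simp add: add_nonneg_pos)
    have t: "t > 0" using e dpos by (simp add: t_def)
    let ?z = "- complex_of_real t"
    have z: "?z \<in> resolvent_set Dom A" using t by (rule neg_real_resolvent_set)
    have "Res ?z y = scaleC (1 / ?z) y"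
      using t y(2) kernel_iff by (intro Res_kernel[OF z]) auto
    then have "norm y = t * norm (Res ?z y)"
      using t by (simp add: norm_divide)
    also have "Res ?z y = Res ?z (y - (v - B v)) + Res ?z (A b)"
      by (simp add: Res_add[OF z, symmetric] b)
    also have "t * norm (Res ?z (y - (v - B v)) + Res ?z (A b))
        \<le> t * norm (Res ?z (y - (v - B v))) + t * norm (Res ?z (A b))"
      using t norm_triangle_ineq by (simp add: distrib_left[symmetric])
    also have "t * norm (Res ?z (A b)) \<le> t * ((M + 1) * norm b)"
    proof -
      have "norm (Res ?z (A b)) \<le> t * norm (Res ?z b) + norm b"
        using norm_triangle_ineq4[of "scaleC ?z (Res ?z b)" b] t by (simp add: Res_A[OF z b(1)])
      also have "\<dots> \<le> (M + 1) * norm b" using bound[OF t, of b] by (simp add: algebra_simps)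
      finally show ?thesis using t by (intro mult_left_mono) auto
    qed
    also have "t * ((M + 1) * norm b) \<le> t * ((M + 1) * norm b + 1)" using t by simp
    also have "t * ((M + 1) * norm b + 1) = e" using dpos by (simp add: t_def)
    finally show "norm y \<le> M * norm (y - (v - B v)) + e"
      using bound[OF t, of "y - (v - B v)"] by simp
  qed
  have small: "norm y \<le> e" if e: "e > 0" for e
  proof -
    obtain v where v: "dist (v - B v) y < e / (M + 1)"
      using y(1) e M(1) unfolding clran_def closure_approachable
      by (metis (no_types, lifting) add_nonneg_pos divide_pos_pos rangeE zero_less_one)
    have "norm y \<le> M * norm (y - (v - B v))" by (rule est)
    also have "\<dots> \<le> (M + 1) * norm (y - (v - B v))" by (intro mult_right_mono) auto
    also have "\<dots> \<le> e"
      using v M(1) by (simp add: dist_norm norm_minus_commute field_simps)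
    finally show ?thesis .
  qed
  show ?thesis
  proof (rule ccontr)
    assume "y \<noteq> 0"
    then show False using small[of "norm y / 2"] by simp
  qed
qed

end

section \<open>The class of integrable holomorphic functions on a sector\<close>

text \<open>Expanding the square, and using cos \<theta> \<ge> c - 1 in the mixed term, leaves a
  surplus of (1 - c)(a - t)^2. The constant c measures how far the ray stays from the negative
  axis.\<close>

lemma cmod_add_ray_ge:
  assumes "a \<ge> 0" "t \<ge> 0" "c \<le> 1" "c - 1 \<le> cos \<theta>"
  shows "c * (a\<^sup>2 + t\<^sup>2) \<le> (cmod (of_real a + of_real t * cis \<theta>))\<^sup>2"
proof -
  have "(cmod (of_real a + of_real t * cis \<theta>))\<^sup>2 = a\<^sup>2 + 2 * (a * t) * cos \<theta> + t\<^sup>2"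
  proof -
    have "(cmod (of_real a + of_real t * cis \<theta>))\<^sup>2 = (a + t * cos \<theta>)\<^sup>2 + (t * sin \<theta>)\<^sup>2"
      by (simp add: cmod_power2)
    also have "\<dots> = a\<^sup>2 + 2 * (a * t) * cos \<theta> + (t\<^sup>2 * (sin \<theta>)\<^sup>2 + t\<^sup>2 * (cos \<theta>)\<^sup>2)"
      by (simp add: power2_eq_square algebra_simps)
    also have "t\<^sup>2 * (sin \<theta>)\<^sup>2 + t\<^sup>2 * (cos \<theta>)\<^sup>2 = t\<^sup>2"
      by (simp flip: distrib_left)
    finally show ?thesis .
  qed
  moreover have "2 * (a * t) * (c - 1) \<le> 2 * (a * t) * cos \<theta>"
    using assms by (intro mult_left_mono) auto
  moreover have "0 \<le> (1 - c) * (a - t)\<^sup>2"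
    using assms by simp
  ultimately show ?thesis
    by (simp add: power2_eq_square algebra_simps)
qed

lemma sector_angle_const:
  assumes "0 \<le> d" "d < pi"
  obtains c where "c > 0" "c \<le> 1" "\<And>\<theta>. \<bar>\<theta>\<bar> \<le> d \<Longrightarrow> c - 1 \<le> cos \<theta>"
proof
  have "cos d > cos pi" using assms by (intro cos_monotone_0_pi) auto
  then show "min 1 (1 + cos d) > 0" by simp
  show "min 1 (1 + cos d) - 1 \<le> cos \<theta>" if "\<bar>\<theta>\<bar> \<le> d" for \<theta>
  proof -
    have "cos d \<le> cos \<bar>\<theta>\<bar>" using assms that by (intro cos_monotone_0_pi_le) auto
    then show ?thesis by (simp add: min_def)
  qed
qed simp

lemma sector_ray_cases:
  assumes "z \<in> sector w"
  obtains t \<theta> where "t > 0" "\<bar>\<theta>\<bar> < w" "z = of_real t * cis \<theta>"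
  using assms that[of "cmod z" "Arg z"] rcis_cmod_Arg[of z] by (auto simp: sector_def rcis_def)

lemma one_plus_sector: "z \<in> sector w \<Longrightarrow> w \<le> pi \<Longrightarrow> 1 + z \<noteq> 0"
  using Arg_of_real[of "-1"] by (auto simp: sector_def add_eq_0_iff)

lemma continuous_on_ray:
  assumes "continuous_on (sector w) f" "\<bar>\<theta>\<bar> < w" "w \<le> pi"
  shows "continuous_on {0<..} (\<lambda>t. f (of_real t * cis \<theta>))"
  by (rule continuous_on_compose2[OF assms(1)])
     (use assms in \<open>auto intro!: continuous_intros ray_in_sector\<close>)

lemma
  assumes "h \<in> Ecl w"
  shows Ecl_holomorphic: "h holomorphic_on sector w"
    and Ecl_bounded: "\<exists>M\<ge>0. \<forall>z\<in>sector w. cmod (h z) \<le> M"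
    and Ecl_ray_integrable: "\<bar>\<theta>\<bar> < w \<Longrightarrow> (\<lambda>t. cmod (h (of_real t * cis \<theta>)) / t) integrable_on {0<..}"
proof -
  show "h holomorphic_on sector w" using assms by (simp add: Ecl_def)
  have "bounded (h ` sector w)" using assms by (simp add: Ecl_def)
  then obtain M where "\<forall>z\<in>sector w. cmod (h z) \<le> M" by (auto simp: bounded_iff)
  then show "\<exists>M\<ge>0. \<forall>z\<in>sector w. cmod (h z) \<le> M"
    by (intro exI[of _ "\<bar>M\<bar>"]) (auto intro: order_trans[OF _ abs_ge_self])
  show "(\<lambda>t. cmod (h (of_real t * cis \<theta>)) / t) integrable_on {0<..}" if th: "\<bar>\<theta>\<bar> < w"
  proof -
    have "0 \<le> \<bar>\<theta>\<bar>" by simp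
    then have "set_integrable lborel {0<..} (\<lambda>t::real. cmod (h (of_real t * cis \<bar>\<theta>\<bar>)) / t) \<and>
        set_integrable lborel {0<..} (\<lambda>t::real. cmod (h (of_real t * cis (- \<bar>\<theta>\<bar>))) / t)"
      using assms th unfolding Ecl_def by blast
    then have "set_integrable lborel {0<..} (\<lambda>t::real. cmod (h (of_real t * cis \<theta>)) / t)"
      by (cases "\<theta> \<ge> 0") auto
    then show ?thesis by (rule set_borel_integral_eq_integral(1))
  qed
qed

lemma cmod_e0_ray_le:
  assumes "c > 0" "c \<le> 1" "c - 1 \<le> cos \<theta>" "t > 0"
  shows "cmod (of_real t * cis \<theta> / (1 + of_real t * cis \<theta>)\<^sup>2) \<le> t / (c * (1 + t\<^sup>2))"
proof -
  have "c * (1 + t\<^sup>2) \<le> (cmod (1 + of_real t * cis \<theta>))\<^sup>2"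
    using cmod_add_ray_ge[of 1 t c \<theta>] assms by simp
  moreover have "c * (1 + t\<^sup>2) > 0" using assms by (simp add: add_pos_nonneg)
  ultimately have "t / (cmod (1 + of_real t * cis \<theta>))\<^sup>2 \<le> t / (c * (1 + t\<^sup>2))"
    using assms by (intro frac_le) auto
  then show ?thesis using assms by (simp add: norm_divide norm_mult norm_power)
qed

text \<open>On a ray z/(1+z)^2 has size at most t/(c (1+t^2)), so division by t leaves the
  integrable M/(c (1+t^2)). This is what makes z/(1+z)^2 a regulariser of every bounded holomorphic
  function.\<close>

lemma e0_mult_Ecl:
  assumes w: "0 < w" "w < pi" and f: "f holomorphic_on sector w" "\<And>z. z \<in> sector w \<Longrightarrow> cmod (f z) \<le> M"
  shows "(\<lambda>z. z / (1 + z)\<^sup>2 * f z) \<in> Ecl w" (is "?g \<in> _")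
proof -
  obtain c where c: "c > 0" "c \<le> 1" "\<And>\<theta>. \<bar>\<theta>\<bar> \<le> w \<Longrightarrow> c - 1 \<le> cos \<theta>"
    using sector_angle_const[of w] w by auto
  have bound: "cmod (?g (of_real t * cis \<theta>)) \<le> t * (M / c / (1 + t\<^sup>2))" if "\<bar>\<theta>\<bar> < w" "t > 0" for t \<theta>
  proof -
    have "cmod (?g (of_real t * cis \<theta>)) \<le> t / (c * (1 + t\<^sup>2)) * M"
      unfolding norm_mult[of "_ / _"]
      using cmod_e0_ray_le[OF c(1,2) c(3), of \<theta> t] f(2)[OF ray_in_sector[of \<theta> w t]] that w c
      by (intro mult_mono) auto
    then show ?thesis by (simp add: mult_ac)
  qed
  have hol: "?g holomorphic_on sector w"
    using one_plus_sector[of _ w] w by (intro holomorphic_intros f(1)) auto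
  have "cmod (?g z) \<le> M / c" if z: "z \<in> sector w" for z
  proof -
    obtain t \<theta> where t: "t > 0" "\<bar>\<theta>\<bar> < w" "z = of_real t * cis \<theta>" using sector_ray_cases[OF z] .
    have M: "M \<ge> 0" using f(2)[OF z] norm_ge_zero order_trans by blast
    have "2 * t \<le> 1 + t\<^sup>2" using sum_squares_bound[of 1 t] by simp
    then have "t \<le> 1 + t\<^sup>2" using t by linarith
    then have "M / c * t \<le> M / c * (1 + t\<^sup>2)" using M c by (intro mult_left_mono) auto
    then have "(M / c * t) / (1 + t\<^sup>2) \<le> M / c"
      by (subst pos_divide_le_eq) (auto simp: add_pos_nonneg)
    then have "t * (M / c / (1 + t\<^sup>2)) \<le> M / c"
      by (simp add: mult_ac)
    then show ?thesis using bound[OF t(2,1)] t(3) by simp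
  qed
  then have bd: "bounded (?g ` sector w)"
    by (auto simp: bounded_iff)
  have "set_integrable lborel {0<..} (\<lambda>t::real. cmod (?g (of_real t * cis \<theta>)) / t)" if th: "\<bar>\<theta>\<bar> < w" for \<theta>
  proof (rule set_integrable_bound[OF set_integrable_inverse_1_plus_square])
    have "continuous_on {0<..} (\<lambda>t. ?g (of_real t * cis \<theta>))"
      using w by (intro continuous_on_ray[OF holomorphic_on_imp_continuous_on[OF hol] th]) simp
    then have "continuous_on {0<..} (\<lambda>t. cmod (?g (of_real t * cis \<theta>)) / t)"
      by (intro continuous_on_divide continuous_on_norm continuous_on_id) auto
    then have "(\<lambda>t. indicator {0<..} t *\<^sub>R (cmod (?g (of_real t * cis \<theta>)) / t)) \<in> borel_measurable borel"
      by (intro borel_measurable_continuous_on_indicator) auto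
    then show "set_borel_measurable lborel {0<..} (\<lambda>t. cmod (?g (of_real t * cis \<theta>)) / t)"
      by (simp only: set_borel_measurable_def measurable_lborel2)
    show "AE t in lborel. t \<in> {0<..} \<longrightarrow> norm (cmod (?g (of_real t * cis \<theta>)) / t) \<le> norm (M / c / (1 + t\<^sup>2))"
    proof (intro always_eventually allI impI)
      fix t :: real assume "t \<in> {0<..}"
      then have t: "t > 0" by simp
      have "0 \<le> cmod (?g (of_real t * cis \<theta>)) / t" using t by simp
      moreover have "cmod (?g (of_real t * cis \<theta>)) / t \<le> M / c / (1 + t\<^sup>2)"
        using bound[OF th t] t by (metis pos_divide_le_eq mult.commute)
      ultimately show "norm (cmod (?g (of_real t * cis \<theta>)) / t) \<le> norm (M / c / (1 + t\<^sup>2))"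
        unfolding real_norm_def by linarith
    qed
  qed
  then show ?thesis
    unfolding Ecl_def using hol bd by auto
qed

section \<open>Boundary behaviour of functions integrable against dt/t\<close>

lemma log_integral_bound:
  fixes k :: "real \<Rightarrow> real"
  assumes int: "(\<lambda>t. k t / t) integrable_on {0<..}" and nn: "\<And>t. t > 0 \<Longrightarrow> k t \<ge> 0"
    and ab: "0 < a" "a \<le> b" and ge: "\<And>t. t \<in> {a..b} \<Longrightarrow> e \<le> k t"
  shows "e * ln (b / a) \<le> integral {0<..} (\<lambda>t. k t / t)"
proof -
  have sub: "{a..b} \<subseteq> {0<..}" using ab by auto
  have "((\<lambda>t. e * (1 / t)) has_integral (e * ln b - e * ln a)) {a..b}"
    using ab by (intro fundamental_theorem_of_calculus)
      (auto intro!: derivative_eq_intros simp: has_real_derivative_iff_has_vector_derivative[symmetric])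
  then have 1: "((\<lambda>t. e / t) has_integral e * ln (b / a)) {a..b}"
    using ab by (simp add: ln_div algebra_simps)
  have int2: "(\<lambda>t. k t / t) integrable_on {a..b}"
    using integrable_on_subcbox[OF int, of a b] sub by simp
  have "e * ln (b / a) \<le> integral {a..b} (\<lambda>t. k t / t)"
    unfolding integral_unique[OF 1, symmetric]
    using 1 int2 ge ab by (intro integral_le) (auto simp: has_integral_iff divide_right_mono)
  also have "\<dots> \<le> integral {0<..} (\<lambda>t. k t / t)"
    using nn by (intro integral_subset_le[OF sub int2 int]) auto
  finally show ?thesis .
qed

text \<open>The measure dt/t has infinite mass near 0 and near infinity, so an integrable
  nonnegative k cannot stay above a positive constant at either end. A limit need not exist for such
  a k, but a null sequence of values does.\<close>

lemma
  fixes k :: "real \<Rightarrow> real"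
  assumes int: "(\<lambda>t. k t / t) integrable_on {0<..}" and nn: "\<And>t. t > 0 \<Longrightarrow> k t \<ge> 0"
  shows log_integrable_small_seq_0: "\<exists>\<tau>. (\<forall>n. \<tau> n > 0) \<and> \<tau> \<longlonglongrightarrow> 0 \<and> (\<lambda>n::nat. k (\<tau> n)) \<longlonglongrightarrow> 0"
    and log_integrable_small_seq_top: "\<exists>\<tau>. (\<forall>n. \<tau> n > 0) \<and> filterlim \<tau> at_top sequentially \<and> (\<lambda>n::nat. k (\<tau> n)) \<longlonglongrightarrow> 0"
proof -
  define J where "J = integral {0<..} (\<lambda>t. k t / t)"
  \<comment> \<open>The interval has logarithmic length (J + 1)/e; k \<ge> e on all of it would
    force an integral of at least J + 1.\<close>
  have small: "\<exists>t\<in>{s..s * exp ((J + 1) / e)}. k t < e" if s: "s > 0" and e: "e > 0" for s e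
  proof (rule ccontr)
    assume "\<not> ?thesis"
    then have ge: "\<And>t. t \<in> {s..s * exp ((J + 1) / e)} \<Longrightarrow> e \<le> k t" by force
    have "J \<ge> 0" unfolding J_def using int nn by (intro integral_nonneg) auto
    then have "s \<le> s * exp ((J + 1) / e)" using s e by simp
    from log_integral_bound[OF int nn s this ge]
    have "e * ln (s * exp ((J + 1) / e) / s) \<le> J" by (simp only: J_def)
    then show False using s e by simp
  qed
  define e where "e n = 1 / real (Suc n)" for n
  have e: "e n > 0" for n by (simp add: e_def)
  have elim: "e \<longlonglongrightarrow> 0"
    unfolding e_def using LIMSEQ_inverse_real_of_nat by (simp add: inverse_eq_divide)
  have klim: "(\<lambda>n. k (\<tau> n)) \<longlonglongrightarrow> 0" if "\<And>n. \<tau> n > 0" "\<And>n. k (\<tau> n) < e n" for \<tau>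
    by (rule tendsto_sandwich[OF _ _ tendsto_const elim]) (use that nn in \<open>auto intro!: always_eventually less_imp_le\<close>)
  show "\<exists>\<tau>. (\<forall>n. \<tau> n > 0) \<and> \<tau> \<longlonglongrightarrow> 0 \<and> (\<lambda>n::nat. k (\<tau> n)) \<longlonglongrightarrow> 0"
  proof -
    have "\<forall>n. \<exists>t. 0 < t \<and> t \<le> e n \<and> k t < e n"
    proof
      fix n
      \<comment> \<open>The left end is placed so that the right end is exactly \<open>e n\<close>,
        which forces the chosen point below \<open>e n\<close>.\<close>
      define s where "s = e n / exp ((J + 1) / e n)"
      have "s > 0" using e by (simp add: s_def)
      moreover have "s * exp ((J + 1) / e n) = e n" by (simp add: s_def)
      ultimately show "\<exists>t. 0 < t \<and> t \<le> e n \<and> k t < e n"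
        using small[OF _ e, of s n] by (metis atLeastAtMost_iff less_le_trans)
    qed
    then obtain \<tau> where \<tau>: "\<And>n. 0 < \<tau> n" "\<And>n. \<tau> n \<le> e n" "\<And>n. k (\<tau> n) < e n" by metis
    moreover have "\<tau> \<longlonglongrightarrow> 0"
      by (rule tendsto_sandwich[OF _ _ tendsto_const elim]) (use \<tau> in \<open>auto intro!: always_eventually less_imp_le\<close>)
    ultimately show ?thesis using klim[of \<tau>] by blast
  qed
  show "\<exists>\<tau>. (\<forall>n. \<tau> n > 0) \<and> filterlim \<tau> at_top sequentially \<and> (\<lambda>n::nat. k (\<tau> n)) \<longlonglongrightarrow> 0"
  proof -
    have "\<forall>n. \<exists>t. real (Suc n) \<le> t \<and> k t < e n"
      using small[OF _ e] by (metis atLeastAtMost_iff of_nat_0_less_iff zero_less_Suc)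
    then obtain \<tau> where \<tau>: "\<And>n. real (Suc n) \<le> \<tau> n" "\<And>n. k (\<tau> n) < e n" by metis
    have pos: "\<tau> n > 0" for n using \<tau>(1)[of n] by simp
    have "filterlim (\<lambda>n. real (Suc n)) at_top sequentially"
      by (rule filterlim_compose[OF filterlim_real_sequentially filterlim_Suc])
    then have "filterlim \<tau> at_top sequentially"
      by (rule filterlim_at_top_mono) (use \<tau>(1) in auto)
    then show ?thesis using klim[OF pos \<tau>(2)] pos by blast
  qed
qed

text \<open>Cauchy's theorem for h(z)/z, whose integrability is known ray by ray and not uniformly
  in the angle. Replacing z by D(z) = (\<epsilon> + z)(1 + \<epsilon> z) gives decay like 1/(1+t^2),
  so the ray can be rotated from -d to d; then \<epsilon> \<rightarrow> 0. The zeros -\<epsilon> and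
  -1/\<epsilon> of D lie on the negative axis, outside the sector.\<close>

lemma integral_Ecl_over_ray_eq:
  fixes x :: "'a::complex_banach"
  assumes h: "h \<in> Ecl w" and d: "0 \<le> d" "d < w" and w: "w < pi"
  shows "integral {0<..} (\<lambda>t. scaleC (h (of_real t * cis d) / of_real t) x)
       = integral {0<..} (\<lambda>t. scaleC (h (of_real t * cis (- d)) / of_real t) x)"
proof -
  obtain c where c: "c > 0" "c \<le> 1" "\<And>\<theta>. \<bar>\<theta>\<bar> \<le> d \<Longrightarrow> c - 1 \<le> cos \<theta>"
    using sector_angle_const[of d] d w by auto
  obtain M where M: "M \<ge> 0" "\<And>z. z \<in> sector w \<Longrightarrow> cmod (h z) \<le> M"
    using Ecl_bounded[OF h] by auto
  note hol = Ecl_holomorphic[OF h]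
  define e where "e n = 1 / real (Suc n)" for n
  have e: "0 < e n" "e n \<le> 1" for n by (auto simp: e_def)
  have elim: "e \<longlonglongrightarrow> 0"
    unfolding e_def using LIMSEQ_inverse_real_of_nat by (simp add: inverse_eq_divide)
  define D where "D n z = (of_real (e n) + z) * (1 + of_real (e n) * z)" for n and z :: complex
  define q where "q n z = h z / D n z" for n z
  \<comment> \<open>The first bound does not involve n and yields the majorant for \<epsilon>
    \<rightarrow> 0; the second, for fixed n, yields the quadratic decay needed to rotate.\<close>
  have D_ge: "c * t \<le> cmod (D n (of_real t * cis \<theta>))" (is ?A)
      "c * (e n)\<^sup>2 * (1 + t\<^sup>2) \<le> cmod (D n (of_real t * cis \<theta>))" (is ?B)
    if th: "\<bar>\<theta>\<bar> \<le> d" and t: "t > 0" for n t \<theta>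
  proof -
    let ?e = "e n"
    have e1: "?e\<^sup>2 \<le> 1" "?e\<^sup>2 \<ge> 0" using e[of n] by (auto simp: power_le_one)
    have "c * (?e\<^sup>2 + t\<^sup>2) \<le> (cmod (of_real ?e + of_real t * cis \<theta>))\<^sup>2"
      using e[of n] t c th by (intro cmod_add_ray_ge) auto
    moreover have "c * (1\<^sup>2 + (?e * t)\<^sup>2) \<le> (cmod (of_real 1 + of_real (?e * t) * cis \<theta>))\<^sup>2"
      using e[of n] t c th by (intro cmod_add_ray_ge) auto
    ultimately have "(c * (?e\<^sup>2 + t\<^sup>2)) * (c * (1 + (?e * t)\<^sup>2)) \<le> (cmod (D n (of_real t * cis \<theta>)))\<^sup>2"
      unfolding D_def norm_mult power_mult_distrib
      using c by (intro mult_mono) (auto simp: mult.assoc)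
    moreover have "(c * t)\<^sup>2 \<le> (c * (?e\<^sup>2 + t\<^sup>2)) * (c * (1 + (?e * t)\<^sup>2))"
    proof -
      have "(c * t\<^sup>2) * (c * 1) \<le> (c * (?e\<^sup>2 + t\<^sup>2)) * (c * (1 + (?e * t)\<^sup>2))"
        using c by (intro mult_mono) auto
      then show ?thesis by (simp add: power2_eq_square mult_ac)
    qed
    moreover have "(c * ?e\<^sup>2 * (1 + t\<^sup>2))\<^sup>2 \<le> (c * (?e\<^sup>2 + t\<^sup>2)) * (c * (1 + (?e * t)\<^sup>2))"
    proof -
      have "?e\<^sup>2 * t\<^sup>2 \<le> 1 * t\<^sup>2" using e1 by (intro mult_right_mono) auto
      then have "?e\<^sup>2 * (1 + t\<^sup>2) \<le> ?e\<^sup>2 + t\<^sup>2" "?e\<^sup>2 * (1 + t\<^sup>2) \<le> 1 + (?e * t)\<^sup>2"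
        using e1 by (simp_all add: power_mult_distrib algebra_simps)
      then have "(c * (?e\<^sup>2 * (1 + t\<^sup>2))) * (c * (?e\<^sup>2 * (1 + t\<^sup>2)))
          \<le> (c * (?e\<^sup>2 + t\<^sup>2)) * (c * (1 + (?e * t)\<^sup>2))"
        using c by (intro mult_mono mult_left_mono) auto
      then show ?thesis by (simp add: power2_eq_square mult_ac)
    qed
    ultimately have sq: "(c * t)\<^sup>2 \<le> (cmod (D n (of_real t * cis \<theta>)))\<^sup>2"
        "(c * ?e\<^sup>2 * (1 + t\<^sup>2))\<^sup>2 \<le> (cmod (D n (of_real t * cis \<theta>)))\<^sup>2"
      by linarith+
    show ?A by (rule power2_le_imp_le[OF sq(1)]) simp
    show ?B by (rule power2_le_imp_le[OF sq(2)]) simp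
  qed
  have D_nz: "D n z \<noteq> 0" if "z \<in> sector w" for n z
  proof -
    have "of_real (e n) + z \<noteq> 0"
    proof
      assume "of_real (e n) + z = 0"
      then have "z = of_real (- e n)" by (simp add: add_eq_0_iff)
      then show False using that e[of n] w Arg_of_real[of "- e n"] by (simp add: sector_def)
    qed
    moreover have "1 + of_real (e n) * z \<noteq> 0"
    proof
      assume "1 + of_real (e n) * z = 0"
      then have "z = of_real (- (1 / e n))" using e[of n] by (simp add: add_eq_0_iff field_simps)
      then show False using that e[of n] w Arg_of_real[of "- (1 / e n)"] by (simp add: sector_def)
    qed
    ultimately show ?thesis by (simp add: D_def)
  qed
  have openS: "open (sector w)" using d w by (intro open_sector) auto
  have Dhol: "D n holomorphic_on sector w" for n
    unfolding D_def by (intro holomorphic_intros)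
  have qhol: "q n holomorphic_on sector w" for n
    unfolding q_def using D_nz by (intro holomorphic_intros hol Dhol)
  have insect: "of_real t * cis \<theta> \<in> sector w" if "t > 0" "\<bar>\<theta>\<bar> \<le> d" for t \<theta>
    using that d w by (intro ray_in_sector) auto
  have shift: "integral {0<..} (\<lambda>t. scaleC (cis d) (scaleC (q n (of_real t * cis d)) x))
      = integral {0<..} (\<lambda>t. scaleC (cis (- d)) (scaleC (q n (of_real t * cis (- d))) x))" for n
  proof (rule ray_integral_shift_Lorentz[where g' = "\<lambda>z. scaleC (deriv (q n) z) x"])
    show "- d \<le> d" using d by simp
    fix t \<theta> :: real assume t: "t > 0" and th: "\<theta> \<in> {- d..d}"
    then have z: "of_real t * cis \<theta> \<in> sector w" by (intro insect) auto
    show "((\<lambda>z. scaleC (q n z) x) has_derivative (\<lambda>k. scaleC k (scaleC (deriv (q n) (of_real t * cis \<theta>)) x)))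
        (at (of_real t * cis \<theta>))"
      by (rule has_derivative_scaleC_const[OF holomorphic_derivI[OF qhol openS z]])
    have "cmod (q n (of_real t * cis \<theta>)) \<le> M / (c * (e n)\<^sup>2 * (1 + t\<^sup>2))"
      unfolding q_def norm_divide using M z D_ge(2)[of \<theta> t n] t th c e[of n]
      by (intro frac_le) (auto simp: add_pos_nonneg)
    then have "cmod (q n (of_real t * cis \<theta>)) * norm x \<le> M / (c * (e n)\<^sup>2 * (1 + t\<^sup>2)) * norm x"
      by (rule mult_right_mono) simp
    then show "norm (scaleC (q n (of_real t * cis \<theta>)) x) \<le> (M * norm x / (c * (e n)\<^sup>2)) / (1 + t\<^sup>2)"
      by (simp add: mult_ac)
  next
    have "continuous_on (sector w) (deriv (q n))"
      by (intro holomorphic_on_imp_continuous_on holomorphic_deriv qhol openS)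
    then have "continuous_on ({- d..d} \<times> {0<..}) (\<lambda>p. deriv (q n) (of_real (snd p) * cis (fst p)))"
      by (rule continuous_on_compose2) (auto intro!: continuous_intros insect)
    then show "continuous_on ({- d..d} \<times> {0<..}) (\<lambda>(\<theta>, t). scaleC (deriv (q n) (of_real t * cis \<theta>)) x)"
      unfolding split_def by (intro continuous_intros)
  qed
  have lim: "(\<lambda>n. integral {0<..} (\<lambda>t. scaleC (cis \<theta>) (scaleC (q n (of_real t * cis \<theta>)) x)))
      \<longlonglongrightarrow> integral {0<..} (\<lambda>t. scaleC (h (of_real t * cis \<theta>) / of_real t) x)" if th: "\<bar>\<theta>\<bar> \<le> d" for \<theta>
  proof (rule halfline_dominated_convergence)
    have th': "\<bar>\<theta>\<bar> < w" "w \<le> pi" using th d w by auto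
    have cont: "continuous_on {0<..} (\<lambda>t. h (of_real t * cis \<theta>))" "continuous_on {0<..} (\<lambda>t. q n (of_real t * cis \<theta>))" for n
      by (intro continuous_on_ray[OF _ th'] holomorphic_on_imp_continuous_on hol qhol)+
    show "continuous_on {0<..} (\<lambda>t. scaleC (h (of_real t * cis \<theta>) / of_real t) x)"
      by (intro continuous_on_scaleC continuous_on_divide cont continuous_intros) auto
    show "continuous_on {0<..} (\<lambda>t. scaleC (cis \<theta>) (scaleC (q n (of_real t * cis \<theta>)) x))" for n
      by (intro continuous_on_scaleC cont continuous_intros)
    show "(\<lambda>t. cmod (h (of_real t * cis \<theta>)) / t * (norm x / c)) integrable_on {0<..}"
      using Ecl_ray_integrable[OF h th'(1)] by (rule integrable_on_mult_left)
    fix t :: real assume t: "t > 0"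
    show "norm (scaleC (cis \<theta>) (scaleC (q n (of_real t * cis \<theta>)) x)) \<le> cmod (h (of_real t * cis \<theta>)) / t * (norm x / c)" for n
    proof -
      have "cmod (q n (of_real t * cis \<theta>)) \<le> cmod (h (of_real t * cis \<theta>)) / (c * t)"
        unfolding q_def norm_divide using D_ge(1)[OF th t, of n] c t by (intro frac_le) auto
      then have "cmod (q n (of_real t * cis \<theta>)) * norm x \<le> cmod (h (of_real t * cis \<theta>)) / (c * t) * norm x"
        by (rule mult_right_mono) simp
      then show ?thesis by (simp add: mult_ac norm_mult)
    qed
    have "(\<lambda>n. D n (of_real t * cis \<theta>)) \<longlonglongrightarrow> (of_real 0 + of_real t * cis \<theta>) * (1 + of_real 0 * (of_real t * cis \<theta>))"
      unfolding D_def by (intro tendsto_intros elim)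
    then have "(\<lambda>n. D n (of_real t * cis \<theta>)) \<longlonglongrightarrow> of_real t * cis \<theta>" by simp
    then have "(\<lambda>n. scaleC (cis \<theta>) (scaleC (q n (of_real t * cis \<theta>)) x))
        \<longlonglongrightarrow> scaleC (cis \<theta>) (scaleC (h (of_real t * cis \<theta>) / (of_real t * cis \<theta>)) x)"
      unfolding q_def using t by (intro scaleC.tendsto tendsto_intros) auto
    moreover have "cis \<theta> * (h (of_real t * cis \<theta>) / (of_real t * cis \<theta>)) = h (of_real t * cis \<theta>) / of_real t"
      by simp
    ultimately show "(\<lambda>n. scaleC (cis \<theta>) (scaleC (q n (of_real t * cis \<theta>)) x))
        \<longlonglongrightarrow> scaleC (h (of_real t * cis \<theta>) / of_real t) x" by (simp only: scaleC_scaleC)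
  qed
  show ?thesis
    using LIMSEQ_unique[OF lim[of d]] lim[of "- d"] d unfolding shift by simp
qed

text \<open>The primitive is Ln(1 - z) - Ln(1 + z): off the real axis neither argument meets the
  branch cut. It vanishes at 0 and tends to Ln(-cis \<theta>) - Ln(cis \<theta>) at infinity, where
  \<eta> is the principal argument of -cis \<theta>. This explicit value takes the place of a
  residue.\<close>

lemma ray_integral_Ln:
  assumes th: "- pi < \<theta>" "\<theta> < pi" "sin \<theta> \<noteq> 0" and et: "- pi < \<eta>" "\<eta> \<le> pi" "cis \<eta> = - cis \<theta>"
  defines "s \<equiv> \<lambda>t::real. cis \<theta> * (1 / (of_real t * cis \<theta> - 1) - 1 / (1 + of_real t * cis \<theta>))"
  shows "s integrable_on {0<..}" "integral {0<..} s = \<i> * of_real (\<eta> - \<theta>)"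
proof -
  define F where "F t = Ln (1 - of_real t * cis \<theta>) - Ln (1 + of_real t * cis \<theta>)" for t :: real
  \<comment> \<open>This one constant serves both \<theta> and \<theta> + pi, that is, both
    denominators 1 + z and 1 - z.\<close>
  define c where "c = 1 - \<bar>cos \<theta>\<bar>"
  have "\<bar>cos \<theta>\<bar> < 1"
  proof -
    have "(cos \<theta>)\<^sup>2 < 1\<^sup>2" using th(3) sin_cos_squared_add[of \<theta>] by (smt (verit) zero_less_power2 one_power2)
    then show ?thesis using abs_square_less_1 by auto
  qed
  then have c: "c > 0" "c \<le> 1" "c - 1 \<le> cos \<theta>" "c - 1 \<le> cos (\<theta> + pi)" by (auto simp: c_def)
  have im: "Im (1 - of_real t * cis \<theta>) \<noteq> 0" "Im (1 + of_real t * cis \<theta>) \<noteq> 0" if "t > 0" for t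
    using that th by auto
  have nz: "of_real t * cis \<theta> - 1 \<noteq> 0" "1 + of_real t * cis \<theta> \<noteq> 0" "1 - of_real t * cis \<theta> \<noteq> 0" if "t > 0" for t
    using im[OF that] by (auto simp: complex_eq_iff)
  have cont: "continuous_on {0<..} s"
    unfolding s_def using nz by (auto intro!: continuous_intros)
  have bound: "cmod (s t) \<le> (2 / c) / (1 + t\<^sup>2)" if t: "t > 0" for t
  proof -
    let ?z = "of_real t * cis \<theta>"
    have "c * (1\<^sup>2 + t\<^sup>2) \<le> (cmod (of_real 1 + of_real t * cis (\<theta> + pi)))\<^sup>2"
      using c t by (intro cmod_add_ray_ge) auto
    then have 1: "c * (1 + t\<^sup>2) \<le> (cmod (?z - 1))\<^sup>2"
      by (simp add: cis_mult[symmetric] norm_minus_commute)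
    have 2: "c * (1 + t\<^sup>2) \<le> (cmod (1 + ?z))\<^sup>2"
      using cmod_add_ray_ge[of 1 t c \<theta>] c t by simp
    have p: "c * (1 + t\<^sup>2) > 0" using c by (simp add: add_pos_nonneg)
    have "(c * (1 + t\<^sup>2))\<^sup>2 \<le> (cmod (?z - 1) * cmod (1 + ?z))\<^sup>2"
      unfolding power_mult_distrib[of "cmod _"] power2_eq_square[of "c * _"]
      using p by (intro mult_mono 1 2) auto
    then have ge: "c * (1 + t\<^sup>2) \<le> cmod (?z - 1) * cmod (1 + ?z)"
      by (rule power2_le_imp_le) simp
    have "s t = cis \<theta> * (2 / ((?z - 1) * (1 + ?z)))"
      unfolding s_def using nz[OF t] by (simp add: field_simps)
    then have "cmod (s t) = 2 / (cmod (?z - 1) * cmod (1 + ?z))"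
      by (simp add: norm_mult norm_divide)
    also have "\<dots> \<le> 2 / (c * (1 + t\<^sup>2))"
      using ge p by (intro frac_le) auto
    finally show ?thesis by simp
  qed
  note int = integrable_on_halfline[OF cont integrable_on_inverse_1_plus_square bound]
  show "s integrable_on {0<..}" by (rule int)
  have lim1: "(\<lambda>n. integral {1 / real (Suc n)..real (Suc n)} s) \<longlonglongrightarrow> integral {0<..} s"
    by (rule halfline_truncation_tendsto[OF cont integrable_on_inverse_1_plus_square bound])
  have Fder: "(F has_vector_derivative s t) (at t within S)" if t: "t > 0" for t S
  proof -
    let ?z = "of_real t * cis \<theta>"
    have z: "((\<lambda>t. of_real t * cis \<theta>) has_vector_derivative cis \<theta>) (at t within S)"
      by (rule has_vector_derivative_mult_of_real)
    have np: "1 - ?z \<notin> \<real>\<^sub>\<le>\<^sub>0" "1 + ?z \<notin> \<real>\<^sub>\<le>\<^sub>0"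
      using im[OF t] by (auto simp: complex_nonpos_Reals_iff)
    have d: "((\<lambda>z. Ln (1 - z) - Ln (1 + z)) has_field_derivative - 1 / (1 - ?z) - 1 / (1 + ?z)) (at ?z)"
      using np by (auto intro!: derivative_eq_intros simp: inverse_eq_divide)
    have "((\<lambda>t. Ln (1 - of_real t * cis \<theta>) - Ln (1 + of_real t * cis \<theta>))
        has_vector_derivative cis \<theta> * (- 1 / (1 - ?z) - 1 / (1 + ?z))) (at t within S)"
      using field_vector_diff_chain_within[OF z has_field_derivative_at_within[OF d]] by (simp add: o_def)
    moreover have "- 1 / (1 - ?z) = 1 / (?z - 1)" using nz[OF t] by (simp add: field_simps)
    ultimately show ?thesis unfolding F_def s_def by (simp only:)
  qed
  have FTC: "integral {1 / real (Suc n)..real (Suc n)} s = F (real (Suc n)) - F (1 / real (Suc n))" for n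
  proof -
    have "1 / real (Suc n) \<le> 1" "1 \<le> real (Suc n)" by auto
    then have le: "1 / real (Suc n) \<le> real (Suc n)" by linarith
    have pos: "t > 0" if "t \<in> {1 / real (Suc n)..real (Suc n)}" for t
      using that by (metis atLeastAtMost_iff divide_pos_pos less_le_trans of_nat_0_less_iff
        zero_less_Suc zero_less_one)
    show ?thesis
      using pos by (intro integral_unique fundamental_theorem_of_calculus le Fder) auto
  qed
  have elim: "(\<lambda>n. 1 / real (Suc n)) \<longlonglongrightarrow> 0"
    using LIMSEQ_inverse_real_of_nat by (simp add: inverse_eq_divide)
  have np: "- cis \<theta> \<notin> \<real>\<^sub>\<le>\<^sub>0" "cis \<theta> \<notin> \<real>\<^sub>\<le>\<^sub>0"
    using th(3) by (auto simp: complex_nonpos_Reals_iff)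
  have F0: "(\<lambda>n. F (1 / real (Suc n))) \<longlonglongrightarrow> 0"
  proof -
    have "(\<lambda>n. F (1 / real (Suc n))) \<longlonglongrightarrow> Ln (1 - of_real 0 * cis \<theta>) - Ln (1 + of_real 0 * cis \<theta>)"
      unfolding F_def by (intro tendsto_intros elim) auto
    then show ?thesis by simp
  qed
  have Finf: "(\<lambda>n. F (real (Suc n))) \<longlonglongrightarrow> Ln (- cis \<theta>) - Ln (cis \<theta>)"
  proof -
    \<comment> \<open>The positive factor n + 1 contributes the same real logarithm to both terms
      and cancels.\<close>
    have eq: "F (real (Suc n)) = Ln (of_real (1 / real (Suc n)) - cis \<theta>) - Ln (of_real (1 / real (Suc n)) + cis \<theta>)" for n
    proof -
      let ?r = "real (Suc n)"
      have e1: "1 - of_real ?r * cis \<theta> = of_real ?r * (of_real (1 / ?r) - cis \<theta>)"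
        "1 + of_real ?r * cis \<theta> = of_real ?r * (of_real (1 / ?r) + cis \<theta>)"
        by (simp_all add: right_diff_distrib distrib_left del: of_nat_Suc)
      have "of_real (1 / ?r) - cis \<theta> \<noteq> 0" "of_real (1 / ?r) + cis \<theta> \<noteq> 0"
        using th(3) by (auto simp: complex_eq_iff simp del: of_nat_Suc)
      then show ?thesis
        unfolding F_def e1 using Ln_times_of_real[of ?r "of_real (1 / ?r) - cis \<theta>"]
          Ln_times_of_real[of ?r "of_real (1 / ?r) + cis \<theta>"]
        by (simp del: of_nat_Suc of_real_divide)
    qed
    have "(\<lambda>n. F (real (Suc n))) \<longlonglongrightarrow> Ln (of_real 0 - cis \<theta>) - Ln (of_real 0 + cis \<theta>)"
      unfolding eq using np by (intro tendsto_intros elim) auto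
    then show ?thesis by simp
  qed
  have "Ln (cis \<theta>) = \<i> * of_real \<theta>" "Ln (cis \<eta>) = \<i> * of_real \<eta>"
    using th et by (auto simp: cis_conv_exp intro!: Ln_unique)
  then have "Ln (- cis \<theta>) - Ln (cis \<theta>) = \<i> * of_real (\<eta> - \<theta>)"
    by (simp add: et(3)[symmetric] right_diff_distrib)
  with Finf F0 have "(\<lambda>n. integral {1 / real (Suc n)..real (Suc n)} s) \<longlonglongrightarrow> \<i> * of_real (\<eta> - \<theta>) - 0"
    unfolding FTC by (intro tendsto_diff) simp_all
  with lim1 show "integral {0<..} s = \<i> * of_real (\<eta> - \<theta>)"
    using LIMSEQ_unique by fastforce
qed

lemma punctured_eq_imp_eq:
  fixes f g :: "complex \<Rightarrow> complex"
  assumes "isCont f z" "isCont g z" "\<forall>\<^sub>F y in at z. f y = g y"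
  shows "f z = g z"
proof -
  have "(f \<longlongrightarrow> g z) (at z)"
    using assms(2,3) by (subst tendsto_cong[OF assms(3)]) (simp add: isCont_def)
  then show ?thesis
    using assms(1) tendsto_unique[of "at z" f] by (auto simp: isCont_def)
qed

lemma Ecl_pos_real_integrable:
  assumes "h \<in> Ecl w" "h' \<in> Ecl w" "0 < w"
  shows "(\<lambda>t. (cmod (h (of_real t)) + cmod (h' (of_real t))) / t) integrable_on {0<..}"
  using integrable_add[OF Ecl_ray_integrable[OF assms(1), of 0] Ecl_ray_integrable[OF assms(2), of 0]] assms(3)
  by (simp add: add_divide_distrib)

text \<open>Elements of \<open>Ecl\<close> are not shown to have a limit at 0. Applying the
  log-integrability argument to |h| + |h'| produces one sequence tending to 0 along which both
  vanish, while f tends to l and 1/(1+z) to 1.\<close>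

lemma
  assumes w: "0 < w" "w < pi" and h: "h \<in> Ecl w" "h' \<in> Ecl w"
    and f: "f holomorphic_on sector w" "\<And>z. z \<in> sector w \<Longrightarrow> cmod (f z) \<le> M"
      "((\<lambda>t::real. f (of_real t)) \<longlongrightarrow> l) (at_right 0)"
    and ev: "\<And>z0. z0 \<in> sector w \<Longrightarrow> \<forall>\<^sub>F z in at z0. (h z + a + b / (1 + z)) * f z = h' z + a' + b' / (1 + z)"
  shows Ecl_decomposition_eq: "z \<in> sector w \<Longrightarrow> (h z + a + b / (1 + z)) * f z = h' z + a' + b' / (1 + z)"
    and Ecl_decomposition_limit: "(a + b) * l = a' + b'"
proof -
  have isc: "isCont k z" if "k holomorphic_on sector w" "z \<in> sector w" for k z
    using that w open_sector[of w] by (auto simp: continuous_on_eq_continuous_at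
        dest!: holomorphic_on_imp_continuous_on)
  show eq: "(h z + a + b / (1 + z)) * f z = h' z + a' + b' / (1 + z)" if z: "z \<in> sector w" for z
    using isc[OF Ecl_holomorphic[OF h(1)] z] isc[OF Ecl_holomorphic[OF h(2)] z] isc[OF f(1) z]
      one_plus_sector[OF z] w
    by (intro punctured_eq_imp_eq[where f = "\<lambda>z. (h z + a + b / (1 + z)) * f z"
          and g = "\<lambda>z. h' z + a' + b' / (1 + z)", OF _ _ ev[OF z]] continuous_intros) auto
  obtain \<tau> where \<tau>: "\<And>n. \<tau> n > 0" "\<tau> \<longlonglongrightarrow> 0"
    and k: "(\<lambda>n::nat. cmod (h (of_real (\<tau> n))) + cmod (h' (of_real (\<tau> n)))) \<longlonglongrightarrow> 0"
    using log_integrable_small_seq_0[OF Ecl_pos_real_integrable[OF h w(1)]] by auto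
  have hl: "(\<lambda>n. h (of_real (\<tau> n))) \<longlonglongrightarrow> 0" "(\<lambda>n. h' (of_real (\<tau> n))) \<longlonglongrightarrow> 0"
    by (rule Lim_null_comparison[OF always_eventually k]; simp)+
  have "filterlim \<tau> (at_right 0) sequentially"
    using \<tau> by (simp add: filterlim_at less_imp_neq[symmetric])
  then have fl: "(\<lambda>n. f (of_real (\<tau> n))) \<longlonglongrightarrow> l"
    by (rule filterlim_compose[OF f(3)])
  have "(\<lambda>n. (h (of_real (\<tau> n)) + a + b / (1 + of_real (\<tau> n))) * f (of_real (\<tau> n)))
      \<longlonglongrightarrow> (0 + a + b / (1 + of_real 0)) * l"
    by (intro tendsto_intros hl fl \<tau>(2)) auto
  moreover have "(\<lambda>n. h' (of_real (\<tau> n)) + a' + b' / (1 + of_real (\<tau> n)))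
      \<longlonglongrightarrow> 0 + a' + b' / (1 + of_real 0)"
    by (intro tendsto_intros hl \<tau>(2)) auto
  moreover have "(h (of_real (\<tau> n)) + a + b / (1 + of_real (\<tau> n))) * f (of_real (\<tau> n))
      = h' (of_real (\<tau> n)) + a' + b' / (1 + of_real (\<tau> n))" for n
    using ray_in_sector[of 0 w "\<tau> n"] w \<tau>(1)[of n] by (intro eq) auto
  ultimately show "(a + b) * l = a' + b'"
    using LIMSEQ_unique by fastforce
qed

text \<open>The sum defining \<open>Ee\<close> is direct: sequences tending to 0 recover a + b (the
  case f = 1 of the previous limit), sequences tending to infinity recover a.\<close>

lemma Ecl_decomposition_unique:
  assumes w: "0 < w" "w < pi" and h: "h \<in> Ecl w" "h' \<in> Ecl w"
    and ev: "\<And>z0. z0 \<in> sector w \<Longrightarrow> \<forall>\<^sub>F z in at z0. h z + a + b / (1 + z) = h' z + a' + b' / (1 + z)"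
  shows "a = a'" "b = b'" "\<And>z. z \<in> sector w \<Longrightarrow> h z = h' z"
proof -
  have ev': "\<forall>\<^sub>F z in at z0. (h z + a + b / (1 + z)) * 1 = h' z + a' + b' / (1 + z)" if "z0 \<in> sector w" for z0
    using ev[OF that] by simp
  have one: "(\<lambda>z. 1) holomorphic_on sector w" "\<And>z. z \<in> sector w \<Longrightarrow> cmod 1 \<le> 1"
    "((\<lambda>t::real. 1) \<longlongrightarrow> 1) (at_right 0)" for z :: complex
    by auto
  have eq: "h z + a + b / (1 + z) = h' z + a' + b' / (1 + z)" if "z \<in> sector w" for z
    using Ecl_decomposition_eq[OF w h one(1) one(2) one(3) ev' that] by simp
  have sum: "a + b = a' + b'"
    using Ecl_decomposition_limit[OF w h one(1) one(2) one(3) ev'] by simp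
  obtain \<tau> where \<tau>: "\<And>n. \<tau> n > 0" "filterlim \<tau> at_top sequentially"
    and k: "(\<lambda>n::nat. cmod (h (of_real (\<tau> n))) + cmod (h' (of_real (\<tau> n)))) \<longlonglongrightarrow> 0"
    using log_integrable_small_seq_top[OF Ecl_pos_real_integrable[OF h w(1)]] by auto
  have hl: "(\<lambda>n. h (of_real (\<tau> n))) \<longlonglongrightarrow> 0" "(\<lambda>n. h' (of_real (\<tau> n))) \<longlonglongrightarrow> 0"
    by (rule Lim_null_comparison[OF always_eventually k]; simp)+
  have "((\<lambda>t. inverse (1 + t)) \<longlongrightarrow> 0) (at_top :: real filter)"
    by real_asymp
  then have "(\<lambda>n. of_real (inverse (1 + \<tau> n)) :: complex) \<longlonglongrightarrow> of_real 0"
    by (intro tendsto_of_real filterlim_compose[OF _ \<tau>(2)])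
  then have q: "(\<lambda>n. 1 / (1 + of_real (\<tau> n)) :: complex) \<longlonglongrightarrow> 0"
    by (simp add: inverse_eq_divide)
  have "(\<lambda>n. h (of_real (\<tau> n)) + a + b * (1 / (1 + of_real (\<tau> n)))) \<longlonglongrightarrow> 0 + a + b * 0"
    by (intro tendsto_intros hl q)
  moreover have "(\<lambda>n. h' (of_real (\<tau> n)) + a' + b' * (1 / (1 + of_real (\<tau> n)))) \<longlonglongrightarrow> 0 + a' + b' * 0"
    by (intro tendsto_intros hl q)
  moreover have "h (of_real (\<tau> n)) + a + b * (1 / (1 + of_real (\<tau> n)))
      = h' (of_real (\<tau> n)) + a' + b' * (1 / (1 + of_real (\<tau> n)))" for n
    using eq[of "of_real (\<tau> n)"] ray_in_sector[of 0 w "\<tau> n"] w \<tau>(1)[of n] by auto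
  ultimately show a: "a = a'"
    using LIMSEQ_unique by fastforce
  with sum show b: "b = b'" by simp
  show "h z = h' z" if "z \<in> sector w" for z
    using eq[OF that] a b by simp
qed

section \<open>The Dunford--Riesz integral\<close>

context sectorial_operator
begin

definition rayint :: "(complex \<Rightarrow> complex) \<Rightarrow> 'a \<Rightarrow> real \<Rightarrow> 'a" where
  "rayint f x \<theta> = integral {0<..} (\<lambda>t::real. scaleC (f (of_real t * cis \<theta>) * cis \<theta>) (Res (of_real t * cis \<theta>) x))"

lemma Phi_E_rayint:
  "Phi_E Dom A w f x = scaleC (1 / (2 * pi * \<i>)) (rayint f x (- ((\<omega> + w) / 2)) - rayint f x ((\<omega> + w) / 2))"
  by (simp add: Phi_E_def rayint_def Let_def)

section \<open>Ray integrals modulo the closure of the range\<close>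

lemma rayint_integrand_split:
  assumes "z \<in> resolvent_set Dom A" "z = of_real t * cis \<theta>" "t \<noteq> 0"
  shows "scaleC (b * cis \<theta>) (Res z x) = scaleC (b / of_real t) x + scaleC (b / of_real t) (A (Res z x))"
proof -
  have "scaleC (b * cis \<theta>) (Res z x) = scaleC (b / of_real t) (scaleC z (Res z x))"
    using assms by simp
  also have "scaleC z (Res z x) = x + A (Res z x)"
    using Res_right[OF assms(1), of x] by (simp add: diff_eq_eq)
  finally show ?thesis by (simp add: scaleC_add_right)
qed

lemma continuous_on_Res_ray:
  assumes "\<omega> < v" "v < \<theta>" "\<theta> < pi"
  shows "continuous_on {0<..} (\<lambda>t. Res (of_real t * cis \<theta>) x)"
    and "continuous_on {0<..} (\<lambda>t. Res (of_real t * cis (- \<theta>)) x)"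
  using assms omega_nonneg ray_notin_csector[of v \<theta>]
  by (intro continuous_on_Res[of v] continuous_intros; auto)+

text \<open>Since cis \<theta> = z/t and z R(z,A) = I + A R(z,A), the integrand is (h/t) x plus a
  value in the range of A, and integration stays in the closed subspace \<open>clran\<close>. If A x
  = 0, the second part vanishes identically.\<close>

lemma rayint_mod_clran:
  assumes h: "h \<in> Ecl w" and w: "w < pi" and th: "\<omega> < d" "d < w" and sg: "\<theta> = d \<or> \<theta> = - d"
  obtains y where "y \<in> clran" "B x = x \<Longrightarrow> y = 0"
    "rayint h x \<theta> = integral {0<..} (\<lambda>t. scaleC (h (of_real t * cis \<theta>) / of_real t) x) + y"
proof -
  define v where "v = (\<omega> + d) / 2"
  have v: "\<omega> < v" "v < d" "0 \<le> v" "v < pi" using th w omega_nonneg by (auto simp: v_def)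
  have d: "d < pi" "\<bar>\<theta>\<bar> = d" "\<bar>\<theta>\<bar> < w" using th w sg omega_nonneg by auto
  obtain M where M: "M \<ge> 0" "\<And>z. z \<notin> csector v \<Longrightarrow> z \<in> resolvent_set Dom A"
    "\<And>z x. z \<notin> csector v \<Longrightarrow> cmod z * norm (Res z x) \<le> M * norm x"
    using resolvent_bound[OF v(1,4)] by blast
  have z: "of_real t * cis \<theta> \<notin> csector v" if "t > 0" for t
    using ray_notin_csector[of v d t] v d sg that by auto
  have contR: "continuous_on {0<..} (\<lambda>t. Res (of_real t * cis \<theta>) x)"
    using continuous_on_Res_ray[OF v(1,2) d(1)] sg by auto
  have conth: "continuous_on {0<..} (\<lambda>t. h (of_real t * cis \<theta>))"
    using continuous_on_ray[OF holomorphic_on_imp_continuous_on[OF Ecl_holomorphic[OF h]] d(3)] w by simp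
  define p where "p t = scaleC (h (of_real t * cis \<theta>) / of_real t) x" for t
  define g where "g t = scaleC (h (of_real t * cis \<theta>) * cis \<theta>) (Res (of_real t * cis \<theta>) x)" for t
  have split: "g t - p t = scaleC (h (of_real t * cis \<theta>) / of_real t) (A (Res (of_real t * cis \<theta>) x))"
    if "t > 0" for t
    using rayint_integrand_split[OF M(2)[OF z[OF that]] refl, of "h (of_real t * cis \<theta>)" x] that
    by (simp add: g_def p_def)
  have contp: "continuous_on {0<..} p"
    unfolding p_def by (intro continuous_on_scaleC continuous_on_divide conth continuous_intros) auto
  have contg: "continuous_on {0<..} g"
    unfolding g_def by (intro continuous_on_scaleC conth contR continuous_intros)
  note hint = Ecl_ray_integrable[OF h d(3)]
  have boundp: "norm (p t) \<le> cmod (h (of_real t * cis \<theta>)) / t * norm x" if "t > 0" for t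
    using that by (simp add: p_def norm_divide)
  have boundg: "norm (g t) \<le> cmod (h (of_real t * cis \<theta>)) / t * (M * norm x)" if t: "t > 0" for t
  proof -
    have "norm (Res (of_real t * cis \<theta>) x) \<le> M * norm x / t"
      using M(3)[OF z[OF t], of x] t by (simp add: norm_mult field_simps)
    then have "cmod (h (of_real t * cis \<theta>)) * norm (Res (of_real t * cis \<theta>) x)
        \<le> cmod (h (of_real t * cis \<theta>)) * (M * norm x / t)"
      by (rule mult_left_mono) simp
    then show ?thesis by (simp add: g_def norm_mult)
  qed
  have p: "p integrable_on {0<..}"
    by (rule integrable_on_halfline[OF contp integrable_on_mult_left[OF hint] boundp])
  have g: "g integrable_on {0<..}"
    by (rule integrable_on_halfline[OF contg integrable_on_mult_left[OF hint] boundg])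
  show thesis
  proof (rule that)
    show "rayint h x \<theta> = integral {0<..} (\<lambda>t. scaleC (h (of_real t * cis \<theta>) / of_real t) x)
        + integral {0<..} (\<lambda>t. g t - p t)"
      unfolding rayint_def g_def[symmetric] p_def[symmetric] by (simp add: integral_diff[OF g p])
    show "integral {0<..} (\<lambda>t. g t - p t) \<in> clran"
    proof (rule integral_halfline_in_closed_subspace[OF subspace_clran closed_clran])
      show "continuous_on {0<..} (\<lambda>t. g t - p t)"
        by (intro continuous_intros contg contp)
      show "(\<lambda>t. cmod (h (of_real t * cis \<theta>)) / t * (M * norm x) + cmod (h (of_real t * cis \<theta>)) / t * norm x)
          integrable_on {0<..}"
        by (intro integrable_add integrable_on_mult_left hint)
      show "norm (g t - p t) \<le> cmod (h (of_real t * cis \<theta>)) / t * (M * norm x)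
          + cmod (h (of_real t * cis \<theta>)) / t * norm x" if "t > 0" for t
        using norm_triangle_ineq4[of "g t" "p t"] boundg[OF that] boundp[OF that] by linarith
      show "g t - p t \<in> clran" if "t > 0" for t
        unfolding split[OF that] using M(2)[OF z[OF that]] by (intro scaleC_clran A_in_clran Res_Dom)
    qed
    assume "B x = x"
    then have x: "x \<in> Dom" "A x = 0" using kernel_iff by auto
    have "g t - p t = 0" if "t > 0" for t
    proof -
      have "Res (of_real t * cis \<theta>) x = scaleC (1 / (of_real t * cis \<theta>)) x"
        using that by (intro Res_kernel[OF M(2)[OF z[OF that]] _ x]) auto
      then show ?thesis
        unfolding split[OF that] by (simp only: A_scaleC[OF x(1)] x(2) scaleC.zero_right)
    qed
    then have "integral {0<..} (\<lambda>t. g t - p t) = integral {0<..} (\<lambda>t::real. 0)"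
      by (intro integral_cong) auto
    then show "integral {0<..} (\<lambda>t. g t - p t) = 0" by simp
  qed
qed

text \<open>The multiples of x from the two rays cancel by \<open>integral_Ecl_over_ray_eq\<close>,
  so only the corrections in \<open>clran\<close> survive, and none of them on the kernel of
  A.\<close>

lemma
  assumes h: "h \<in> Ecl w" and w: "\<omega> < w" "w < pi"
  shows Phi_E_in_clran: "Phi_E Dom A w h x \<in> clran"
    and Phi_E_kernel: "B x = x \<Longrightarrow> Phi_E Dom A w h x = 0"
proof -
  define d where "d = (\<omega> + w) / 2"
  have d: "\<omega> < d" "d < w" "0 \<le> d" using w omega_nonneg by (auto simp: d_def)
  obtain y where y: "y \<in> clran" "B x = x \<Longrightarrow> y = 0"
    "rayint h x d = integral {0<..} (\<lambda>t. scaleC (h (of_real t * cis d) / of_real t) x) + y"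
    using rayint_mod_clran[OF h w(2) d(1,2)] by blast
  obtain y' where y': "y' \<in> clran" "B x = x \<Longrightarrow> y' = 0"
    "rayint h x (- d) = integral {0<..} (\<lambda>t. scaleC (h (of_real t * cis (- d)) / of_real t) x) + y'"
    using rayint_mod_clran[OF h w(2) d(1,2)] by blast
  have eq: "Phi_E Dom A w h x = scaleC (1 / (2 * pi * \<i>)) (y' - y)"
    unfolding Phi_E_rayint d_def[symmetric] y(3) y'(3) integral_Ecl_over_ray_eq[OF h d(3,2) w(2)] by simp
  show "Phi_E Dom A w h x \<in> clran"
    unfolding eq by (intro scaleC_clran subspace_diff[OF subspace_clran] y y')
  show "Phi_E Dom A w h x = 0" if "B x = x"
    unfolding eq using y(2) y'(2) that by simp
qed

section \<open>Contour independence and convergence for multiples of z/(1+z)^2\<close>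

text \<open>The factor z/(1+z)^2 supplies t/(c (1+t^2)) and the resolvent N/t, so the product has
  the majorant C/(1+t^2) uniformly in the angle. The angles avoid the closed sector of angle v,
  where the resolvent is not controlled.\<close>

lemma rayint_e0_mult_shift:
  assumes w: "w < pi" and f: "f holomorphic_on sector w" "\<And>z. z \<in> sector w \<Longrightarrow> cmod (f z) \<le> M"
    and v: "\<omega> < v" "v < pi" and le: "\<alpha> \<le> \<beta>"
    and th: "\<And>\<theta>. \<theta> \<in> {\<alpha>..\<beta>} \<Longrightarrow> v < \<bar>\<theta>\<bar> \<and> \<bar>\<theta>\<bar> < w"
  shows "rayint (\<lambda>z. z / (1 + z)\<^sup>2 * f z) x \<beta> = rayint (\<lambda>z. z / (1 + z)\<^sup>2 * f z) x \<alpha>"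
proof -
  define g where "g z = z / (1 + z)\<^sup>2 * f z" for z
  have v0: "0 \<le> v" "v \<le> pi" using v omega_nonneg by auto
  have w0: "0 \<le> w" "w \<le> pi" using th[of \<alpha>] le w by auto
  obtain c where c: "c > 0" "c \<le> 1" "\<And>\<theta>. \<bar>\<theta>\<bar> \<le> w \<Longrightarrow> c - 1 \<le> cos \<theta>"
    using sector_angle_const[OF w0(1) w] by blast
  obtain N where N: "N \<ge> 0" "\<And>z. z \<notin> csector v \<Longrightarrow> z \<in> resolvent_set Dom A"
    "\<And>z x. z \<notin> csector v \<Longrightarrow> cmod z * norm (Res z x) \<le> N * norm x"
    using resolvent_bound[OF v] by blast
  have hol: "g holomorphic_on sector w"
    unfolding g_def using one_plus_sector[of _ w] w0 by (intro holomorphic_intros f(1)) auto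
  have z: "of_real t * cis \<theta> \<in> sector w" "of_real t * cis \<theta> \<notin> csector v" if "t > 0" "\<theta> \<in> {\<alpha>..\<beta>}" for t \<theta>
  proof -
    show "of_real t * cis \<theta> \<in> sector w" using th[OF that(2)] that(1) w0 by (intro ray_in_sector) auto
    show "of_real t * cis \<theta> \<notin> csector v"
      using ray_notin_csector[of v "\<bar>\<theta>\<bar>" t] th[OF that(2)] that(1) w v0
      by (cases "\<theta> \<ge> 0") auto
  qed
  let ?G = "\<lambda>z. scaleC (g z) (Res z x)"
  let ?G' = "\<lambda>z. scaleC (g z) (- Res z (Res z x)) + scaleC (deriv g z) (Res z x)"
  have "integral {0<..} (\<lambda>t. scaleC (cis \<beta>) (?G (of_real t * cis \<beta>)))
      = integral {0<..} (\<lambda>t. scaleC (cis \<alpha>) (?G (of_real t * cis \<alpha>)))"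
  proof (rule ray_integral_shift_Lorentz[OF le, where g' = ?G'])
    fix t \<theta> :: real assume t: "t > 0" and th1: "\<theta> \<in> {\<alpha>..\<beta>}"
    show "(?G has_derivative (\<lambda>k. scaleC k (?G' (of_real t * cis \<theta>)))) (at (of_real t * cis \<theta>))"
      by (rule has_derivative_scaleC[OF holomorphic_derivI[OF hol open_sector[OF w0] z(1)[OF t th1]]
            has_derivative_Res[OF v z(2)[OF t th1]]])
    have 1: "cmod (g (of_real t * cis \<theta>)) \<le> t / (c * (1 + t\<^sup>2)) * M"
      unfolding g_def norm_mult[of "_ / _"]
      using cmod_e0_ray_le[OF c(1,2) c(3), of \<theta> t] f(2)[OF z(1)[OF t th1]] t th[OF th1] c
      by (intro mult_mono) auto
    have 2: "norm (Res (of_real t * cis \<theta>) x) \<le> N * norm x / t"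
      using N(3)[OF z(2)[OF t th1], of x] t by (simp add: norm_mult field_simps)
    have "norm (?G (of_real t * cis \<theta>)) \<le> t / (c * (1 + t\<^sup>2)) * M * (N * norm x / t)"
      unfolding norm_scaleC using 1 2 by (rule mult_mono) (use 1 norm_ge_zero order_trans in blast, simp)
    also have "\<dots> = (M * N * norm x / c) / (1 + t\<^sup>2)" using t by simp
    finally show "norm (?G (of_real t * cis \<theta>)) \<le> (M * N * norm x / c) / (1 + t\<^sup>2)" .
  next
    let ?z = "\<lambda>p::real \<times> real. of_real (snd p) * cis (fst p)"
    have cz: "continuous_on ({\<alpha>..\<beta>} \<times> {0<..}) ?z" by (intro continuous_intros)
    have cg: "continuous_on ({\<alpha>..\<beta>} \<times> {0<..}) (\<lambda>p. k (?z p))" if "continuous_on (sector w) k" for k :: "complex \<Rightarrow> complex"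
      by (rule continuous_on_compose2[OF that cz]) (auto intro!: z(1))
    have cR: "continuous_on ({\<alpha>..\<beta>} \<times> {0<..}) (\<lambda>p. Res (?z p) (u p))"
      if "continuous_on ({\<alpha>..\<beta>} \<times> {0<..}) u" for u
      by (rule continuous_on_Res[OF v cz _ that], rule z(2)) auto
    show "continuous_on ({\<alpha>..\<beta>} \<times> {0<..}) (\<lambda>(\<theta>, t). ?G' (of_real t * cis \<theta>))"
      unfolding split_def
      by (intro continuous_on_add continuous_on_scaleC continuous_on_minus cR cg continuous_on_const
          holomorphic_on_imp_continuous_on holomorphic_deriv hol open_sector w0)
  qed
  then show ?thesis
    by (simp add: rayint_def g_def mult.commute)
qed

text \<open>Frees the value from the sector w' that the sectorial calculus happens to provide, and
  that may vary with f.\<close>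

lemma Phi_E_e0_mult:
  assumes w: "w < pi" and f: "f holomorphic_on sector w" "\<And>z. z \<in> sector w \<Longrightarrow> cmod (f z) \<le> M"
    and w': "\<omega> < w'" "w' \<le> w"
  shows "Phi_E Dom A w' (\<lambda>z. z / (1 + z)\<^sup>2 * f z) x = Phi_E Dom A w (\<lambda>z. z / (1 + z)\<^sup>2 * f z) x"
proof -
  define a b v where "a = (\<omega> + w') / 2" and "b = (\<omega> + w) / 2" and "v = (\<omega> + a) / 2"
  have "\<omega> < a" "a \<le> b" "b < w" using w w' by (auto simp: a_def b_def)
  moreover from this have "\<omega> < v" "v < a" by (auto simp: v_def)
  ultimately have o: "0 \<le> \<omega>" "\<omega> < v" "v < a" "a \<le> b" "b < w" using omega_nonneg by auto
  have "rayint (\<lambda>z. z / (1 + z)\<^sup>2 * f z) x b = rayint (\<lambda>z. z / (1 + z)\<^sup>2 * f z) x a"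
    by (rule rayint_e0_mult_shift[where v = v, OF w f]) (use w o in auto)
  moreover have "rayint (\<lambda>z. z / (1 + z)\<^sup>2 * f z) x (- a) = rayint (\<lambda>z. z / (1 + z)\<^sup>2 * f z) x (- b)"
    by (rule rayint_e0_mult_shift[where v = v, OF w f]) (use w o in auto)
  ultimately show ?thesis by (simp add: Phi_E_rayint a_def b_def)
qed

text \<open>The uniform bound M makes the majorant C/(1+t^2) on each of the two fixed rays
  independent of n.\<close>

lemma Phi_E_e0_mult_tendsto_0:
  assumes w: "\<omega> < w" "w < pi" and f: "\<And>n. f n holomorphic_on sector w"
    "\<And>n z. z \<in> sector w \<Longrightarrow> cmod (f n z) \<le> M" "\<And>z. z \<in> sector w \<Longrightarrow> (\<lambda>n. f n z) \<longlonglongrightarrow> 0"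
  shows "(\<lambda>n. Phi_E Dom A w (\<lambda>z. z / (1 + z)\<^sup>2 * f n z) x) \<longlonglongrightarrow> 0"
proof -
  define d where "d = (\<omega> + w) / 2"
  define v where "v = (\<omega> + d) / 2"
  have d: "\<omega> < d" "d < w" using w by (auto simp: d_def)
  then have v: "\<omega> < v" "v < d" "0 \<le> v" "v < pi" "d < w" "d < pi" using w omega_nonneg by (auto simp: v_def)
  have w0: "0 < w" using w omega_nonneg by simp
  obtain c where c: "c > 0" "c \<le> 1" "\<And>\<theta>. \<bar>\<theta>\<bar> \<le> w \<Longrightarrow> c - 1 \<le> cos \<theta>"
    using sector_angle_const[of w] w w0 by auto
  obtain N where N: "N \<ge> 0" "\<And>z. z \<notin> csector v \<Longrightarrow> z \<in> resolvent_set Dom A"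
    "\<And>z x. z \<notin> csector v \<Longrightarrow> cmod z * norm (Res z x) \<le> N * norm x"
    using resolvent_bound[OF v(1,4)] by blast
  have lim: "(\<lambda>n. rayint (\<lambda>z. z / (1 + z)\<^sup>2 * f n z) x \<theta>) \<longlonglongrightarrow> 0" if sg: "\<theta> = d \<or> \<theta> = - d" for \<theta>
  proof -
    have th: "\<bar>\<theta>\<bar> < w" using sg v omega_nonneg by auto
    have z: "of_real t * cis \<theta> \<in> sector w" "of_real t * cis \<theta> \<notin> csector v" if "t > 0" for t
      using ray_notin_csector[of v d t] ray_in_sector[OF th _ that] v w sg that by auto
    have contR: "continuous_on {0<..} (\<lambda>t. Res (of_real t * cis \<theta>) x)"
      using continuous_on_Res_ray[OF v(1,2,6)] sg by auto
    have conth: "continuous_on {0<..} (\<lambda>t. of_real t * cis \<theta> / (1 + of_real t * cis \<theta>)\<^sup>2 * f n (of_real t * cis \<theta>))" for n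
    proof -
      have "(\<lambda>z. z / (1 + z)\<^sup>2 * f n z) \<in> Ecl w" by (rule e0_mult_Ecl[OF w0 w(2) f(1,2)])
      from continuous_on_ray[OF holomorphic_on_imp_continuous_on[OF Ecl_holomorphic[OF this]] th]
      show ?thesis using w by simp
    qed
    have "(\<lambda>n. rayint (\<lambda>z. z / (1 + z)\<^sup>2 * f n z) x \<theta>) \<longlonglongrightarrow> integral {0<..} (\<lambda>t::real. 0 :: 'a)"
      unfolding rayint_def
    proof (rule halfline_dominated_convergence[OF _ _ integrable_on_inverse_1_plus_square])
      show "continuous_on {0<..} (\<lambda>t. scaleC (of_real t * cis \<theta> / (1 + of_real t * cis \<theta>)\<^sup>2 * f n (of_real t * cis \<theta>) * cis \<theta>)
          (Res (of_real t * cis \<theta>) x))" for n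
        by (intro continuous_on_scaleC continuous_on_mult[OF conth] contR continuous_on_const)
      fix t :: real assume t: "t > 0"
      show "norm (scaleC (of_real t * cis \<theta> / (1 + of_real t * cis \<theta>)\<^sup>2 * f n (of_real t * cis \<theta>) * cis \<theta>)
          (Res (of_real t * cis \<theta>) x)) \<le> (M * N * norm x / c) / (1 + t\<^sup>2)" for n
      proof -
        have 1: "cmod (of_real t * cis \<theta> / (1 + of_real t * cis \<theta>)\<^sup>2 * f n (of_real t * cis \<theta>) * cis \<theta>) \<le> t / (c * (1 + t\<^sup>2)) * M"
          unfolding norm_mult[of "_ / _"] norm_mult[of _ "cis \<theta>"] norm_cis mult_1_right
          using cmod_e0_ray_le[OF c(1,2) c(3), of \<theta> t] f(2)[OF z(1)[OF t]] t th c
          by (intro mult_mono) auto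
        have 2: "norm (Res (of_real t * cis \<theta>) x) \<le> N * norm x / t"
          using N(3)[OF z(2)[OF t], of x] t by (simp add: norm_mult field_simps)
        have "norm (scaleC (of_real t * cis \<theta> / (1 + of_real t * cis \<theta>)\<^sup>2 * f n (of_real t * cis \<theta>) * cis \<theta>)
          (Res (of_real t * cis \<theta>) x)) \<le> t / (c * (1 + t\<^sup>2)) * M * (N * norm x / t)"
          unfolding norm_scaleC using 1 2 by (rule mult_mono) (use 1 norm_ge_zero order_trans in blast, simp)
        also have "\<dots> = (M * N * norm x / c) / (1 + t\<^sup>2)" using t by simp
        finally show ?thesis .
      qed
      have "(\<lambda>n. of_real t * cis \<theta> / (1 + of_real t * cis \<theta>)\<^sup>2 * f n (of_real t * cis \<theta>) * cis \<theta>)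
          \<longlonglongrightarrow> of_real t * cis \<theta> / (1 + of_real t * cis \<theta>)\<^sup>2 * 0 * cis \<theta>"
        by (intro tendsto_mult tendsto_const f(3) z(1) t)
      from scaleC.tendsto[OF this tendsto_const]
      show "(\<lambda>n. scaleC (of_real t * cis \<theta> / (1 + of_real t * cis \<theta>)\<^sup>2 * f n (of_real t * cis \<theta>) * cis \<theta>)
          (Res (of_real t * cis \<theta>) x)) \<longlonglongrightarrow> 0" by simp
    qed auto
    then show ?thesis by simp
  qed
  have "(\<lambda>n. scaleC (1 / (2 * pi * \<i>)) (rayint (\<lambda>z. z / (1 + z)\<^sup>2 * f n z) x (- d) - rayint (\<lambda>z. z / (1 + z)\<^sup>2 * f n z) x d))
      \<longlonglongrightarrow> scaleC (1 / (2 * pi * \<i>)) (0 - 0)"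
    by (intro scaleC.tendsto tendsto_const tendsto_diff lim) auto
  then show ?thesis by (simp add: Phi_E_rayint d_def)
qed

section \<open>Evaluation of the integral for z/(1+z)^2\<close>

text \<open>Splits the integrand into three parts that can each be integrated. R(z)u behaves like
  u/z at infinity; subtracting u/(z - 1) cancels this term with a pole at 1, to the right of the
  contour, so the first part decays quadratically and can be rotated through the negative axis. The
  second is integrated by logarithms. The third is the regulariser over z, whose contributions on
  the two rays agree.\<close>

lemma e0_Res_decomposition:
  fixes x :: 'a
  assumes z: "z \<in> resolvent_set Dom A" and nz: "1 + z \<noteq> 0" "z \<noteq> 0"
  defines "u \<equiv> B x - B (B x)"
  shows "scaleC (z / (1 + z)\<^sup>2) (Res z x) = (Res z u - scaleC (1 / (z - 1)) u)
    + scaleC (1 / (z - 1) - 1 / (1 + z)) u + scaleC (z / (1 + z)\<^sup>2 / z) (B x)"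
proof -
  define b where "b = B x"
  define c where "c = B b"
  define r where "r = Res z c"
  have Rb: "Res z b = scaleC (1 + z) r - c"
    using Res_B[OF z, of b] by (simp add: r_def c_def)
  have Rx: "Res z x = scaleC (1 + z) (Res z b) - b"
    using Res_B[OF z, of x] by (simp add: b_def)
  have Ru: "Res z u = scaleC z r - c"
    by (simp add: u_def b_def[symmetric] c_def[symmetric] Res_diff[OF z] Rb r_def[symmetric] scaleC_add_left)
  have "scaleC (z / (1 + z)\<^sup>2) (Res z x) = scaleC (z / (1 + z)\<^sup>2 * (1 + z) * (1 + z)) r
      - scaleC (z / (1 + z)\<^sup>2 * (1 + z)) c - scaleC (z / (1 + z)\<^sup>2) b"
    unfolding Rx Rb by (simp add: scaleC.diff_right mult.assoc)
  also have "\<dots> = scaleC z r - scaleC (1 - 1 / (1 + z)) c - scaleC (1 / (1 + z) - z / (1 + z)\<^sup>2 / z) b"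
  proof -
    \<comment> \<open>With p = 1 + z, the coefficient of b is written as 1/p minus (z/p^2)/z, so
      that the 1/p terms of b and c combine to -u/p.\<close>
    have e: "z / p\<^sup>2 * p * p = z" "z / p\<^sup>2 * p = 1 - 1 / p" "z / p\<^sup>2 = 1 / p - z / p\<^sup>2 / z"
      if "p \<noteq> 0" "z = p - 1" for p
      using that nz(2) by (simp_all add: power2_eq_square field_simps)
    have z: "z = (1 + z) - 1" by simp
    show ?thesis
      by (intro arg_cong2[where f = minus] arg_cong2[where f = scaleC] refl e[OF nz(1) z])
  qed
  also have "scaleC z r - scaleC (1 - 1 / (1 + z)) c - scaleC (1 / (1 + z) - z / (1 + z)\<^sup>2 / z) b
      = Res z u - scaleC (1 / (1 + z)) u + scaleC (z / (1 + z)\<^sup>2 / z) b"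
    unfolding Ru by (simp add: u_def b_def[symmetric] c_def[symmetric] scaleC.diff_left scaleC.diff_right)
  finally show ?thesis
    by (simp add: b_def scaleC.diff_left)
qed

text \<open>Near 0, R(z)u = z R(z) B^2 x - B^2 x is bounded because u = A B^2 x. For large t, z
  R(z)u = u + R(z) A u turns the difference into R(z) A u / z - u/(z (z - 1)), of order 1/t^2. The
  angle range is the complement of the sector, traversed through pi.\<close>

lemma Res_minus_simple_pole_bound:
  fixes x :: 'a
  assumes v: "\<omega> < v" "v < d" "d < pi"
  defines "u \<equiv> B x - B (B x)"
  obtains C where "\<And>t \<theta>. t > 0 \<Longrightarrow> \<theta> \<in> {d..2 * pi - d} \<Longrightarrow>
    norm (Res (of_real t * cis \<theta>) u - scaleC (1 / (of_real t * cis \<theta> - 1)) u) \<le> C / (1 + t\<^sup>2)"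
proof -
  have v0: "0 \<le> v" "v < pi" "0 < d" using v omega_nonneg by auto
  obtain N where N: "N \<ge> 0" "\<And>z. z \<notin> csector v \<Longrightarrow> z \<in> resolvent_set Dom A"
    "\<And>z x. z \<notin> csector v \<Longrightarrow> cmod z * norm (Res z x) \<le> N * norm x"
    using resolvent_bound[OF v(1) v0(2)] by blast
  define c where "c = min 1 (1 - cos d)"
  have "cos d < cos 0" using v v0 by (intro cos_monotone_0_pi) auto
  then have c: "c > 0" "c \<le> 1" by (auto simp: c_def)
  define c2 where "c2 = B (B x)"
  define y where "y = x - B x - u"
  have uDom: "u \<in> Dom" unfolding u_def by (intro Dom_diff B_Dom)
  have Au: "A u = y" unfolding u_def y_def by (simp add: A_diff A_B u_def)
  \<comment> \<open>The factor 2 covers both ranges: 1 + t^2 \<le> 2 for t \<le> 1 and 1 + t^2 \<le>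
    2 t^2 beyond.\<close>
  define C where "C = 2 * ((N + 1) * norm c2 + norm u / c + N * norm y)"
  show thesis
  proof (rule that)
    fix t \<theta> :: real assume t: "t > 0" and th: "\<theta> \<in> {d..2 * pi - d}"
    define z where "z = of_real t * cis \<theta>"
    have zc: "z \<notin> csector v" unfolding z_def using ray_notin_csector(1)[of v \<theta> t] v v0 t th by auto
    note zr = N(2)[OF zc]
    have cz: "cmod z = t" "z \<noteq> 0" using t by (auto simp: z_def norm_mult)
    have "cos \<theta> \<le> cos d"
    proof (cases "\<theta> \<le> pi")
      case True
      then show ?thesis using th v0 by (intro cos_monotone_0_pi_le) auto
    next
      case False
      then have "cos (2 * pi - \<theta>) \<le> cos d" using th v0 by (intro cos_monotone_0_pi_le) auto
      then show ?thesis by (simp add: cos_diff)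
    qed
    then have "c - 1 \<le> cos (\<theta> + pi)" by (auto simp: c_def min_def)
    then have "c * (1\<^sup>2 + t\<^sup>2) \<le> (cmod (of_real 1 + of_real t * cis (\<theta> + pi)))\<^sup>2"
      using t c by (intro cmod_add_ray_ge) auto
    then have sq: "c * (1 + t\<^sup>2) \<le> (cmod (z - 1))\<^sup>2"
      by (simp add: z_def cis_mult[symmetric] norm_minus_commute)
    have "c * c \<le> c" using c by (simp add: mult_left_le)
    then have "c\<^sup>2 * (1 + t\<^sup>2) \<le> c * (1 + t\<^sup>2)" by (intro mult_right_mono) (auto simp: power2_eq_square)
    with sq have "c\<^sup>2 * (1 + t\<^sup>2) \<le> (cmod (z - 1))\<^sup>2" by linarith
    then have "c\<^sup>2 + (c * t)\<^sup>2 \<le> (cmod (z - 1))\<^sup>2" by (simp add: algebra_simps power_mult_distrib)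
    then have "c\<^sup>2 \<le> (cmod (z - 1))\<^sup>2" "(c * t)\<^sup>2 \<le> (cmod (z - 1))\<^sup>2"
      by (smt (verit) zero_le_power2)+
    then have ge: "c \<le> cmod (z - 1)" "c * t \<le> cmod (z - 1)"
      by (auto intro: power2_le_imp_le)
    have z1: "z - 1 \<noteq> 0" using ge(1) c by auto
    define K where "K = Res z u - scaleC (1 / (z - 1)) u"
    have pos: "0 \<le> norm u / c" "0 \<le> (N + 1) * norm c2" "0 \<le> N * norm y" using c N by auto
    have "norm K * (1 + t\<^sup>2) \<le> C"
    proof (cases "t \<le> 1")
      case True
      have Ru: "Res z u = scaleC z (Res z c2) - c2"
        using Res_B[OF zr, of "B x"]
        by (simp add: u_def c2_def Res_diff[OF zr] scaleC_add_left algebra_simps)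
      have "norm (Res z u) \<le> (N + 1) * norm c2"
        unfolding Ru using norm_triangle_ineq4[of "scaleC z (Res z c2)" c2] N(3)[OF zc, of c2]
        by (simp add: algebra_simps)
      moreover have "norm (scaleC (1 / (z - 1)) u) \<le> norm u / c"
        using ge(1) c by (simp add: norm_divide frac_le)
      ultimately have "norm K \<le> (N + 1) * norm c2 + norm u / c"
        unfolding K_def using norm_triangle_ineq4[of "Res z u" "scaleC (1 / (z - 1)) u"] by linarith
      moreover have "1 + t\<^sup>2 \<le> 2" using True t by (simp add: power_le_one)
      ultimately have "norm K * (1 + t\<^sup>2) \<le> ((N + 1) * norm c2 + norm u / c) * 2"
        using pos by (intro mult_mono) auto
      then show ?thesis using pos by (simp add: C_def algebra_simps)
    next
      case False
      have zRu: "scaleC z (Res z u) = u + Res z y"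
        using Res_A[OF zr uDom] by (simp add: Au)
      have "Res z u = scaleC (1 / z) (u + Res z y)"
        using cz by (simp flip: zRu)
      then have "K = scaleC (1 / z) (Res z y) - (scaleC (1 / (z - 1)) u - scaleC (1 / z) u)"
        by (simp add: K_def scaleC_add_right)
      also have "scaleC (1 / (z - 1)) u - scaleC (1 / z) u = scaleC (1 / (z * (z - 1))) u"
        unfolding scaleC.diff_left[symmetric] using cz z1 by (simp add: field_simps)
      finally have "norm K \<le> norm (scaleC (1 / z) (Res z y)) + norm (scaleC (1 / (z * (z - 1))) u)"
        by (simp only: norm_triangle_ineq4)
      moreover have "norm (scaleC (1 / z) (Res z y)) \<le> N * norm y / t\<^sup>2"
      proof -
        have "norm (Res z y) \<le> N * norm y / t"
          using N(3)[OF zc, of y] t cz by (simp add: field_simps)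
        then have "norm (Res z y) / t \<le> N * norm y / t / t"
          using t by (intro divide_right_mono) auto
        then show ?thesis using cz by (simp add: norm_divide power2_eq_square)
      qed
      moreover have "norm (scaleC (1 / (z * (z - 1))) u) \<le> norm u / c / t\<^sup>2"
      proof -
        have "t * (c * t) \<le> t * cmod (z - 1)" using ge(2) t by (intro mult_left_mono) auto
        then have "norm u / (t * cmod (z - 1)) \<le> norm u / (t * (c * t))"
          using c t by (intro frac_le) auto
        then show ?thesis using cz by (simp add: norm_divide norm_mult power2_eq_square mult_ac)
      qed
      ultimately have K: "norm K \<le> (norm u / c + N * norm y) / t\<^sup>2"
        by (simp add: add_divide_distrib)
      have "1 \<le> t\<^sup>2" using False by (simp add: one_le_power)
      then have "norm K * (1 + t\<^sup>2) \<le> norm K * (2 * t\<^sup>2)"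
        by (intro mult_left_mono) auto
      also have "\<dots> \<le> (norm u / c + N * norm y) / t\<^sup>2 * (2 * t\<^sup>2)"
        using K by (intro mult_right_mono) auto
      also have "\<dots> = 2 * (norm u / c + N * norm y)" using t by simp
      finally show ?thesis using pos by (simp add: C_def algebra_simps)
    qed
    then have "norm K \<le> C / (1 + t\<^sup>2)"
      by (subst pos_le_divide_eq) (auto simp: add_pos_nonneg)
    then show "norm (Res (of_real t * cis \<theta>) u - scaleC (1 / (of_real t * cis \<theta> - 1)) u) \<le> C / (1 + t\<^sup>2)"
      by (simp add: K_def z_def)
  qed
qed

text \<open>Of the three parts of the integrand, the first (\<open>J\<close>) and the third
  (\<open>E\<close>) agree on the two rays and drop out of the difference. The logarithmic part
  gives -i pi u and i pi u, hence 2 pi i u.\<close>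

lemma Phi_E_e0:
  assumes w: "\<omega> < w" "w < pi"
  shows "Phi_E Dom A w (\<lambda>z. z / (1 + z)\<^sup>2) x = B x - B (B x)"
proof -
  define d where "d = (\<omega> + w) / 2"
  define v where "v = (\<omega> + d) / 2"
  have d: "\<omega> < d" "d < w" using w by (auto simp: d_def)
  then have v: "\<omega> < v" "v < d" "0 \<le> v" "v < pi" "d < pi" "0 < d" "0 < w"
    using w omega_nonneg by (auto simp: v_def)
  define u where "u = B x - B (B x)"
  obtain C where C: "\<And>t \<theta>. t > 0 \<Longrightarrow> \<theta> \<in> {d..2 * pi - d} \<Longrightarrow>
    norm (Res (of_real t * cis \<theta>) u - scaleC (1 / (of_real t * cis \<theta> - 1)) u) \<le> C / (1 + t\<^sup>2)"
    using Res_minus_simple_pole_bound[OF v(1,2,5), of x] unfolding u_def[symmetric] by blast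
  obtain N where N: "\<And>z. z \<notin> csector v \<Longrightarrow> z \<in> resolvent_set Dom A"
    using resolvent_bound[OF v(1,4)] by blast
  have e0: "(\<lambda>z. z / (1 + z)\<^sup>2) \<in> Ecl w"
    using e0_mult_Ecl[OF v(7) w(2), of "\<lambda>_. 1" 1] by simp
  let ?K = "\<lambda>z. Res z u - scaleC (1 / (z - 1)) u"
  define J where "J \<theta> = integral {0<..} (\<lambda>t. scaleC (cis \<theta>) (?K (of_real t * cis \<theta>)))" for \<theta>
  define E where "E \<theta> = integral {0<..} (\<lambda>t::real. scaleC (of_real t * cis \<theta> / (1 + of_real t * cis \<theta>)\<^sup>2 / of_real t) (B x))" for \<theta>
  have z: "of_real t * cis \<theta> \<notin> csector v" "of_real t * cis \<theta> - 1 \<noteq> 0"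
    if "t > 0" "\<theta> \<in> {d..2 * pi - d}" for t \<theta>
  proof -
    show nc: "of_real t * cis \<theta> \<notin> csector v"
      using ray_notin_csector(1)[of v \<theta> t] that v by auto
    have "1 \<in> csector v" using v by (simp add: csector_def)
    then show "of_real t * cis \<theta> - 1 \<noteq> 0" using nc by auto
  qed
  have contK: "continuous_on ({d..2 * pi - d} \<times> {0<..}) (\<lambda>(\<theta>, t). - Res (of_real t * cis \<theta>) (Res (of_real t * cis \<theta>) u)
      - scaleC (- 1 / (of_real t * cis \<theta> - 1)\<^sup>2) u)"
  proof -
    let ?z = "\<lambda>p::real \<times> real. of_real (snd p) * cis (fst p)"
    have cz: "continuous_on ({d..2 * pi - d} \<times> {0<..}) ?z" by (intro continuous_intros)
    have cR: "continuous_on ({d..2 * pi - d} \<times> {0<..}) (\<lambda>p. Res (?z p) (y p))"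
      if "continuous_on ({d..2 * pi - d} \<times> {0<..}) y" for y
      by (rule continuous_on_Res[OF v(1,4) cz _ that], rule z(1)) auto
    have cs: "continuous_on ({d..2 * pi - d} \<times> {0<..}) (\<lambda>p. - 1 / (?z p - 1)\<^sup>2)"
    proof (intro continuous_on_divide continuous_on_power continuous_on_diff cz continuous_on_const ballI)
      fix p assume "p \<in> {d..2 * pi - d} \<times> {0::real<..}"
      then have "?z p - 1 \<noteq> 0" using z(2)[of "snd p" "fst p"] by auto
      then show "(?z p - 1)\<^sup>2 \<noteq> 0" by simp
    qed
    show ?thesis
      unfolding split_def
      by (intro continuous_on_diff continuous_on_minus cR continuous_on_scaleC cs continuous_on_const)
  qed
  \<comment> \<open>The ray of angle 2 pi - d is the ray of angle -d, reached from d through the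
    negative axis, where the resolvent exists.\<close>
  have J_eq: "J (2 * pi - d) = J d"
    unfolding J_def
  proof (rule ray_integral_shift_Lorentz[OF _ _ contK C])
    show "d \<le> 2 * pi - d" using v by simp
    fix t \<theta> :: real assume t: "t > 0" "\<theta> \<in> {d..2 * pi - d}"
    let ?z = "of_real t * cis \<theta>"
    have "((\<lambda>z. 1 / (z - 1)) has_field_derivative - 1 / (?z - 1)\<^sup>2) (at ?z)"
      using z(2)[OF t] by (auto intro!: derivative_eq_intros simp: power2_eq_square)
    from has_derivative_diff[OF has_derivative_Res[OF v(1,4) z(1)[OF t]] has_derivative_scaleC_const[OF this]]
    show "(?K has_derivative (\<lambda>k. scaleC k (- Res ?z (Res ?z u) - scaleC (- 1 / (?z - 1)\<^sup>2) u))) (at ?z)"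
      by (rule has_derivative_eq_rhs) (simp only: scaleC.diff_right)
  qed auto
  have cis2: "cis (2 * pi - d) = cis (- d)"
    by (simp add: complex_eq_iff cos_diff sin_diff)
  have J_eq': "J (- d) = J d"
    using J_eq unfolding J_def cis2 .
  have E_eq: "E d = E (- d)"
    unfolding E_def using v d by (intro integral_Ecl_over_ray_eq[OF e0 _ _ w(2)]) auto
  have ray: "rayint (\<lambda>z. z / (1 + z)\<^sup>2) x \<theta> = J \<theta> + scaleC (\<i> * of_real (\<eta> - \<theta>)) u + E \<theta>"
    if sg: "\<theta> = d \<or> \<theta> = - d" and et: "- pi < \<eta>" "\<eta> \<le> pi" "cis \<eta> = - cis \<theta>" for \<theta> \<eta>
  proof -
    have th: "- pi < \<theta>" "\<theta> < pi" "\<bar>\<theta>\<bar> < w" using sg v d by auto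
    have "sin d > 0" using v by (intro sin_gt_zero) auto
    then have sn: "sin \<theta> \<noteq> 0" using sg by auto
    \<comment> \<open>The bounds hold for angles in {d..2 pi - d}, so -d enters as 2 pi - d.\<close>
    define \<theta>' where "\<theta>' = (if \<theta> = d then d else 2 * pi - d)"
    have th': "cis \<theta> = cis \<theta>'" "\<theta>' \<in> {d..2 * pi - d}" using sg cis2 v by (auto simp: \<theta>'_def)
    note z' = z[OF _ th'(2), folded th'(1)]
    let ?z = "\<lambda>t. of_real t * cis \<theta>"
    have K: "(\<lambda>t. scaleC (cis \<theta>) (?K (?z t))) integrable_on {0<..}"
    proof (rule integrable_on_halfline[OF _ integrable_on_inverse_1_plus_square])
      have "continuous_on {0<..} (\<lambda>t. Res (?z t) u)"
        by (rule continuous_on_Res[OF v(1,4)]) (use z'(1) in \<open>auto intro!: continuous_intros\<close>)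
      then show "continuous_on {0<..} (\<lambda>t. scaleC (cis \<theta>) (?K (?z t)))"
        using z'(2) by (intro continuous_intros) auto
      show "norm (scaleC (cis \<theta>) (?K (?z t))) \<le> C / (1 + t\<^sup>2)" if "t > 0" for t
        using C[OF that th'(2)] th'(1) by simp
    qed
    note L = ray_integral_Ln[OF th(1,2) sn et]
    let ?s = "\<lambda>t::real. cis \<theta> * (1 / (?z t - 1) - 1 / (1 + ?z t))"
    have s: "(\<lambda>t. scaleC (?s t) u) integrable_on {0<..}"
      "integral {0<..} (\<lambda>t. scaleC (?s t) u) = scaleC (\<i> * of_real (\<eta> - \<theta>)) u"
      using integrable_linear[OF L(1) scaleC.bounded_linear_left, of u]
        integral_linear[OF L(1) scaleC.bounded_linear_left, of u] L(2) by (simp_all add: o_def)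
    have e: "(\<lambda>t. scaleC (?z t / (1 + ?z t)\<^sup>2 / of_real t) (B x)) integrable_on {0<..}"
    proof (rule integrable_on_halfline)
      have c: "continuous_on {0<..} (\<lambda>t. ?z t / (1 + ?z t)\<^sup>2)"
        using continuous_on_ray[OF holomorphic_on_imp_continuous_on[OF Ecl_holomorphic[OF e0]] th(3)] w by simp
      show "continuous_on {0<..} (\<lambda>t. scaleC (?z t / (1 + ?z t)\<^sup>2 / of_real t) (B x))"
        by (rule continuous_on_scaleC[OF continuous_on_divide[OF c] continuous_on_const])
           (auto intro!: continuous_intros)
      show "(\<lambda>t. cmod (?z t / (1 + ?z t)\<^sup>2) / t * norm (B x)) integrable_on {0<..}"
        by (intro integrable_on_mult_left Ecl_ray_integrable[OF e0 th(3)])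
    qed (simp add: norm_divide norm_mult)
    have "rayint (\<lambda>z. z / (1 + z)\<^sup>2) x \<theta> = integral {0<..} (\<lambda>t. scaleC (cis \<theta>) (?K (?z t)) + scaleC (?s t) u
        + scaleC (?z t / (1 + ?z t)\<^sup>2 / of_real t) (B x))"
      unfolding rayint_def
    proof (rule integral_cong)
      fix t :: real assume "t \<in> {0<..}"
      then have t: "t > 0" by simp
      have "?z t \<in> sector w" using th w t by (intro ray_in_sector) auto
      then have nz: "1 + ?z t \<noteq> 0" "?z t \<noteq> 0" using one_plus_sector[of "?z t" w] w t by auto
      have "scaleC (?z t / (1 + ?z t)\<^sup>2 * cis \<theta>) (Res (?z t) x)
          = scaleC (cis \<theta>) (scaleC (?z t / (1 + ?z t)\<^sup>2) (Res (?z t) x))"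
        by (simp only: scaleC_scaleC mult.commute)
      also have "\<dots> = scaleC (cis \<theta>) (?K (?z t)) + scaleC (?s t) u
          + scaleC (cis \<theta> * (?z t / (1 + ?z t)\<^sup>2 / ?z t)) (B x)"
        unfolding e0_Res_decomposition[OF N[OF z'(1)[OF t]] nz, of x, folded u_def]
        by (simp only: scaleC_add_right scaleC_scaleC)
      also have "cis \<theta> * (?z t / (1 + ?z t)\<^sup>2 / ?z t) = ?z t / (1 + ?z t)\<^sup>2 / of_real t"
        using t by simp
      finally show "scaleC (?z t / (1 + ?z t)\<^sup>2 * cis \<theta>) (Res (?z t) x) = scaleC (cis \<theta>) (?K (?z t)) + scaleC (?s t) u
        + scaleC (?z t / (1 + ?z t)\<^sup>2 / of_real t) (B x)" .
    qed
    also have "\<dots> = J \<theta> + scaleC (\<i> * of_real (\<eta> - \<theta>)) u + E \<theta>"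
      by (simp only: integral_add[OF integrable_add[OF K s(1)] e] integral_add[OF K s(1)] s(2) J_def E_def)
    finally show ?thesis .
  qed
  \<comment> \<open>The principal argument of -cis d is d - pi, and that of -cis(-d) is pi - d, so
    \<eta> - \<theta> is -pi and pi respectively.\<close>
  have "rayint (\<lambda>z. z / (1 + z)\<^sup>2) x d = J d + scaleC (\<i> * of_real ((d - pi) - d)) u + E d"
    using v by (intro ray) (auto simp: complex_eq_iff cos_diff sin_diff)
  moreover have "rayint (\<lambda>z. z / (1 + z)\<^sup>2) x (- d) = J (- d) + scaleC (\<i> * of_real ((pi - d) - - d)) u + E (- d)"
    using v by (intro ray) (auto simp: complex_eq_iff cos_diff sin_diff)
  ultimately have "rayint (\<lambda>z. z / (1 + z)\<^sup>2) x (- d) - rayint (\<lambda>z. z / (1 + z)\<^sup>2) x d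
      = scaleC (2 * pi * \<i>) u"
    unfolding J_eq' E_eq by (simp add: scaleC.diff_left[symmetric] mult_ac)
  then show ?thesis
    unfolding Phi_E_rayint d_def[symmetric] u_def[symmetric] by simp
qed

section \<open>The extended and the sectorial calculus\<close>

text \<open>Makes the definite description in \<open>Phi_e\<close> usable: the decomposition is
  unique on the sector, and \<open>Phi_E\<close> sees h only on two rays inside it.\<close>

lemma Phi_e_eq:
  assumes w: "\<omega> < w" "w < pi" and h: "h \<in> Ecl w"
    and ev: "\<And>z0. z0 \<in> sector w \<Longrightarrow> \<forall>\<^sub>F z in at z0. g z = h z + a + b / (1 + z)"
  shows "Phi_e Dom A w g = (\<lambda>x. Phi_E Dom A w h x + scaleC a x + scaleC b (B x))"
  unfolding Phi_e_def
proof (rule the_equality)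
  show "\<exists>h' a' b'. h' \<in> Ecl w \<and> (\<forall>z0\<in>sector w. \<forall>\<^sub>F z in at z0. g z = h' z + a' + b' / (1 + z)) \<and>
      (\<lambda>x. Phi_E Dom A w h x + scaleC a x + scaleC b (B x))
      = (\<lambda>x. Phi_E Dom A w h' x + scaleC a' x + scaleC b' (B x))"
    using h ev by blast
  fix T assume "\<exists>h' a' b'. h' \<in> Ecl w \<and> (\<forall>z0\<in>sector w. \<forall>\<^sub>F z in at z0. g z = h' z + a' + b' / (1 + z)) \<and>
      T = (\<lambda>x. Phi_E Dom A w h' x + scaleC a' x + scaleC b' (B x))"
  then obtain h' a' b' where h': "h' \<in> Ecl w"
    and ev': "\<And>z0. z0 \<in> sector w \<Longrightarrow> \<forall>\<^sub>F z in at z0. g z = h' z + a' + b' / (1 + z)"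
    and T: "T = (\<lambda>x. Phi_E Dom A w h' x + scaleC a' x + scaleC b' (B x))" by blast
  have w0: "0 < w" using w omega_nonneg by simp
  have "\<forall>\<^sub>F z in at z0. h z + a + b / (1 + z) = h' z + a' + b' / (1 + z)" if "z0 \<in> sector w" for z0
    using ev[OF that] ev'[OF that] by eventually_elim simp
  note uniq = Ecl_decomposition_unique[OF w0 w(2) h h' this]
  have "rayint h x \<theta> = rayint h' x \<theta>" if "\<bar>\<theta>\<bar> < w" for x \<theta>
    unfolding rayint_def
  proof (rule integral_cong)
    fix t :: real assume "t \<in> {0<..}"
    then have "h (of_real t * cis \<theta>) = h' (of_real t * cis \<theta>)"
      using w that by (intro uniq(3) ray_in_sector) auto
    then show "scaleC (h (of_real t * cis \<theta>) * cis \<theta>) (Res (of_real t * cis \<theta>) x)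
        = scaleC (h' (of_real t * cis \<theta>) * cis \<theta>) (Res (of_real t * cis \<theta>) x)" by simp
  qed
  then have "Phi_E Dom A w h x = Phi_E Dom A w h' x" for x
    unfolding Phi_E_rayint using w w0 omega_nonneg by simp
  then show "T = (\<lambda>x. Phi_E Dom A w h x + scaleC a x + scaleC b (B x))"
    unfolding T using uniq(1,2) by simp
qed

lemma Phi_e_Ecl:
  assumes "\<omega> < w" "w < pi" "h \<in> Ecl w"
  shows "h \<in> Ee w" "Phi_e Dom A w h = Phi_E Dom A w h"
proof -
  have "\<forall>\<^sub>F z in at z0. h z = h z + 0 + 0 / (1 + z)" for z0 by simp
  then show "h \<in> Ee w" "Phi_e Dom A w h = Phi_E Dom A w h"
    using Phi_e_eq[OF assms, of h 0 0] assms(3) unfolding Ee_def by fastforce+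
qed

text \<open>The regulariser z/(1+z)^2 belongs to \<open>regs\<close> on the sector w' provided by
  the calculus. The graph condition for it is the product formula, and the left side is then carried
  over to w.\<close>

lemma Phi_sect_e0:
  assumes w: "w < pi" and f: "f holomorphic_on sector w" "\<And>z. z \<in> sector w \<Longrightarrow> cmod (f z) \<le> M"
    and S: "Phi_sect_is Dom A w f S"
  shows "Phi_E Dom A w (\<lambda>z. z / (1 + z)\<^sup>2 * f z) x = B (S x) - B (B (S x))"
proof -
  obtain w' where w': "\<omega> < w'" "w' \<le> w" and gr: "graph_Phi_w Dom A w' f = {(x, S x) | x. True}"
    using S unfolding Phi_sect_is_def by blast
  have w0: "0 < w'" "w' < pi" using w w' omega_nonneg by auto
  have f': "f holomorphic_on sector w'" "\<And>z. z \<in> sector w' \<Longrightarrow> cmod (f z) \<le> M"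
    using f sector_mono[OF w'(2)] by (auto intro: holomorphic_on_subset)
  have e: "(\<lambda>z. z / (1 + z)\<^sup>2) \<in> Ecl w'" "(\<lambda>z. z / (1 + z)\<^sup>2 * f z) \<in> Ecl w'"
    using e0_mult_Ecl[OF w0, of "\<lambda>_. 1" 1] e0_mult_Ecl[OF w0 f'] by simp_all
  note E = Phi_e_Ecl[OF w'(1) w0(2) e(1)] Phi_e_Ecl[OF w'(1) w0(2) e(2)]
  have "(x, S x) \<in> graph_Phi_w Dom A w' f" unfolding gr by blast
  moreover have "(\<lambda>z. z / (1 + z)\<^sup>2) \<in> regs w' f" using E(1,3) by (simp add: regs_def)
  ultimately have "Phi_E Dom A w' (\<lambda>z. z / (1 + z)\<^sup>2 * f z) x = Phi_E Dom A w' (\<lambda>z. z / (1 + z)\<^sup>2) (S x)"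
    unfolding graph_Phi_w_def using E(2,4) by fastforce
  then show ?thesis
    by (simp only: Phi_E_e0_mult[OF w f w'] Phi_E_e0[OF w'(1) w0(2)])
qed

text \<open>The kernel vector y serves only to select a regulariser e with \<Phi>(e) y \<noteq> 0.
  As \<Phi>(e) acts on y as a + b, this sum is nonzero. Modulo \<open>clran\<close>, \<Phi>(e) and
  \<Phi>(e f) act on every vector as a + b and as a' + b' = (a + b) l, and division by a + b gives
  the claim.\<close>

lemma Phi_sect_mod_clran:
  assumes w: "w < pi" and f: "f holomorphic_on sector w" "\<And>z. z \<in> sector w \<Longrightarrow> cmod (f z) \<le> M"
      "((\<lambda>t::real. f (of_real t)) \<longlongrightarrow> l) (at_right 0)"
    and S: "Phi_sect_is Dom A w f S" and y: "B y = y" "y \<noteq> 0"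
  shows "S x - scaleC l x \<in> clran"
proof -
  obtain w' where w': "\<omega> < w'" "w' \<le> w" and dom: "dom_Phi_w Dom A w' f"
    and gr: "graph_Phi_w Dom A w' f = {(x, S x) | x. True}"
    using S unfolding Phi_sect_is_def by blast
  have w0: "0 < w'" "w' < pi" using w w' omega_nonneg by auto
  have f': "f holomorphic_on sector w'" "\<And>z. z \<in> sector w' \<Longrightarrow> cmod (f z) \<le> M"
    using f sector_mono[OF w'(2)] by (auto intro: holomorphic_on_subset)
  obtain e where e: "e \<in> regs w' f" "Phi_e Dom A w' e y \<noteq> 0"
    using dom y(2) unfolding dom_Phi_w_def by blast
  obtain h a b where h: "h \<in> Ecl w'"
    "\<And>z0. z0 \<in> sector w' \<Longrightarrow> \<forall>\<^sub>F z in at z0. e z = h z + a + b / (1 + z)"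
    using e(1) unfolding regs_def Ee_def by blast
  obtain h' a' b' where h': "h' \<in> Ecl w'"
    "\<And>z0. z0 \<in> sector w' \<Longrightarrow> \<forall>\<^sub>F z in at z0. e z * f z = h' z + a' + b' / (1 + z)"
    using e(1) unfolding regs_def Ee_def by blast
  have Phi: "Phi_e Dom A w' e = (\<lambda>x. Phi_E Dom A w' h x + scaleC a x + scaleC b (B x))"
    "Phi_e Dom A w' (\<lambda>z. e z * f z) = (\<lambda>x. Phi_E Dom A w' h' x + scaleC a' x + scaleC b' (B x))"
    by (rule Phi_e_eq[OF w'(1) w0(2) h(1) h(2)] Phi_e_eq[OF w'(1) w0(2) h'(1) h'(2)]; assumption)+
  have lim: "(a + b) * l = a' + b'"
  proof (rule Ecl_decomposition_limit[OF w0 h(1) h'(1) f' f(3)])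
    show "\<forall>\<^sub>F z in at z0. (h z + a + b / (1 + z)) * f z = h' z + a' + b' / (1 + z)"
      if "z0 \<in> sector w'" for z0
      using h(2)[OF that] h'(2)[OF that] by eventually_elim simp
  qed
  have "Phi_e Dom A w' e y = scaleC (a + b) y"
    unfolding Phi using Phi_E_kernel[OF h(1) w'(1) w0(2) y(1)] by (simp add: y(1) scaleC_add_left)
  then have nz: "a + b \<noteq> 0" using e(2) by auto
  \<comment> \<open>The coefficient of B v may be moved to v, because v - B v lies in
    \<open>clran\<close>.\<close>
  have mod: "\<exists>r\<in>clran. Phi_E Dom A w' k v + scaleC c v + scaleC c' (B v) = scaleC (c + c') v + r"
    if "k \<in> Ecl w'" for k v c c'
  proof
    show "Phi_E Dom A w' k v - scaleC c' (v - B v) \<in> clran"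
      by (intro subspace_diff[OF subspace_clran] scaleC_clran diff_B_in_clran Phi_E_in_clran that w' w0)
  qed (simp add: scaleC_add_left scaleC.diff_right)
  have "(x, S x) \<in> graph_Phi_w Dom A w' f" unfolding gr by blast
  then have eq: "Phi_e Dom A w' (\<lambda>z. e z * f z) x = Phi_e Dom A w' e (S x)"
    using e(1) unfolding graph_Phi_w_def by blast
  obtain r r' where r: "r \<in> clran" "r' \<in> clran" "scaleC (a' + b') x + r' = scaleC (a + b) (S x) + r"
    using eq mod[OF h(1), where v = "S x" and c = a and c' = b]
      mod[OF h'(1), where v = x and c = a' and c' = b'] unfolding Phi by metis
  have "scaleC (a + b) (S x - scaleC l x) = r' - r"
    using r(3) by (simp add: lim[symmetric] scaleC.diff_right algebra_simps)
  then have "scaleC (1 / (a + b)) (scaleC (a + b) (S x - scaleC l x)) = scaleC (1 / (a + b)) (r' - r)"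
    by simp
  then have "S x - scaleC l x = scaleC (1 / (a + b)) (r' - r)"
    using nz by (simp only: scaleC_scaleC) simp
  then show ?thesis
    using r by (simp add: scaleC_clran subspace_diff[OF subspace_clran])
qed

end

theorem theorem11p4:
  fixes Dom :: "'a::complex_banach set" and A :: "'a \<Rightarrow> 'a"
    and w :: real and f :: "nat \<Rightarrow> complex \<Rightarrow> complex"
    and S :: "nat \<Rightarrow> 'a \<Rightarrow> 'a" and T :: "'a \<Rightarrow> 'a"
  assumes "sectorial Dom A"
    and "omega_se Dom A < w" and "w < pi"
    and "\<And>n. f n \<in> Hinf0 w"
    and "\<And>z. z \<in> sector w \<union> {0} \<Longrightarrow> (\<lambda>n. f n z) \<longlonglongrightarrow> 0"
    and "\<exists>M. \<forall>n. \<forall>z\<in>sector w. cmod (f n z) \<le> M"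
    and "\<And>n. cblin (S n)"
    and "\<And>n. Phi_sect_is Dom A w (f n) (S n)"
    and "T \<in> comm_alg Dom A"
    and "tau_conv Dom A S T"
  shows "T = (\<lambda>x. 0)"
proof -
  interpret sectorial_operator Dom A by unfold_locales (rule assms(1))
  obtain M where M: "\<And>n z. z \<in> sector w \<Longrightarrow> cmod (f n z) \<le> M" using assms(6) by blast
  have hol: "f n holomorphic_on sector w"
    and f0: "((\<lambda>t::real. f n (of_real t)) \<longlongrightarrow> f n 0) (at_right 0)" for n
    using assms(4)[of n] by (auto simp: Hinf0_def)
  obtain \<D> where \<D>: "\<D> \<subseteq> comm_alg' Dom A" "\<forall>x. (\<forall>D\<in>\<D>. D x = 0) \<longrightarrow> x = 0"
    "\<forall>D\<in>\<D>. \<forall>x. (\<lambda>n. D (S n x)) \<longlonglongrightarrow> D (T x)"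
    using assms(10) unfolding tau_conv_def by (elim conjE exE)
  have "T x = 0" for x
  proof (rule \<D>(2)[rule_format])
    fix D assume D: "D \<in> \<D>"
    have cD: "cblin D" and DB: "D (B v) = B (D v)" for v
    proof -
      have "D \<in> comm_alg' Dom A" using D \<D>(1) by blast
      then have "cblin D" "D \<circ> B = B \<circ> D" using B_comm_alg by (auto simp: comm_alg'_def)
      then show "cblin D" "D (B v) = B (D v)" by (simp_all add: fun_eq_iff)
    qed
    interpret D: bounded_linear D using cD by (simp add: cblin_def)
    interpret BL: bounded_linear B using cblin_B by (simp add: cblin_def)
    have conv: "(\<lambda>n. D (S n x)) \<longlonglongrightarrow> D (T x)" using \<D>(3) D by simp
    have "(\<lambda>n. Phi_E Dom A w (\<lambda>z. z / (1 + z)\<^sup>2 * f n z) x) \<longlonglongrightarrow> 0"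
      by (rule Phi_E_e0_mult_tendsto_0[OF assms(2,3) hol M]) (use assms(5) in auto)
    moreover have "Phi_E Dom A w (\<lambda>z. z / (1 + z)\<^sup>2 * f n z) x = B (S n x) - B (B (S n x))" for n
      by (rule Phi_sect_e0[OF assms(3) hol M assms(8)])
    ultimately have "(\<lambda>n. D (B (S n x) - B (B (S n x)))) \<longlonglongrightarrow> D 0"
      by (simp only: D.tendsto)
    then have "(\<lambda>n. B (D (S n x)) - B (B (D (S n x)))) \<longlonglongrightarrow> 0"
      by (simp add: D.diff DB D.zero)
    moreover have "(\<lambda>n. B (D (S n x)) - B (B (D (S n x)))) \<longlonglongrightarrow> B (D (T x)) - B (B (D (T x)))"
      by (intro tendsto_diff BL.tendsto conv)
    ultimately have "B (D (T x)) - B (B (D (T x))) = 0"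
      by (rule LIMSEQ_unique[rotated])
    \<comment> \<open>B - B^2 factors as B (I - B), and B is injective.\<close>
    then have "B (D (T x) - B (D (T x))) = 0" by (simp only: B_diff)
    from B_eq_0[OF this] have ker: "B (D (T x)) = D (T x)" by simp
    \<comment> \<open>If nonzero, D T x is itself the kernel vector that
      \<open>Phi_sect_mod_clran\<close> asks for, so the case of injective A needs no separate
      treatment.\<close>
    show "D (T x) = 0"
    proof (rule ccontr)
      assume nz: "D (T x) \<noteq> 0"
      have mod: "D (S n x - scaleC (f n 0) x) \<in> clran" for n
      proof (rule clran_invariant[OF cD DB])
        show "S n x - scaleC (f n 0) x \<in> clran"
          by (rule Phi_sect_mod_clran[OF assms(3) hol M f0 assms(8) ker nz])
      qed
      \<comment> \<open>Here the convergence at the point 0 enters: f n(0) \<rightarrow> 0 removes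
        the scalar term, and the limit stays in the closed \<open>clran\<close>.\<close>
      have "(\<lambda>n. D (S n x - scaleC (f n 0) x)) \<longlonglongrightarrow> D (T x) - D (scaleC 0 x)"
        unfolding D.diff using assms(5)[of 0]
        by (intro tendsto_diff conv D.tendsto scaleC.tendsto tendsto_const) auto
      then have "(\<lambda>n. D (S n x - scaleC (f n 0) x)) \<longlonglongrightarrow> D (T x)"
        by (simp add: D.zero)
      then have "D (T x) \<in> clran"
        by (rule closed_sequentially[OF closed_clran mod])
      from clran_Int_kernel[OF this ker] nz show False by simp
    qed
  qed
  then show ?thesis by (simp add: fun_eq_iff)
qed

end
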